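(* Let $\tau\colon B\to D$ and $\pi\colon C\to D$ be $*$-homomorphisms of $C^*$-algebras with $\pi$ surjective, and let $A$, with $*$-homomorphisms $\eta\colon A\to B$ and $\rho\colon A\to C$, $\tau\circ\eta=\pi\circ\rho$, be a pullback, i.e. $(\eta,\rho)$ is an isomorphism of $A$ onto $B\oplus_D C=\{(b,c)\in B\oplus C:\tau(b)=\pi(c)\}$ (so $\eta$ is also surjective). Then: (i) $\operatorname{tsr}(A)\le\max(\operatorname{tsr}(B),\operatorname{tsr}(C))$. (ii) If $B$ and $C$ have real rank zero, then $A$ has real rank zero. (iii) If $B$ and $C$ (hence also $D$) are extremally rich, then: $A$ is extremally rich and $\rho$ is extreme-point-preserving if and only if $\tau$ is extreme-point-preserving.
   Context: $\widetilde B$ denotes the unitization of $B$ ($\widetilde B=B$ if $B$ is unital). For unital $B$: $\operatorname{tsr}(B)$ is the smallest $d\ge1$ (or $\infty$) such that the tuples $(x_1,\dots,x_d)$ with $\sum x_k^*x_k$ invertible are dense in $B^d$; $B$ has real rank zero if the invertible self-adjoint elements are dense in $B_{\mathrm{sa}}$. For non-unital $B$ these are defined via $\widetilde B$. For unital $B$ let $\mathcal E(B)$ be the set of extreme points of the closed unit ball and $B_q^{-1}=B^{-1}\mathcal E(B)B^{-1}$, with $B^{-1}$ the invertible elements. $B$ is extremally rich if $B_q^{-1}$ is dense in $B$; a non-unital $B$ is extremally rich if $\widetilde B$ is. A unital $*$-homomorphism $\varphi\colon B\to D$ of unital $C^*$-algebras is extreme-point-preserving (e.p.p.) if $\varphi(\mathcal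 E(B))\subset\mathcal E(D)$. In the non-unital situation, the property is understood after forced unitization: one replaces $\varphi$ by $\varphi^+\colon B^+\to D^+$, where $B^+$ is $B$ with a new unit adjoined (even if $B$ is already unital) and $\varphi^+$ is the unital extension of $\varphi$. For unital $\varphi$ the two definitions agree. *)

theory Defs
  imports "HOL-Analysis.Analysis" "HOL-Library.Extended_Nat"
begin

section \<open>C*-algebras\<close>

class scaleC =
  fixes scaleC :: "complex \<Rightarrow> 'a \<Rightarrow> 'a"  (infixr \<open>*\<^sub>C\<close> 75)

class star =
  fixes star :: "'a \<Rightarrow> 'a"

text \<open>
  A type of class \<open>cstar_algebra\<close> is a complex C*-algebra, with or without a unit; the zero algebra
  is allowed, and is unital. A unit is not part of the structure (hence no \<open>1\<close>): being unital is
  a property of the type.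
\<close>

class cstar_algebra = real_normed_algebra + banach + scaleC + star +
  assumes scaleC_add_right: "c *\<^sub>C (x + y) = c *\<^sub>C x + c *\<^sub>C y"
    and scaleC_add_left: "(c + d) *\<^sub>C x = c *\<^sub>C x + d *\<^sub>C x"
    and scaleC_scaleC: "c *\<^sub>C d *\<^sub>C x = (c * d) *\<^sub>C x"
    and scaleC_of_real: "complex_of_real r *\<^sub>C x = r *\<^sub>R x"
    and mult_scaleC_left: "(c *\<^sub>C x) * y = c *\<^sub>C (x * y)"
    and mult_scaleC_right: "x * (c *\<^sub>C y) = c *\<^sub>C (x * y)"
    and norm_scaleC: "norm (c *\<^sub>C x) = cmod c * norm x"
    and star_star: "star (star x) = x"
    and star_add: "star (x + y) = star x + star y"
    and star_scaleC: "star (c *\<^sub>C x) = cnj c *\<^sub>C star x"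
    and star_mult: "star (x * y) = star y * star x"
    and cstar_identity: "norm (star x * x) = (norm x)\<^sup>2"

definition star_hom :: "('a::cstar_algebra \<Rightarrow> 'b::cstar_algebra) \<Rightarrow> bool" where
  "star_hom f \<longleftrightarrow>
     (\<forall>x y. f (x + y) = f x + f y) \<and> (\<forall>c x. f (c *\<^sub>C x) = c *\<^sub>C f x) \<and>
     (\<forall>x y. f (x * y) = f x * f y) \<and> (\<forall>x. f (star x) = star (f x))"

definition is_unit_elem :: "'a::cstar_algebra \<Rightarrow> bool" where
  "is_unit_elem e \<longleftrightarrow> (\<forall>x. e * x = x \<and> x * e = x)"

definition unital :: "'a::cstar_algebra itself \<Rightarrow> bool" where
  "unital (_ :: 'a itself) \<longleftrightarrow> (\<exists>e::'a. is_unit_elem e)"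

text \<open>The notions from here to \<open>extremally_rich_unital\<close> are meaningful for unital algebras only.\<close>

definition the_unit :: "'a::cstar_algebra" where
  "the_unit = (THE e. is_unit_elem e)"

definition invertibles :: "'a::cstar_algebra set" where
  "invertibles = {x. \<exists>y. x * y = the_unit \<and> y * x = the_unit}"

definition tsr_unital :: "'a::cstar_algebra itself \<Rightarrow> enat" where
  "tsr_unital (_ :: 'a itself) =
     Inf {enat d | d. d \<ge> 1 \<and>
       (\<forall>(x :: nat \<Rightarrow> 'a) \<epsilon>. \<epsilon> > 0 \<longrightarrow>
          (\<exists>y. (\<forall>k<d. norm (x k - y k) < \<epsilon>) \<and> (\<Sum>k<d. star (y k) * y k) \<in> invertibles))}"

definition self_adjoints :: "'a::cstar_algebra set" where
  "self_adjoints = {x. star x = x}"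

definition real_rank_zero_unital :: "'a::cstar_algebra itself \<Rightarrow> bool" where
  "real_rank_zero_unital (_ :: 'a itself) \<longleftrightarrow>
     (self_adjoints :: 'a set) \<subseteq> closure (invertibles \<inter> self_adjoints)"

definition extremes :: "'a::cstar_algebra set" where
  "extremes = {v. v extreme_point_of cball 0 1}"

definition quasi_invertibles :: "'a::cstar_algebra set" where
  "quasi_invertibles = {x * v * y | x v y. x \<in> invertibles \<and> v \<in> extremes \<and> y \<in> invertibles}"

definition extremally_rich_unital :: "'a::cstar_algebra itself \<Rightarrow> bool" where
  "extremally_rich_unital (_ :: 'a itself) \<longleftrightarrow> closure quasi_invertibles = (UNIV :: 'a set)"


section \<open>Forced unitization\<close>

text \<open>
  \<open>Unitization b c\<close> is the element \<open>b + c 1\<close> of \<open>B\<^sup>+\<close>, where \<open>1\<close> is a new unit even if \<open>B\<close> has one.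
  Its left multiplication on \<open>B\<close> has operator norm at least \<open>\<bar>c\<bar>\<close> when \<open>B\<close> is not unital; if \<open>B\<close> is
  unital then \<open>B\<^sup>+\<close> is isomorphic to the direct sum of \<open>B\<close> and the scalars via \<open>(b + c 1\<^sub>B, c)\<close>. In both
  cases the maximum below is the unique C*-norm.
\<close>

datatype 'a unitization = Unitization (base: 'a) (scalar: complex)

lemma unitization_eq_iff: "u = v \<longleftrightarrow> base u = base v \<and> scalar u = scalar v"
  by (cases u; cases v) auto

definition lmult :: "'a::cstar_algebra unitization \<Rightarrow> 'a \<Rightarrow> 'a" where
  "lmult u x = base u * x + scalar u *\<^sub>C x"

lemma scaleC_zero_right [simp]: "c *\<^sub>C (0::'a::cstar_algebra) = 0"
  using scaleC_add_right[of c 0 "0::'a"] by simp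

lemma scaleC_zero_left [simp]: "0 *\<^sub>C (x::'a::cstar_algebra) = 0"
  using scaleC_add_left[of 0 0 x] by simp

lemma scaleC_one [simp]: "1 *\<^sub>C (x::'a::cstar_algebra) = x"
  using scaleC_of_real[of 1 x] by simp

lemma scaleC_minus_left: "(- c) *\<^sub>C (x::'a::cstar_algebra) = - (c *\<^sub>C x)"
  using scaleC_add_left[of c "- c" x] by (simp add: eq_neg_iff_add_eq_0 add.commute)

lemma scaleR_as_scaleC: "r *\<^sub>R (x::'a::cstar_algebra) = complex_of_real r *\<^sub>C x"
  by (simp add: scaleC_of_real)

lemma scaleC_commute: "c *\<^sub>C d *\<^sub>C (x::'a::cstar_algebra) = d *\<^sub>C c *\<^sub>C x"
  by (simp add: scaleC_scaleC mult.commute)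

lemma norm_star [simp]: "norm (star x) = norm (x::'a::cstar_algebra)"
proof -
  have "norm z \<le> norm (star z)" for z :: 'a
  proof (cases "norm z = 0")
    case False
    have "norm z * norm z \<le> norm (star z) * norm z"
      using norm_mult_ineq[of "star z" z] by (simp add: cstar_identity power2_eq_square)
    then show ?thesis using False by simp
  qed simp
  from this[of x] this[of "star x"] show ?thesis by (simp add: star_star)
qed

lemma bounded_linear_lmult: "bounded_linear (lmult (u :: 'a::cstar_algebra unitization))"
proof (rule bounded_linear_intro[where K = "norm (base u) + cmod (scalar u)"])
  show "norm (lmult u x) \<le> norm x * (norm (base u) + cmod (scalar u))" for x
  proof -
    have "norm (lmult u x) \<le> norm (base u * x) + norm (scalar u *\<^sub>C x)"
      unfolding lmult_def by (rule norm_triangle_ineq)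
    also have "\<dots> \<le> norm (base u) * norm x + cmod (scalar u) * norm x"
      using norm_mult_ineq[of "base u" x] by (simp add: norm_scaleC)
    finally show ?thesis by (simp add: algebra_simps)
  qed
qed (simp_all add: lmult_def scaleC_add_right distrib_left scaleR_as_scaleC mult_scaleC_right
       scaleC_commute)

instantiation unitization :: (cstar_algebra) scaleC
begin
definition scaleC_unitization :: "complex \<Rightarrow> 'a unitization \<Rightarrow> 'a unitization" where
  "c *\<^sub>C u = Unitization (c *\<^sub>C base u) (c * scalar u)"
instance ..
end

instantiation unitization :: (cstar_algebra) star
begin
definition star_unitization :: "'a unitization \<Rightarrow> 'a unitization" where
  "star u = Unitization (star (base u)) (cnj (scalar u))"
instance ..
end

instantiation unitization :: (cstar_algebra) real_normed_algebra
begin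

definition zero_unitization :: "'a unitization" where
  "0 = Unitization 0 0"
definition plus_unitization :: "'a unitization \<Rightarrow> 'a unitization \<Rightarrow> 'a unitization" where
  "u + v = Unitization (base u + base v) (scalar u + scalar v)"
definition uminus_unitization :: "'a unitization \<Rightarrow> 'a unitization" where
  "- u = Unitization (- base u) (- scalar u)"
definition minus_unitization :: "'a unitization \<Rightarrow> 'a unitization \<Rightarrow> 'a unitization" where
  "u - v = Unitization (base u - base v) (scalar u - scalar v)"
definition times_unitization :: "'a unitization \<Rightarrow> 'a unitization \<Rightarrow> 'a unitization" where
  "u * v = Unitization (base u * base v + scalar u *\<^sub>C base v + scalar v *\<^sub>C base u)
             (scalar u * scalar v)"
definition scaleR_unitization :: "real \<Rightarrow> 'a unitization \<Rightarrow> 'a unitization" where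
  "r *\<^sub>R u = Unitization (r *\<^sub>R base u) (r *\<^sub>R scalar u)"
definition norm_unitization :: "'a unitization \<Rightarrow> real" where
  "norm u = max (onorm (lmult u)) (cmod (scalar u))"
definition sgn_unitization :: "'a unitization \<Rightarrow> 'a unitization" where
  "sgn (u :: 'a unitization) = inverse (norm u) *\<^sub>R u"
definition dist_unitization :: "'a unitization \<Rightarrow> 'a unitization \<Rightarrow> real" where
  "dist (u :: 'a unitization) v = norm (u - v)"
definition uniformity_unitization :: "('a unitization \<times> 'a unitization) filter" where
  "uniformity = (INF e\<in>{0 <..}. principal {(u :: 'a unitization, v). dist u v < e})"
definition open_unitization :: "'a unitization set \<Rightarrow> bool" where
  "open (U :: 'a unitization set) \<longleftrightarrow> (\<forall>u\<in>U. eventually (\<lambda>(u', v). u' = u \<longrightarrow> v \<in> U) uniformity)"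

lemmas unitization_defs = zero_unitization_def plus_unitization_def uminus_unitization_def
  minus_unitization_def times_unitization_def scaleR_unitization_def scaleC_unitization_def
  star_unitization_def

lemma lmult_plus: "lmult (u + v) = (\<lambda>x. lmult u x + lmult v (x::'a))"
  by (auto simp: lmult_def unitization_defs algebra_simps scaleC_add_left)

lemma lmult_scaleC: "lmult (c *\<^sub>C u) = (\<lambda>x. c *\<^sub>C lmult u (x::'a))"
  by (auto simp: lmult_def unitization_defs mult_scaleC_left scaleC_add_right scaleC_scaleC)

lemma lmult_times: "lmult (u * v) = lmult u \<circ> lmult (v :: 'a unitization)"
  by (auto simp: lmult_def unitization_defs algebra_simps mult_scaleC_left mult_scaleC_right
        scaleC_add_right scaleC_scaleC)

lemma star_lmult: "star (lmult u x) * y = star x * lmult (star u) (y::'a)"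
  by (simp add: lmult_def unitization_defs star_add star_mult star_scaleC algebra_simps
        mult_scaleC_left mult_scaleC_right)

lemma norm_base_le: "norm (base u) \<le> onorm (lmult (Unitization (base u :: 'a) 0))"
proof (cases "norm (base u) = 0")
  case True
  then show ?thesis using onorm_pos_le[OF bounded_linear_lmult] by simp
next
  case False
  let ?b = "base u" and ?L = "lmult (Unitization (base u) 0)"
  have "norm (?L (star ?b)) = norm ?b * norm ?b"
    using cstar_identity[of "star ?b"] by (simp add: lmult_def star_star power2_eq_square)
  moreover have "norm (?L (star ?b)) \<le> onorm ?L * norm ?b"
    using onorm[OF bounded_linear_lmult, of "Unitization ?b 0" "star ?b"] by simp
  ultimately show ?thesis using False by simp
qed

lemma onorm_lmult_le: "onorm (lmult u) \<le> norm (base u :: 'a) + cmod (scalar u)"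
proof (rule onorm_bound)
  fix x
  have "norm (lmult u x) \<le> norm (base u * x) + norm (scalar u *\<^sub>C x)"
    unfolding lmult_def by (rule norm_triangle_ineq)
  also have "\<dots> \<le> norm (base u) * norm x + cmod (scalar u) * norm x"
    using norm_mult_ineq[of "base u" x] by (simp add: norm_scaleC)
  finally show "norm (lmult u x) \<le> (norm (base u) + cmod (scalar u)) * norm x"
    by (simp add: algebra_simps)
qed simp

lemma norm_unitization_le: "norm u \<le> norm (base u :: 'a) + cmod (scalar u)"
  using onorm_lmult_le[of u] by (simp add: norm_unitization_def)

lemma norm_base_le_unitization: "norm (base u :: 'a) \<le> 2 * norm u"
proof -
  have eq: "Unitization (base u) 0 = u + Unitization 0 (- scalar u)"
    by (simp add: unitization_eq_iff plus_unitization_def)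
  have "norm (base u) \<le> onorm (lmult (Unitization (base u) 0))"
    by (rule norm_base_le)
  also have "\<dots> \<le> onorm (lmult u) + onorm (lmult (Unitization (0::'a) (- scalar u)))"
    unfolding eq lmult_plus by (rule onorm_triangle) (rule bounded_linear_lmult)+
  also have "onorm (lmult (Unitization (0::'a) (- scalar u))) \<le> cmod (scalar u)"
    using onorm_lmult_le[of "Unitization (0::'a) (- scalar u)"] by simp
  finally show ?thesis by (simp add: norm_unitization_def)
qed

lemma norm_zero_unitization: "norm u = 0 \<longleftrightarrow> u = (0 :: 'a unitization)"
proof
  assume "norm u = 0"
  moreover from this have "norm (base u) = 0"
    using norm_base_le_unitization[of u] by simp
  moreover have "cmod (scalar u) \<le> norm u" by (simp add: norm_unitization_def)
  ultimately show "u = 0" by (simp add: unitization_eq_iff zero_unitization_def)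
next
  assume "u = 0"
  moreover have "lmult (0 :: 'a unitization) = (\<lambda>x. 0)"
    by (auto simp: lmult_def zero_unitization_def)
  ultimately show "norm u = 0" 
    by (simp add: norm_unitization_def onorm_zero) (simp add: zero_unitization_def)
qed

lemma onorm_lmult_sq: "(onorm (lmult u))\<^sup>2 \<le> onorm (lmult (star u * (u :: 'a unitization)))"
proof -
  let ?K = "onorm (lmult (star u * u))"
  have K: "?K \<ge> 0" by (rule onorm_pos_le[OF bounded_linear_lmult])
  have "onorm (lmult u) \<le> sqrt ?K"
  proof (rule onorm_bound)
    fix x
    have "(norm (lmult u x))\<^sup>2 = norm (star x * lmult (star u * u) x)"
      by (simp add: cstar_identity[symmetric] star_lmult lmult_times)
    also have "\<dots> \<le> norm x * norm (lmult (star u * u) x)"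
      using norm_mult_ineq[of "star x"] by simp
    also have "\<dots> \<le> norm x * (?K * norm x)"
      by (intro mult_left_mono onorm[OF bounded_linear_lmult]) simp
    also have "\<dots> = (sqrt ?K * norm x)\<^sup>2"
      using K by (simp add: power_mult_distrib power2_eq_square)
    finally show "norm (lmult u x) \<le> sqrt ?K * norm x"
      using K by (simp add: power2_le_iff_abs_le)
  qed (use K in simp)
  then have "(onorm (lmult u))\<^sup>2 \<le> (sqrt ?K)\<^sup>2"
    by (intro power_mono onorm_pos_le bounded_linear_lmult)
  then show ?thesis using K by simp
qed

lemma onorm_lmult_times:
  "onorm (lmult (u * v)) \<le> onorm (lmult u) * onorm (lmult (v :: 'a unitization))"
  unfolding lmult_times by (rule onorm_compose) (rule bounded_linear_lmult)+

lemma star_star_unitization: "star (star u) = (u :: 'a unitization)"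
  by (simp add: unitization_eq_iff star_unitization_def star_star)

lemma onorm_lmult_star: "onorm (lmult (star u)) = onorm (lmult (u :: 'a unitization))"
proof -
  have "onorm (lmult w) \<le> onorm (lmult (star w))" for w :: "'a unitization"
  proof (cases "onorm (lmult w) = 0")
    case True
    then show ?thesis using onorm_pos_le[OF bounded_linear_lmult] by simp
  next
    case False
    then have pos: "onorm (lmult w) > 0"
      using onorm_pos_le[OF bounded_linear_lmult, of w] by simp
    have "(onorm (lmult w))\<^sup>2 \<le> onorm (lmult (star w)) * onorm (lmult w)"
      by (rule order_trans[OF onorm_lmult_sq onorm_lmult_times])
    then show ?thesis using pos by (simp add: power2_eq_square)
  qed
  from this[of u] this[of "star u"] show ?thesis by (simp add: star_star_unitization)
qed

lemma onorm_lmult_star_mult: "onorm (lmult (star u * u)) = (onorm (lmult (u :: 'a unitization)))\<^sup>2"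
  using onorm_lmult_sq[of u] onorm_lmult_times[of "star u" u]
  by (simp add: onorm_lmult_star power2_eq_square)

lemma onorm_scaleC_le: "onorm (\<lambda>x. c *\<^sub>C lmult u (x::'a)) \<le> cmod c * onorm (lmult u)"
proof (rule onorm_bound)
  fix x
  show "norm (c *\<^sub>C lmult u x) \<le> cmod c * onorm (lmult u) * norm x"
    using mult_left_mono[OF onorm[OF bounded_linear_lmult, of u x], of "cmod c"]
    by (simp add: norm_scaleC mult.assoc)
qed (simp add: onorm_pos_le[OF bounded_linear_lmult])

lemma norm_scaleC_unitization: "norm (c *\<^sub>C u) = cmod c * norm (u :: 'a unitization)"
proof -
  have le: "norm (c *\<^sub>C u) \<le> cmod c * norm u" for c and u :: "'a unitization"
  proof -
    have "onorm (lmult (c *\<^sub>C u)) \<le> cmod c * norm u"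
      using onorm_scaleC_le[of c u] mult_left_mono[of "onorm (lmult u)" "norm u" "cmod c"]
      by (simp add: norm_unitization_def lmult_scaleC)
    moreover have "cmod (scalar (c *\<^sub>C u)) \<le> cmod c * norm u"
      by (simp add: scaleC_unitization_def norm_mult norm_unitization_def mult_left_mono)
    ultimately show ?thesis by (simp add: norm_unitization_def[of "c *\<^sub>C u"])
  qed
  show ?thesis
  proof (cases "c = 0")
    case True
    then have "c *\<^sub>C u = 0" by (simp add: unitization_defs)
    then show ?thesis using True norm_zero_unitization[of "0 :: 'a unitization"] by simp
  next
    case False
    then have "u = inverse c *\<^sub>C c *\<^sub>C u"
      by (simp add: unitization_eq_iff unitization_defs scaleC_scaleC)
    then have "norm u \<le> cmod (inverse c) * norm (c *\<^sub>C u)"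
      using le by metis
    then have "cmod c * norm u \<le> norm (c *\<^sub>C u)"
      using False by (simp add: norm_inverse field_simps norm_divide)
    then show ?thesis using le[of c u] by simp
  qed
qed

lemma norm_triangle_unitization: "norm (u + v) \<le> norm u + norm (v :: 'a unitization)"
  using onorm_triangle[OF bounded_linear_lmult bounded_linear_lmult, of u v]
    norm_triangle_ineq[of "scalar u" "scalar v"]
  by (simp add: norm_unitization_def lmult_plus) (auto simp: plus_unitization_def)

lemma norm_mult_unitization: "norm (u * v) \<le> norm u * norm (v :: 'a unitization)"
proof -
  have "onorm (lmult (u * v)) \<le> norm u * norm v"
    by (rule order_trans[OF onorm_lmult_times], rule mult_mono)
      (auto simp: norm_unitization_def le_max_iff_disj onorm_pos_le[OF bounded_linear_lmult])
  moreover have "cmod (scalar (u * v)) \<le> norm u * norm v"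
    by (auto simp: times_unitization_def norm_mult norm_unitization_def le_max_iff_disj
        intro!: mult_mono)
  ultimately show ?thesis by (simp add: norm_unitization_def[of "u * v"])
qed

lemma mult_scaleC_unitization:
  "(c *\<^sub>C u) * v = c *\<^sub>C (u * v)" "u * (c *\<^sub>C v) = c *\<^sub>C (u * (v :: 'a unitization))"
  by (simp_all add: unitization_defs mult_scaleC_left mult_scaleC_right scaleC_add_right
      scaleC_scaleC mult_ac)

instance
proof
  fix u v w :: "'a unitization" and r s :: real and U :: "'a unitization set"
  show "u + v + w = u + (v + w)" "u + v = v + u" "0 + u = u" "- u + u = 0" "u - v = u + - v"
    by (simp_all add: unitization_defs)
  show "r *\<^sub>R (u + v) = r *\<^sub>R u + r *\<^sub>R v" "(r + s) *\<^sub>R u = r *\<^sub>R u + s *\<^sub>R u"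
    "r *\<^sub>R s *\<^sub>R u = (r * s) *\<^sub>R u" "1 *\<^sub>R u = u"
    by (simp_all add: unitization_defs algebra_simps)
  show "u * v * w = u * (v * w)"
    by (simp add: unitization_defs algebra_simps mult_scaleC_left mult_scaleC_right
        scaleC_add_right scaleC_scaleC)
  show "(u + v) * w = u * w + v * w" "u * (v + w) = u * v + u * w"
    by (simp_all add: unitization_defs algebra_simps scaleC_add_right scaleC_add_left)
  have sR: "r *\<^sub>R u = complex_of_real r *\<^sub>C u" for r and u :: "'a unitization"
    by (simp add: unitization_defs scaleR_as_scaleC scaleR_conv_of_real)
  show "(r *\<^sub>R u) * v = r *\<^sub>R (u * v)" "u * (r *\<^sub>R v) = r *\<^sub>R (u * v)"
    by (simp_all add: sR mult_scaleC_unitization)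
  show "norm (r *\<^sub>R u) = \<bar>r\<bar> * norm u"
    by (simp add: sR norm_scaleC_unitization)
  show "norm u = 0 \<longleftrightarrow> u = 0" by (rule norm_zero_unitization)
  show "norm (u + v) \<le> norm u + norm v" by (rule norm_triangle_unitization)
  show "norm (u * v) \<le> norm u * norm v" by (rule norm_mult_unitization)
  show "sgn u = inverse (norm u) *\<^sub>R u" by (rule sgn_unitization_def)
  show "dist u v = norm (u - v)" by (rule dist_unitization_def)
  show "uniformity = (INF e\<in>{0 <..}. principal {(u :: 'a unitization, v). dist u v < e})"
    by (rule uniformity_unitization_def)
  show "open U \<longleftrightarrow> (\<forall>u\<in>U. eventually (\<lambda>(u', v). u' = u \<longrightarrow> v \<in> U) uniformity)"
    by (rule open_unitization_def)
qed

end

instance unitization :: (cstar_algebra) banach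
proof
  fix X :: "nat \<Rightarrow> 'a unitization"
  have distB: "dist (base u) (base v) \<le> 2 * dist u v"
    and distS: "dist (scalar u) (scalar v) \<le> dist u v" for u v :: "'a unitization"
    using norm_base_le_unitization[of "u - v"]
    by (simp_all add: dist_unitization_def dist_norm norm_unitization_def)
      (simp_all add: minus_unitization_def)
  assume X: "Cauchy X"
  have "Cauchy (\<lambda>n. base (X n))"
    unfolding Cauchy_def
  proof (intro allI impI)
    fix e :: real assume "e > 0"
    then obtain M where "\<forall>m\<ge>M. \<forall>n\<ge>M. dist (X m) (X n) < e / 2"
      using X unfolding Cauchy_def by (metis half_gt_zero)
    then show "\<exists>M. \<forall>m\<ge>M. \<forall>n\<ge>M. dist (base (X m)) (base (X n)) < e"
      using distB by (smt (verit) field_sum_of_halves)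
  qed
  moreover have "Cauchy (\<lambda>n. scalar (X n))"
    using X distS unfolding Cauchy_def by (meson le_less_trans)
  ultimately obtain b c where lim: "(\<lambda>n. base (X n)) \<longlonglongrightarrow> b" "(\<lambda>n. scalar (X n)) \<longlonglongrightarrow> c"
    by (meson Cauchy_convergent convergentD)
  have "(\<lambda>n. norm (base (X n) - b) + cmod (scalar (X n) - c)) \<longlonglongrightarrow> 0"
    using tendsto_add[OF tendsto_norm_zero[OF LIM_zero[OF lim(1)]]
        tendsto_norm_zero[OF LIM_zero[OF lim(2)]]] by simp
  then have *: "(\<lambda>n. dist (X n) (Unitization b c)) \<longlonglongrightarrow> 0"
  proof (rule Lim_null_comparison[rotated], intro always_eventually allI)
    fix n
    have "0 \<le> dist (X n) (Unitization b c)"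
      by (simp add: dist_unitization_def norm_unitization_def le_max_iff_disj)
    then show "norm (dist (X n) (Unitization b c)) \<le> norm (base (X n) - b) + cmod (scalar (X n) - c)"
      using norm_unitization_le[of "X n - Unitization b c"]
      by (simp add: dist_unitization_def) (simp add: minus_unitization_def)
  qed
  show "convergent X"
    unfolding convergent_def using * tendsto_dist_iff by blast
qed

instance unitization :: (cstar_algebra) cstar_algebra
proof
  fix u v :: "'a unitization" and r :: real and c d :: complex
  show "norm (c *\<^sub>C u) = cmod c * norm u" by (rule norm_scaleC_unitization)
  show "complex_of_real r *\<^sub>C u = r *\<^sub>R u" by (simp add: unitization_defs scaleR_as_scaleC scaleR_conv_of_real)
  show "c *\<^sub>C (u + v) = c *\<^sub>C u + c *\<^sub>C v" "(c + d) *\<^sub>C u = c *\<^sub>C u + d *\<^sub>C u"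
    "c *\<^sub>C d *\<^sub>C u = (c * d) *\<^sub>C u"
    by (simp_all add: unitization_defs algebra_simps scaleC_add_right scaleC_add_left scaleC_scaleC)
  show "(c *\<^sub>C u) * v = c *\<^sub>C (u * v)" "u * (c *\<^sub>C v) = c *\<^sub>C (u * v)"
    by (rule mult_scaleC_unitization)+
  show "star (star u) = u" by (rule star_star_unitization)
  show "star (u + v) = star u + star v" "star (c *\<^sub>C u) = cnj c *\<^sub>C star u"
    "star (u * v) = star v * star u"
    by (simp_all add: unitization_defs star_add star_scaleC star_mult algebra_simps)
  show "norm (star u * u) = (norm u)\<^sup>2"
  proof -
    have "cmod (scalar (star u * u)) = (cmod (scalar u))\<^sup>2"
      by (simp add: unitization_defs norm_mult power2_eq_square)
    moreover have "max (a\<^sup>2) (b\<^sup>2) = (max a b)\<^sup>2" if "a \<ge> 0" "b \<ge> 0" for a b :: real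
      using that power_mono[of a b 2] power_mono[of b a 2] by (auto simp: max_def)
    ultimately show ?thesis
      by (simp add: norm_unitization_def onorm_lmult_star_mult onorm_pos_le[OF bounded_linear_lmult])
  qed
qed

lemma is_unit_elem_unitization: "is_unit_elem (Unitization 0 1 :: 'a::cstar_algebra unitization)"
  by (simp add: is_unit_elem_def times_unitization_def unitization_eq_iff)


section \<open>Notions for arbitrary C*-algebras\<close>

definition tsr :: "'a::cstar_algebra itself \<Rightarrow> enat" where
  "tsr (_ :: 'a itself) =
     (if unital TYPE('a) then tsr_unital TYPE('a) else tsr_unital TYPE('a unitization))"

definition real_rank_zero :: "'a::cstar_algebra itself \<Rightarrow> bool" where
  "real_rank_zero (_ :: 'a itself) \<longleftrightarrow>
     (if unital TYPE('a) then real_rank_zero_unital TYPE('a)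
      else real_rank_zero_unital TYPE('a unitization))"

definition extremally_rich :: "'a::cstar_algebra itself \<Rightarrow> bool" where
  "extremally_rich (_ :: 'a itself) \<longleftrightarrow>
     (if unital TYPE('a) then extremally_rich_unital TYPE('a)
      else extremally_rich_unital TYPE('a unitization))"

text \<open>
  The functorial map \<open>map_unitization \<phi>\<close> of the datatype sends \<open>Unitization b c\<close> to
  \<open>Unitization (\<phi> b) c\<close>, so it is the unital extension of \<open>\<phi>\<close>. It is used whenever \<open>\<phi>\<close> is not
  a unital map of unital algebras; this includes non-unital maps between unital algebras.
\<close>

definition extreme_point_preserving :: "('a::cstar_algebra \<Rightarrow> 'b::cstar_algebra) \<Rightarrow> bool" where
  "extreme_point_preserving \<phi> \<longleftrightarrow>
     (if unital TYPE('a) \<and> unital TYPE('b) \<and> \<phi> the_unit = the_unit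
      then \<phi> ` extremes \<subseteq> extremes
      else map_unitization \<phi> ` extremes \<subseteq> extremes)"

end

(*
  Passing to forced unitizations makes all algebras and maps unital, and the invariants do not change,
  since the unitization of an already unital B is the direct sum of B and the scalars.

  In the unital case, an element (b, c) of the pullback is approximated by first moving b to a good
  element b', then moving c by a lift of the small element tau(b' - b), so that the images in D agree
  again, and finally replacing c by a good element c' near it in the same fibre of pi.  The last step
  uses that good elements form an open set in which nearby elements are related by a factorization with
  factors near 1, and such factors lift from D to C:
    - for left invertible columns d, d + e = (1 + e l) d where l d = 1;
    - for self-adjoint invertible d, d + e = h* d h with h = sqrt (1 + d^-1 e);
    - for quasi-invertible d with generalized inverse w, d + e = (1 + e w) d h, which uses
      (1 - d w) D (1 - w d) = 0.
  The C*-theory behind this (square roots, positivity of x* x, Kadison's description of extreme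
  points) is obtained from the binomial series of sqrt (1 - x), without Gelfand theory.
*)
theory Submission
  imports Defs
begin

text \<open>The good elements found in B and in C must agree exactly in D, while density gives only
  approximate agreement; so good elements need a description that survives passage to D and lifts
  back to C. For invertibility, passage to D is automatic. For quasi-invertibility it is not: the
  condition on the two defects ranges over the whole algebra, and its image under \<tau> speaks only
  of the range of \<tau>. Hence (iii) carries a condition on \<tau>, while the surjections \<pi> and
  \<eta> need none.

  The forced unitization serves even where units exist, because the given maps need not preserve
  them, and because it is never zero: it always lies in the class below, where \<open>1\<close>
  differs from \<open>0\<close> and has norm 1.

  Gluing in A uses two facts that are not formal. The norm of A is controlled by \<eta> and \<rho>,
  which is read off from positivity of \<open>1 - star x * x\<close>; and generalized inverses,
  which are not unique, have to be chosen so that they agree in D, as Moore-Penrose inverses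
  do.\<close>

class cstar_algebra_1 = cstar_algebra + real_normed_algebra_1

lemma lmult_unit: "lmult (Unitization 0 1) = (\<lambda>x :: 'a::cstar_algebra. x)"
  by (auto simp: lmult_def)

instantiation unitization :: (cstar_algebra) cstar_algebra_1
begin

definition one_unitization :: "'a unitization" where
  "1 = Unitization 0 1"

instance
proof
  fix u :: "'a unitization"
  show "1 * u = u" "u * 1 = u"
    using is_unit_elem_unitization[where 'a = 'a] by (simp_all add: is_unit_elem_def one_unitization_def)
  show "(0 :: 'a unitization) \<noteq> 1"
    by (simp add: one_unitization_def zero_unitization_def)
  have "onorm (\<lambda>x :: 'a. x) \<le> 1"
    by (rule onorm_id_le)
  then show "norm (1 :: 'a unitization) = 1"
    by (simp add: norm_unitization_def one_unitization_def lmult_unit)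
qed

end

subsection \<open>Involution and invertible elements\<close>

lemma star_zero [simp]: "star (0::'a::cstar_algebra) = 0"
  using star_add[of "0::'a" 0] by simp

lemma star_uminus: "star (- x) = - star (x::'a::cstar_algebra)"
  using star_add[of x "- x"] by (simp add: eq_neg_iff_add_eq_0 add.commute)

lemma star_diff: "star (x - y) = star x - star (y::'a::cstar_algebra)"
  using star_add[of x "- y"] by (simp add: star_uminus)

lemma star_scaleR: "star (r *\<^sub>R x) = r *\<^sub>R star (x::'a::cstar_algebra)"
  by (simp add: scaleR_as_scaleC star_scaleC)

lemma star_one [simp]: "star (1::'a::cstar_algebra_1) = 1"
  using star_mult[of "star 1" "1::'a"] by (simp add: star_star)

lemma star_of_real [simp]: "star (of_real r :: 'a::cstar_algebra_1) = of_real r"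
  by (simp add: of_real_def star_scaleR)

lemma bounded_linear_star: "bounded_linear (star :: 'a::cstar_algebra \<Rightarrow> 'a)"
  by (rule bounded_linear_intro[where K = 1]) (simp_all add: star_add star_scaleR)

lemma star_power: "star (x ^ n) = star (x::'a::cstar_algebra_1) ^ n"
  by (induction n) (simp_all add: star_mult power_commutes)

lemmas scaleC_simps = mult_scaleC_left mult_scaleC_right scaleC_scaleC star_scaleC scaleC_add_right

lemma scaleC_minus_right: "c *\<^sub>C (- x) = - (c *\<^sub>C (x::'a::cstar_algebra))"
  using scaleC_add_right[of c x "- x"] by (simp add: eq_neg_iff_add_eq_0 add.commute)

lemma scaleC_diff_right: "c *\<^sub>C (x - y) = c *\<^sub>C x - c *\<^sub>C (y::'a::cstar_algebra)"
  using scaleC_add_right[of c x "- y"] by (simp add: scaleC_minus_right)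

lemma scaleC_minus_one [simp]: "(- 1) *\<^sub>C x = - (x::'a::cstar_algebra)"
  by (simp add: scaleC_minus_left)

lemma the_unit_eqI: "is_unit_elem e \<Longrightarrow> the_unit = (e::'a::cstar_algebra)"
  unfolding the_unit_def is_unit_elem_def by (rule the_equality) (metis)+

lemma the_unit_eq_one [simp]: "the_unit = (1::'a::cstar_algebra_1)"
  by (rule the_unit_eqI) (simp add: is_unit_elem_def)

lemma invertiblesI: "x * y = 1 \<Longrightarrow> y * x = 1 \<Longrightarrow> x \<in> invertibles" for x :: "'a::cstar_algebra_1"
  by (auto simp: invertibles_def)

lemma invertiblesE:
  fixes x :: "'a::cstar_algebra_1"
  assumes "x \<in> invertibles"
  obtains y where "x * y = 1" "y * x = 1" "y \<in> invertibles"
  using assms by (auto simp: invertibles_def)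

lemma invertibles_one [simp]: "1 \<in> (invertibles :: 'a::cstar_algebra_1 set)"
  by (rule invertiblesI[of _ 1]) auto

lemma invertibles_mult:
  fixes x y :: "'a::cstar_algebra_1"
  assumes "x \<in> invertibles" "y \<in> invertibles"
  shows "x * y \<in> invertibles"
proof -
  obtain a b where "x * a = 1" "a * x = 1" "y * b = 1" "b * y = 1"
    using assms by (metis invertiblesE)
  then show ?thesis
    by (intro invertiblesI[of _ "b * a"]) (metis mult.assoc mult_1_right mult_1_left)+
qed

text \<open>The right inverse \<open>y * a\<close> and the left inverse \<open>b * y\<close> of
  \<open>x\<close> coincide. The case \<open>y = x\<close> passes from an invertible square to its
  root.\<close>

lemma invertibles_of_mult:
  fixes x y :: "'a::cstar_algebra_1"
  assumes "x * y \<in> invertibles" "y * x \<in> invertibles"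
  shows "x \<in> invertibles"
proof -
  obtain a b where ab: "x * y * a = 1" "b * (y * x) = 1"
    using assms by (metis invertiblesE)
  have "b * y = b * y * (x * y * a)" by (simp add: ab)
  also have "\<dots> = y * a" by (metis ab(2) mult.assoc mult_1_left)
  finally show ?thesis
    using ab by (intro invertiblesI[of _ "y * a"]) (metis mult.assoc)+
qed

lemma invertibles_star: "x \<in> invertibles \<Longrightarrow> star x \<in> invertibles" for x :: "'a::cstar_algebra_1"
  by (erule invertiblesE) (metis invertiblesI star_mult star_one)

lemma invertibles_scaleR:
  fixes x :: "'a::cstar_algebra_1"
  assumes "x \<in> invertibles" "r \<noteq> 0"
  shows "r *\<^sub>R x \<in> invertibles"
proof -
  obtain y where "x * y = 1" "y * x = 1" using assms(1) by (rule invertiblesE)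
  then show ?thesis using assms(2) by (intro invertiblesI[of _ "inverse r *\<^sub>R y"]) simp_all
qed

lemma invertibles_scaleC:
  fixes x :: "'a::cstar_algebra_1"
  assumes "x \<in> invertibles" "c \<noteq> 0"
  shows "c *\<^sub>C x \<in> invertibles"
proof -
  obtain y where "x * y = 1" "y * x = 1" using assms(1) by (rule invertiblesE)
  then show ?thesis
    using assms(2) by (intro invertiblesI[of _ "inverse c *\<^sub>C y"]) (simp_all add: scaleC_simps)
qed

text \<open>The geometric series. The estimate on \<open>y - 1\<close> is what yields continuity of
  inversion at 1.\<close>

lemma neumann:
  fixes x :: "'a::{real_normed_algebra_1,banach}"
  assumes "norm x < 1"
  obtains y where "(1 - x) * y = 1" "y * (1 - x) = 1" "norm (y - 1) \<le> norm x / (1 - norm x)"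
proof -
  let ?f = "\<lambda>n. x ^ n"
  have g: "summable (\<lambda>n. norm x ^ n)"
    using assms by (simp add: summable_geometric)
  have nle: "norm (x ^ n) \<le> norm x ^ n" for n by (rule norm_power_ineq)
  have s: "summable ?f"
    using nle by (intro summable_comparison_test'[OF g, of 0]) simp
  let ?y = "suminf ?f"
  have sy: "?y = 1 + suminf (\<lambda>n. x ^ Suc n)"
    using suminf_split_head[OF s] by simp
  have "x * ?y = suminf (\<lambda>n. x ^ Suc n)" "?y * x = suminf (\<lambda>n. x ^ Suc n)"
    using suminf_mult[OF s, of x] suminf_mult2[OF s, of x] by (simp_all add: power_commutes)
  then have *: "(1 - x) * ?y = 1" "?y * (1 - x) = 1"
    using sy by (simp_all add: algebra_simps)
  have gS: "summable (\<lambda>n. norm x ^ Suc n)"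
    using g by (simp only: summable_Suc_iff)
  have "norm (?y - 1) \<le> suminf (\<lambda>n. norm x ^ Suc n)"
    unfolding sy using norm_suminf_le[OF norm_power_ineq gS] by simp
  also have "\<dots> = norm x * suminf (\<lambda>n. norm x ^ n)"
    using suminf_mult[OF g] by simp
  also have "\<dots> = norm x / (1 - norm x)"
    using assms by (simp add: suminf_geometric)
  finally show ?thesis using * that by blast
qed

lemma invertibles_near_one: "norm (1 - x) < 1 \<Longrightarrow> x \<in> invertibles" for x :: "'a::cstar_algebra_1"
  using neumann[of "1 - x"] by (metis invertiblesI diff_diff_eq2 add_diff_cancel_left')

lemma invertibles_scaleC_one_plus:
  fixes x :: "'a::cstar_algebra_1"
  assumes "norm x < cmod c"
  shows "x + c *\<^sub>C 1 \<in> invertibles"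
proof -
  have c: "c \<noteq> 0" using assms by auto
  have "norm (1 - (inverse c *\<^sub>C x + 1)) < 1"
    using assms c by (simp add: norm_scaleC norm_inverse norm_divide field_simps)
  then have "inverse c *\<^sub>C x + 1 \<in> invertibles" by (rule invertibles_near_one)
  from invertibles_scaleC[OF this c] show ?thesis using c by (simp add: scaleC_simps)
qed

lemma of_real_scaleC: "(of_real r :: 'a::cstar_algebra_1) = complex_of_real r *\<^sub>C 1"
  by (simp only: of_real_def[where 'a = 'a] scaleC_of_real)

lemma of_real_commute: "of_real r * x = x * (of_real r :: 'a::real_algebra_1)"
  by (simp add: of_real_def)

lemma invertibles_of_real_plus:
  fixes x :: "'a::cstar_algebra_1"
  assumes "norm x < \<bar>r\<bar>"
  shows "x + of_real r \<in> invertibles"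
  using invertibles_scaleC_one_plus[of x "of_real r"] assms by (simp add: of_real_scaleC)

text \<open>Arens' trick: a large imaginary translate \<open>h - i s\<close> has norm at most \<open>sqrt (|h|\<^sup>2 + s\<^sup>2)\<close>.\<close>

lemma invertibles_self_adjoint_plus_imaginary:
  fixes h :: "'a::cstar_algebra_1"
  assumes h: "star h = h" and b: "b \<noteq> 0"
  shows "h + (\<i> * of_real b) *\<^sub>C 1 \<in> invertibles"
proof -
  \<comment> \<open>Since \<open>norm k\<close> squared is at most \<open>(norm h)^2 + s^2\<close>,
    it should lie below \<open>(b + s)^2\<close>. Taking \<open>2 * b * s = (norm h)^2\<close>
    leaves exactly the margin \<open>b^2\<close>.\<close>
  define s where "s = (norm h)\<^sup>2 / (2 * b)"
  define k where "k = h - (\<i> * of_real s) *\<^sub>C 1"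
  have "star k * k = h * h + complex_of_real (s * s) *\<^sub>C 1"
    by (simp add: k_def star_diff star_scaleC h algebra_simps scaleC_simps scaleC_diff_right
        scaleC_minus_left)
  then have "(norm k)\<^sup>2 \<le> norm (h * h) + norm (complex_of_real (s * s) *\<^sub>C (1::'a))"
    using norm_triangle_ineq[of "h * h"] by (simp only: cstar_identity[symmetric])
  then have "(norm k)\<^sup>2 \<le> norm (h * h) + s * s"
    by (simp add: norm_scaleC norm_mult)
  also have "\<dots> \<le> (norm h)\<^sup>2 + s\<^sup>2"
    using norm_mult_ineq[of h h] by (simp add: power2_eq_square)
  also have "(norm h)\<^sup>2 = 2 * b * s"
    using b by (simp add: s_def)
  also have "\<dots> + s\<^sup>2 < (b + s)\<^sup>2"
    using b by (simp add: power2_sum)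
  finally have "norm k < \<bar>b + s\<bar>"
    by (metis abs_ge_zero power2_abs power2_less_imp_less)
  then have "norm k < cmod (\<i> * of_real (b + s))"
    by (simp only: norm_mult norm_ii norm_of_real mult_1_left)
  then have "k + (\<i> * of_real (b + s)) *\<^sub>C 1 \<in> invertibles"
    by (rule invertibles_scaleC_one_plus)
  also have "k + (\<i> * of_real (b + s)) *\<^sub>C 1 = h + (\<i> * of_real b) *\<^sub>C 1"
    by (simp add: k_def ring_distribs scaleC_add_left)
  finally show ?thesis .
qed

text \<open>The element is \<open>star k * k\<close> for \<open>k = h + i sqrt t\<close>, which is
  invertible by the preceding lemma.\<close>

lemma invertibles_square_plus:
  fixes h :: "'a::cstar_algebra_1"
  assumes h: "star h = h" and t: "t > 0"
  shows "h * h + of_real t \<in> invertibles"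
proof -
  let ?k = "h + (\<i> * of_real (sqrt t)) *\<^sub>C 1"
  have "?k \<in> invertibles"
    using t by (intro invertibles_self_adjoint_plus_imaginary h) simp
  moreover have "star ?k * ?k = h * h + of_real t"
    using t by (simp add: h star_add scaleC_simps algebra_simps scaleC_minus_left of_real_scaleC
        scaleC_diff_right flip: of_real_mult)
  ultimately show ?thesis
    using invertibles_mult invertibles_star by metis
qed

text \<open>A total function, arbitrary off the invertible elements, so that limits of inverses can
  be written down when invertibility holds only eventually.\<close>

definition inv_elem :: "'a::cstar_algebra_1 \<Rightarrow> 'a" where
  "inv_elem x = (SOME y. x * y = 1 \<and> y * x = 1)"

lemma inv_elem:
  assumes "x \<in> (invertibles :: 'a::cstar_algebra_1 set)"
  shows "x * inv_elem x = 1" "inv_elem x * x = 1"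
proof -
  have "\<exists>y. x * y = 1 \<and> y * x = 1" using assms by (auto simp: invertibles_def)
  from someI_ex[OF this] show "x * inv_elem x = 1" "inv_elem x * x = 1"
    by (auto simp: inv_elem_def)
qed

lemma inv_elem_invertibles: "x \<in> invertibles \<Longrightarrow> inv_elem (x::'a::cstar_algebra_1) \<in> invertibles"
  using inv_elem[of x] by (auto intro: invertiblesI)

lemma inv_elem_unique: "x * y = 1 \<Longrightarrow> y * x = 1 \<Longrightarrow> inv_elem (x::'a::cstar_algebra_1) = y"
  using inv_elem[of x] invertiblesI[of x y] by (metis mult.assoc mult_1_left mult_1_right)

lemma star_inv_elem: "x \<in> invertibles \<Longrightarrow> star (inv_elem x) = inv_elem (star (x::'a::cstar_algebra_1))"
  using inv_elem[of x] by (metis inv_elem_unique star_mult star_one)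

lemma inv_elem_commute:
  fixes x :: "'a::cstar_algebra_1"
  assumes "x \<in> invertibles" "y * x = x * y"
  shows "y * inv_elem x = inv_elem x * y"
  using inv_elem[OF assms(1)] assms(2) by (metis mult.assoc mult_1_left mult_1_right)

lemma eventually_invertibles:
  fixes X :: "'i \<Rightarrow> 'a::cstar_algebra_1"
  assumes "(X \<longlongrightarrow> 1) F"
  shows "eventually (\<lambda>i. X i \<in> invertibles) F"
  using tendstoD[OF assms zero_less_one]
  by eventually_elim (auto intro: invertibles_near_one simp: dist_norm norm_minus_commute)

lemma tendsto_inv_elem:
  fixes X :: "'i \<Rightarrow> 'a::cstar_algebra_1"
  assumes "(X \<longlongrightarrow> 1) F"
  shows "((\<lambda>i. inv_elem (X i)) \<longlongrightarrow> 1) F"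
proof -
  let ?g = "\<lambda>i. norm (1 - X i) / (1 - norm (1 - X i))"
  have "(?g \<longlongrightarrow> norm (1 - 1 :: 'a) / (1 - norm (1 - 1 :: 'a))) F"
    by (intro tendsto_intros assms) simp
  then have g: "(?g \<longlongrightarrow> 0) F" by simp
  have "eventually (\<lambda>i. norm (inv_elem (X i) - 1) \<le> ?g i) F"
    using tendstoD[OF assms zero_less_one]
  proof eventually_elim
    case (elim i)
    then have "norm (1 - X i) < 1" by (simp add: dist_norm norm_minus_commute)
    from neumann[OF this] show ?case
      by (metis inv_elem_unique diff_diff_eq2 add_diff_cancel_left')
  qed
  from Lim_null_comparison[OF this g] show ?thesis by (simp add: LIM_zero_iff)
qed

subsection \<open>The square root of \<open>1 - x\<close>\<close>

text \<open>The Taylor coefficients of \<open>sqrt (1 - t)\<close> at 0.\<close>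

definition sqrt_coeff :: "nat \<Rightarrow> real" where
  "sqrt_coeff n = ((1/2) gchoose n) * (- 1) ^ n"

lemma sqrt_coeff_0 [simp]: "sqrt_coeff 0 = 1"
  by (simp add: sqrt_coeff_def)

lemma sqrt_coeff_Suc_nonpos: "sqrt_coeff (Suc n) \<le> 0"
proof -
  have "sqrt_coeff (Suc n) = pochhammer (- (1/2)) (Suc n) / fact (Suc n)"
    by (simp add: sqrt_coeff_def gbinomial_pochhammer power_mult_distrib[symmetric])
  also have "pochhammer (- (1/2)) (Suc n) = - (1/2) * pochhammer (1/2 :: real) n"
    by (simp add: pochhammer_rec)
  finally show ?thesis
    by (simp add: pochhammer_nonneg divide_nonneg_pos)
qed

lemma sum_sqrt_coeff_nonneg: "(\<Sum>k\<le>n. sqrt_coeff k) \<ge> 0"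
proof -
  have "(\<Sum>k\<le>n. sqrt_coeff k) = (- 1) ^ n * ((1/2 - 1) gchoose n)"
    unfolding sqrt_coeff_def by (rule gbinomial_sum_lower_neg)
  also have "\<dots> = pochhammer (1/2) n / fact n"
    by (simp add: gbinomial_pochhammer power_mult_distrib[symmetric])
  also have "\<dots> \<ge> 0" by (simp add: pochhammer_nonneg)
  finally show ?thesis .
qed

text \<open>All coefficients after the constant term 1 have the same sign, so their absolute values
  sum to 1 minus a nonnegative partial sum. The bound 1 makes the series converge on the closed unit
  ball, boundary included.\<close>

lemma sum_abs_sqrt_coeff_Suc_le: "(\<Sum>k<n. \<bar>sqrt_coeff (Suc k)\<bar>) \<le> 1"
proof -
  have "(\<Sum>k<n. \<bar>sqrt_coeff (Suc k)\<bar>) = 1 - (\<Sum>k\<le>n. sqrt_coeff k)"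
    using sqrt_coeff_Suc_nonpos
    by (simp add: lessThan_Suc_atMost[symmetric] sum.lessThan_Suc_shift sum_negf del: sum.lessThan_Suc)
  then show ?thesis using sum_sqrt_coeff_nonneg[of n] by simp
qed

lemma summable_abs_sqrt_coeff_Suc: "summable (\<lambda>n. \<bar>sqrt_coeff (Suc n)\<bar>)"
  by (rule summableI_nonneg_bounded[where x = 1]) (simp_all add: sum_abs_sqrt_coeff_Suc_le)

lemma suminf_abs_sqrt_coeff_Suc_le: "(\<Sum>n. \<bar>sqrt_coeff (Suc n)\<bar>) \<le> 1"
  by (rule suminf_le_const[OF summable_abs_sqrt_coeff_Suc sum_abs_sqrt_coeff_Suc_le])

text \<open>The coefficients of the squared series must be those of \<open>1 - t\<close>; this is
  Vandermonde's identity for 1/2 + 1/2 = 1.\<close>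

lemma sqrt_coeff_convolution:
  "(\<Sum>k\<le>n. sqrt_coeff k * sqrt_coeff (n - k)) = (if n = 0 then 1 else if n = 1 then - 1 else 0)"
proof -
  have "(\<Sum>k\<le>n. sqrt_coeff k * sqrt_coeff (n - k)) =
      (\<Sum>k\<le>n. ((1/2) gchoose k) * ((1/2) gchoose (n - k))) * (- 1) ^ n"
    unfolding sum_distrib_right
  proof (rule sum.cong)
    fix k assume "k \<in> {..n}"
    then have "(- 1) ^ n = (- 1 :: real) ^ k * (- 1) ^ (n - k)"
      by (simp flip: power_add)
    then show "sqrt_coeff k * sqrt_coeff (n - k) =
        ((1/2) gchoose k) * ((1/2) gchoose (n - k)) * (- 1) ^ n"
      by (simp add: sqrt_coeff_def)
  qed simp
  also have "(\<Sum>k\<le>n. ((1/2) gchoose k) * ((1/2) gchoose (n - k))) = (1 :: real) gchoose n"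
    using gbinomial_Vandermonde[of "1/2 :: real" "1/2" n] by (simp add: atMost_atLeast0)
  also have "(1 :: real) gchoose n = of_nat (1 choose n)"
    by (simp add: binomial_gbinomial)
  finally show ?thesis by (cases n; cases "n - 1") auto
qed

definition sqrt_one_minus :: "'a::cstar_algebra_1 \<Rightarrow> 'a" where
  "sqrt_one_minus x = (\<Sum>n. sqrt_coeff n *\<^sub>R x ^ n)"

context
  fixes x :: "'a::cstar_algebra_1"
  assumes x: "norm x \<le> 1"
begin

lemma norm_power_le_norm: "norm (x ^ Suc n) \<le> norm x"
  using norm_power_ineq[of x "Suc n"] x power_decreasing[of 1 "Suc n" "norm x"] by simp

lemma norm_sqrt_term_le: "norm (sqrt_coeff (Suc n) *\<^sub>R x ^ Suc n) \<le> \<bar>sqrt_coeff (Suc n)\<bar> * norm x"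
  using norm_power_le_norm[of n] by (simp add: mult_left_mono del: power_Suc)

lemma summable_norm_sqrt_one_minus: "summable (\<lambda>n. norm (sqrt_coeff n *\<^sub>R x ^ n))"
proof -
  have "summable (\<lambda>n. norm (sqrt_coeff (Suc n) *\<^sub>R x ^ Suc n))"
    using norm_sqrt_term_le
    by (intro summable_comparison_test'[OF summable_mult2[OF summable_abs_sqrt_coeff_Suc, of "norm x"], of 0])
      (simp only: norm_ge_zero abs_of_nonneg real_norm_def)
  then show ?thesis
    using summable_Suc_iff[of "\<lambda>n. norm (sqrt_coeff n *\<^sub>R x ^ n)"] by blast
qed

lemmas summable_sqrt_one_minus = summable_norm_cancel[OF summable_norm_sqrt_one_minus]

text \<open>The constant terms cancel and the remaining absolute coefficients sum to at most 1. The
  estimate gives both continuity of the root at 0 and, through \<open>positive_of_norm_le\<close>,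
  positivity of the root.\<close>

lemma norm_one_diff_sqrt_one_minus_le: "norm (1 - sqrt_one_minus x) \<le> norm x"
proof -
  have s: "summable (\<lambda>n. sqrt_coeff (Suc n) *\<^sub>R x ^ Suc n)"
    using summable_sqrt_one_minus summable_Suc_iff[of "\<lambda>n. sqrt_coeff n *\<^sub>R x ^ n"] by blast
  have "sqrt_one_minus x = 1 + (\<Sum>n. sqrt_coeff (Suc n) *\<^sub>R x ^ Suc n)"
    unfolding sqrt_one_minus_def using suminf_split_head[OF summable_sqrt_one_minus] by simp
  then have "norm (1 - sqrt_one_minus x) = norm (\<Sum>n. sqrt_coeff (Suc n) *\<^sub>R x ^ Suc n)"
    by (simp del: power_Suc)
  also have "\<dots> \<le> (\<Sum>n. \<bar>sqrt_coeff (Suc n)\<bar> * norm x)"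
    using norm_sqrt_term_le summable_mult2[OF summable_abs_sqrt_coeff_Suc]
    by (rule norm_suminf_le)
  also have "\<dots> = (\<Sum>n. \<bar>sqrt_coeff (Suc n)\<bar>) * norm x"
    by (rule suminf_mult2[symmetric, OF summable_abs_sqrt_coeff_Suc])
  also have "\<dots> \<le> 1 * norm x"
    using suminf_abs_sqrt_coeff_Suc_le by (intro mult_right_mono) auto
  finally show ?thesis by simp
qed

lemma sqrt_one_minus_square: "sqrt_one_minus x * sqrt_one_minus x = 1 - x"
proof -
  have "(\<lambda>n. \<Sum>k\<le>n. (sqrt_coeff k *\<^sub>R x ^ k) * (sqrt_coeff (n - k) *\<^sub>R x ^ (n - k))) sums
      (sqrt_one_minus x * sqrt_one_minus x)"
    unfolding sqrt_one_minus_def by (intro Cauchy_product_sums summable_norm_sqrt_one_minus)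
  also have "(\<lambda>n. \<Sum>k\<le>n. (sqrt_coeff k *\<^sub>R x ^ k) * (sqrt_coeff (n - k) *\<^sub>R x ^ (n - k))) =
      (\<lambda>n. (\<Sum>k\<le>n. sqrt_coeff k * sqrt_coeff (n - k)) *\<^sub>R x ^ n)"
    by (auto simp: scaleR_sum_left power_add[symmetric] fun_eq_iff intro!: sum.cong)
  also have "\<dots> = (\<lambda>n. if n \<in> {0, 1} then (if n = 0 then 1 else - x) else 0)"
    by (auto simp: sqrt_coeff_convolution)
  finally have "(\<lambda>n. if n \<in> {0, 1 :: nat} then (if n = 0 then 1 else - x) else 0) sums
      (sqrt_one_minus x * sqrt_one_minus x)" .
  moreover have "(\<lambda>n. if n \<in> {0, 1 :: nat} then (if n = 0 then 1 else - x) else 0) sums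
      (\<Sum>n\<in>{0, 1 :: nat}. if n = 0 then 1 else - x)"
    by (rule sums_If_finite_set) simp
  ultimately show ?thesis by (simp add: sums_unique2)
qed

end

text \<open>The relation passes to powers and then to the series. With \<open>y = x\<close> it gives
  commutation; with \<open>y = star x\<close> it is the source of the congruence used for
  self-adjoint elements.\<close>

lemma sqrt_one_minus_intertwine:
  fixes x y d :: "'a::cstar_algebra_1"
  assumes "norm x \<le> 1" "norm y \<le> 1" "d * x = y * d"
  shows "d * sqrt_one_minus x = sqrt_one_minus y * d"
proof -
  have *: "d * x ^ n = y ^ n * d" for n
    by (induction n) (simp_all add: assms(3) power_commutes[symmetric] mult.assoc,
        metis assms(3) mult.assoc power_commutes)
  show ?thesis
    unfolding sqrt_one_minus_def
    using suminf_mult[OF summable_sqrt_one_minus[OF assms(1)], of d]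
      suminf_mult2[OF summable_sqrt_one_minus[OF assms(2)], of d]
    by (simp add: *)
qed

lemma sqrt_one_minus_commute:
  "norm x \<le> 1 \<Longrightarrow> y * x = x * y \<Longrightarrow> y * sqrt_one_minus x = sqrt_one_minus x * (y::'a::cstar_algebra_1)"
  by (rule sqrt_one_minus_intertwine)

lemma star_sqrt_one_minus:
  fixes x :: "'a::cstar_algebra_1"
  assumes "norm x \<le> 1"
  shows "star (sqrt_one_minus x) = sqrt_one_minus (star x)"
  using bounded_linear.suminf[OF bounded_linear_star summable_sqrt_one_minus[OF assms]]
  by (simp add: sqrt_one_minus_def star_scaleR star_power)

lemma tendsto_sqrt_one_minus:
  fixes X :: "'i \<Rightarrow> 'a::cstar_algebra_1"
  assumes "(X \<longlongrightarrow> 0) F"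
  shows "((\<lambda>i. sqrt_one_minus (X i)) \<longlongrightarrow> 1) F"
proof -
  have "eventually (\<lambda>i. norm (sqrt_one_minus (X i) - 1) \<le> norm (X i)) F"
    using tendstoD[OF assms zero_less_one]
    by eventually_elim (metis norm_one_diff_sqrt_one_minus_le norm_minus_commute dist_0_norm dist_commute less_imp_le)
  from Lim_null_comparison[OF this tendsto_norm_zero[OF assms]] show ?thesis
    by (simp add: LIM_zero_iff)
qed

subsection \<open>Positive elements\<close>

definition self_adjoint :: "'a::cstar_algebra \<Rightarrow> bool" where
  "self_adjoint x \<longleftrightarrow> star x = x"

text \<open>Squares of self-adjoint elements instead of a spectral condition: homomorphisms preserve
  this at once, and positivity of \<open>star x * x\<close> becomes a theorem.\<close>

definition positive :: "'a::cstar_algebra \<Rightarrow> bool" where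
  "positive a \<longleftrightarrow> (\<exists>k. self_adjoint k \<and> a = k * k)"

lemma positive_self_adjoint: "positive a \<Longrightarrow> self_adjoint a"
  by (auto simp: positive_def self_adjoint_def star_mult)

lemma norm_square_self_adjoint: "self_adjoint k \<Longrightarrow> norm (k * k) = (norm k)\<^sup>2"
  using cstar_identity[of k] by (simp add: self_adjoint_def)

lemma positive_scaleR:
  assumes "positive a" "r \<ge> 0"
  shows "positive (r *\<^sub>R (a :: 'a::cstar_algebra))"
proof -
  obtain k where "self_adjoint k" "a = k * k" using assms(1) by (auto simp: positive_def)
  then show ?thesis unfolding positive_def
    by (intro exI[of _ "sqrt r *\<^sub>R k"]) (simp add: self_adjoint_def star_scaleR assms)
qed

lemma positive_of_real: "r \<ge> 0 \<Longrightarrow> positive (of_real r :: 'a::cstar_algebra_1)"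
  unfolding positive_def self_adjoint_def
  by (intro exI[of _ "of_real (sqrt r)"]) (simp flip: of_real_mult)

lemma positive_zero [simp]: "positive (0 :: 'a::cstar_algebra)"
  by (auto simp: positive_def self_adjoint_def intro!: exI[of _ "0::'a"])

text \<open>For commuting self-adjoint \<open>h\<close>, \<open>m\<close> the element \<open>u = h + i m\<close> satisfies \<open>u\<^sup>* u = h\<^sup>2 + m\<^sup>2\<close>,
  and \<open>h\<close> is the average of \<open>u\<close> and \<open>u\<^sup>*\<close>.\<close>

lemma norm_sq_le_of_sum_squares:
  fixes h m :: "'a::cstar_algebra_1"
  assumes "self_adjoint h" "self_adjoint m" "h * m = m * h" "h * h + m * m = of_real t"
  shows "(norm h)\<^sup>2 \<le> \<bar>t\<bar>"
proof -
  define u where "u = h + \<i> *\<^sub>C m"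
  have st: "star h = h" "star m = m" using assms by (auto simp: self_adjoint_def)
  have su: "star u = h - \<i> *\<^sub>C m"
    by (simp add: u_def star_add star_scaleC st scaleC_minus_left)
  have uu: "star u * u = of_real t"
    by (simp add: su, simp add: u_def algebra_simps scaleC_simps scaleC_diff_right
        scaleC_minus_left assms(3) assms(4)[symmetric])
  have "(norm u)\<^sup>2 = \<bar>t\<bar>"
    by (simp add: cstar_identity[symmetric] uu)
  then have nu: "norm u = sqrt \<bar>t\<bar>" by (metis norm_ge_zero real_sqrt_unique)
  have "2 *\<^sub>R h = u + star u" by (simp add: su) (simp add: u_def scaleR_2)
  then have "2 * norm h \<le> norm u + norm u"
    by (metis norm_star norm_triangle_ineq norm_scaleR abs_numeral)
  then have "(norm h)\<^sup>2 \<le> (sqrt \<bar>t\<bar>)\<^sup>2"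
    by (intro power_mono) (auto simp: nu)
  then show ?thesis by simp
qed

lemma self_adjointD: "self_adjoint x \<Longrightarrow> star x = x"
  by (simp add: self_adjoint_def)

lemma self_adjoint_intros:
  fixes x y :: "'a::cstar_algebra"
  shows
  "self_adjoint x \<Longrightarrow> self_adjoint y \<Longrightarrow> self_adjoint (x + y)"
  "self_adjoint x \<Longrightarrow> self_adjoint y \<Longrightarrow> self_adjoint (x - y)"
  "self_adjoint x \<Longrightarrow> self_adjoint (- x)"
  "self_adjoint x \<Longrightarrow> self_adjoint (r *\<^sub>R x)"
  "self_adjoint x \<Longrightarrow> self_adjoint (x * x)"
  by (auto simp: self_adjoint_def star_add star_diff star_uminus star_scaleR star_mult)

lemma self_adjoint_of_real: "self_adjoint (of_real r :: 'a::cstar_algebra_1)"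
  by (simp add: self_adjoint_def)

lemma self_adjoint_one: "self_adjoint (1 :: 'a::cstar_algebra_1)"
  by (simp add: self_adjoint_def)

lemma self_adjoint_star_mult: "self_adjoint (star x * x)" "self_adjoint (x * star x)"
  by (simp_all add: self_adjoint_def star_mult star_star)

lemma self_adjoint_mult:
  "self_adjoint x \<Longrightarrow> self_adjoint y \<Longrightarrow> x * y = y * x \<Longrightarrow> self_adjoint (x * y)"
  by (simp add: self_adjoint_def star_mult)

lemma self_adjoint_sqrt_one_minus:
  "norm x \<le> 1 \<Longrightarrow> self_adjoint x \<Longrightarrow> self_adjoint (sqrt_one_minus x)"
  by (simp add: self_adjoint_def star_sqrt_one_minus)

text \<open>The root \<open>m\<close> of \<open>1 - h * h\<close> commutes with \<open>h\<close>,
  and the two squares sum to 1, so \<open>m\<close> is a contraction as well.\<close>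

lemma norm_one_diff_square_le:
  fixes h :: "'a::cstar_algebra_1"
  assumes "self_adjoint h" "norm h \<le> 1"
  shows "norm (1 - h * h) \<le> 1"
proof -
  have n: "norm (h * h) \<le> 1"
    using assms by (simp add: norm_square_self_adjoint power_le_one)
  let ?m = "sqrt_one_minus (h * h)"
  have m: "self_adjoint ?m" "?m * ?m = 1 - h * h" "h * ?m = ?m * h"
    using assms n by (auto intro!: self_adjoint_sqrt_one_minus self_adjoint_intros
        sqrt_one_minus_square sqrt_one_minus_commute simp: mult.assoc)
  have "(norm ?m)\<^sup>2 \<le> \<bar>1\<bar>"
    using m assms by (intro norm_sq_le_of_sum_squares[where m = h]) simp_all
  then show ?thesis using m norm_square_self_adjoint[OF m(1)] by simp
qed

text \<open>For \<open>t > 0\<close> write \<open>a = t (1 - y)\<close> with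
  \<open>norm y \<le> 1\<close> and take the root by the series. Together with
  \<open>norm_of_real_diff_le\<close> this describes positivity by a norm inequality.\<close>

lemma positive_of_norm_le:
  fixes a :: "'a::cstar_algebra_1"
  assumes a: "self_adjoint a" and n: "norm (of_real t - a) \<le> t"
  shows "positive a"
proof (cases "t = 0")
  case False
  then have t: "t > 0" using n norm_ge_zero[of "of_real t - a"] by linarith
  let ?y = "1 - (1 / t) *\<^sub>R a"
  have "?y = (1 / t) *\<^sub>R (of_real t - a)"
    using t by (simp add: of_real_def scaleR_diff_right)
  then have y: "norm ?y \<le> 1" using n t by simp
  have "self_adjoint ?y" by (intro self_adjoint_intros self_adjoint_one a)
  then have "self_adjoint (sqrt t *\<^sub>R sqrt_one_minus ?y)"
    using y by (intro self_adjoint_intros(4) self_adjoint_sqrt_one_minus)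
  moreover have "a = (sqrt t *\<^sub>R sqrt_one_minus ?y) * (sqrt t *\<^sub>R sqrt_one_minus ?y)"
    using t by (simp add: sqrt_one_minus_square[OF y])
  ultimately show ?thesis by (auto simp: positive_def)
qed (use n in simp)

lemma norm_of_real_diff_le:
  fixes a :: "'a::cstar_algebra_1"
  assumes "positive a" "norm a \<le> t"
  shows "norm (of_real t - a) \<le> t"
proof (cases "t = 0")
  case False
  then have t: "t > 0" using assms norm_ge_zero[of a] by linarith
  obtain k where k: "self_adjoint k" "a = k * k" using assms(1) by (auto simp: positive_def)
  let ?h = "(1 / sqrt t) *\<^sub>R k"
  have h: "self_adjoint ?h" using k by (intro self_adjoint_intros)
  have hh: "?h * ?h = (1 / t) *\<^sub>R a" using t k by simp
  have "(norm ?h)\<^sup>2 = norm ((1 / t) *\<^sub>R a)"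
    by (simp only: norm_square_self_adjoint[OF h, symmetric] hh)
  also have "\<dots> \<le> 1" using assms t by simp
  finally have "norm ?h \<le> 1" by (simp add: power_le_one_iff)
  from norm_one_diff_square_le[OF h this] have "norm (1 - (1 / t) *\<^sub>R a) \<le> 1"
    by (simp only: hh)
  also have "1 - (1 / t) *\<^sub>R a = (1 / t) *\<^sub>R (of_real t - a)"
    using t by (simp add: of_real_def scaleR_diff_right)
  finally show ?thesis using t by (simp only: norm_scaleR) (simp add: field_simps)
qed (use assms in simp)

text \<open>Sums of squares are not visibly squares, but the norm description of positivity is
  additive by the triangle inequality.\<close>

lemma positive_add:
  fixes a b :: "'a::cstar_algebra_1"
  assumes "positive a" "positive b"
  shows "positive (a + b)"
proof (rule positive_of_norm_le)
  show "self_adjoint (a + b)"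
    using assms by (intro self_adjoint_intros positive_self_adjoint)
  have "of_real (norm a + norm b) - (a + b) = (of_real (norm a) - a) + (of_real (norm b) - b)"
    by simp
  also have "norm \<dots> \<le> norm a + norm b"
    using assms by (intro norm_triangle_le add_mono norm_of_real_diff_le) auto
  finally show "norm (of_real (norm a + norm b) - (a + b)) \<le> norm a + norm b" .
qed

lemma positive_sum:
  "(\<And>i. i \<in> I \<Longrightarrow> positive (f i :: 'a::cstar_algebra_1)) \<Longrightarrow> positive (sum f I)"
  by (induction I rule: infinite_finite_induct) (auto intro: positive_add)

text \<open>The root is a power series in \<open>a\<close>, so it commutes with everything that
  commutes with \<open>a\<close>. This clause takes the place of functional calculus below.\<close>

lemma positive_root:
  fixes a :: "'a::cstar_algebra_1"
  assumes a: "positive a"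
  obtains k where "positive k" "a = k * k" "\<And>x. x * a = a * x \<Longrightarrow> x * k = k * x"
proof -
  define t where "t = norm a + 1"
  have t: "t > 0" "norm a \<le> t" by (simp_all add: t_def add_nonneg_pos)
  define y where "y = 1 - (1 / t) *\<^sub>R a"
  have "y = (1 / t) *\<^sub>R (of_real t - a)"
    using t by (simp add: y_def of_real_def scaleR_diff_right)
  then have y: "norm y \<le> 1" using norm_of_real_diff_le[OF a t(2)] t by simp
  let ?k = "sqrt t *\<^sub>R sqrt_one_minus y"
  have "self_adjoint y"
    unfolding y_def by (intro self_adjoint_intros self_adjoint_one positive_self_adjoint a)
  then have "self_adjoint (sqrt_one_minus y)" using y by (rule self_adjoint_sqrt_one_minus[rotated])
  then have "positive (sqrt_one_minus y)"
    using norm_one_diff_sqrt_one_minus_le[OF y] y by (intro positive_of_norm_le[of _ 1]) auto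
  then have "positive ?k" using t by (intro positive_scaleR) auto
  moreover have "a = ?k * ?k"
    using t by (simp add: sqrt_one_minus_square[OF y]) (simp add: y_def)
  moreover have "x * ?k = ?k * x" if "x * a = a * x" for x
  proof -
    have "x * y = y * x" using that by (simp add: y_def algebra_simps)
    then show ?thesis using sqrt_one_minus_commute[OF y, of x] by simp
  qed
  ultimately show ?thesis using that by blast
qed

lemma positive_mult:
  fixes a b :: "'a::cstar_algebra_1"
  assumes "positive a" "positive b" "a * b = b * a"
  shows "positive (a * b)"
proof -
  obtain k where k: "positive k" "a = k * k" "\<And>x. x * a = a * x \<Longrightarrow> x * k = k * x"
    using positive_root[OF assms(1)] by blast
  obtain m where m: "positive m" "b = m * m" "\<And>x. x * b = b * x \<Longrightarrow> x * m = m * x"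
    using positive_root[OF assms(2)] by blast
  have "k * b = b * k" using k(3)[of b] assms(3) by simp
  then have km: "k * m = m * k" by (rule m(3))
  then have "a * b = (k * m) * (k * m)" by (simp add: k(2) m(2)) (metis mult.assoc)
  moreover have "self_adjoint (k * m)"
    using positive_self_adjoint[OF k(1)] positive_self_adjoint[OF m(1)] km by (rule self_adjoint_mult)
  ultimately show ?thesis by (auto simp: positive_def)
qed

lemma norm_le_of_positive:
  fixes a :: "'a::cstar_algebra_1"
  assumes "positive a" "positive (of_real t - a)" "t \<ge> 0"
  shows "norm a \<le> t"
proof -
  obtain k where k: "self_adjoint k" "a = k * k" using assms(1) by (auto simp: positive_def)
  obtain m where m: "positive m" "of_real t - a = m * m"
      "\<And>x. x * (of_real t - a) = (of_real t - a) * x \<Longrightarrow> x * m = m * x"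
    using positive_root[OF assms(2)] by blast
  have "k * m = m * k"
    by (rule m(3)) (simp add: k(2) algebra_simps of_real_commute)
  moreover have "k * k + m * m = of_real t" by (simp flip: k(2) m(2))
  ultimately have "(norm k)\<^sup>2 \<le> \<bar>t\<bar>"
    using norm_sq_le_of_sum_squares[OF k(1) positive_self_adjoint[OF m(1)]] by blast
  then show ?thesis using k norm_square_self_adjoint[OF k(1)] assms(3) by simp
qed

lemma positive_antisym:
  fixes a :: "'a::cstar_algebra_1"
  assumes "positive a" "positive (- a)"
  shows "a = 0"
  using norm_le_of_positive[of a 0] assms by simp

lemma invertibles_positive_plus:
  fixes a :: "'a::cstar_algebra_1"
  assumes "positive a" "t > 0"
  shows "a + of_real t \<in> invertibles"
  using assms invertibles_square_plus by (auto simp: positive_def self_adjoint_def)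

text \<open>The spectral radius of a self-adjoint element is its norm: if \<open>1 - c\<^sup>2 = m\<^sup>2\<close> is invertible
  then \<open>m\<^sup>2 - 1/N\<close> is still a square for large \<open>N\<close>, so \<open>c\<^sup>2 \<le> 1 - 1/N\<close>.\<close>

lemma norm_less_one_of_invertible:
  fixes c :: "'a::cstar_algebra_1"
  assumes c: "self_adjoint c" "norm c \<le> 1" and inv: "1 - c * c \<in> invertibles"
  shows "norm c < 1"
proof -
  have "positive (1 - c * c)"
    using c by (intro positive_of_norm_le[of _ 1] self_adjoint_intros self_adjoint_one)
      (auto simp: norm_square_self_adjoint power_le_one)
  then obtain m where m: "positive m" "1 - c * c = m * m"
      "\<And>x. x * (1 - c * c) = (1 - c * c) * x \<Longrightarrow> x * m = m * x"
    using positive_root by blast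
  have cm: "c * m = m * c" by (rule m(3)) (simp add: algebra_simps)
  have mm: "m * m \<in> invertibles" using inv m(2) by simp
  then have minv: "m \<in> invertibles" by (rule invertibles_of_mult) (rule mm)
  define n where "n = inv_elem m"
  have n: "m * n = 1" "n * m = 1" using inv_elem[OF minv] by (auto simp: n_def)
  have sn: "self_adjoint n"
    using star_inv_elem[OF minv] m(1) by (simp add: n_def self_adjoint_def positive_self_adjoint[unfolded self_adjoint_def])
  \<comment> \<open>\<open>N\<close> dominates the squared norm of the inverse \<open>n\<close> of
    \<open>m\<close>, so \<open>1 - n^2 / N\<close> is a square \<open>r^2\<close>. Then
    \<open>(m r)^2 = m^2 - 1 / N\<close>, and the commuting squares \<open>c^2\<close> and
    \<open>(m r)^2\<close> sum to \<open>1 - 1 / N\<close>.\<close>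
  define N where "N = (norm n)\<^sup>2 + 1"
  have N: "N \<ge> 1" by (simp add: N_def)
  define e where "e = 1 / N"
  have e: "0 < e" "e \<le> 1" using N by (auto simp: e_def)
  have "positive (1 - (1 / N) *\<^sub>R (n * n))"
  proof (rule positive_of_norm_le[of _ 1])
    show "self_adjoint (1 - (1 / N) *\<^sub>R (n * n))"
      by (intro self_adjoint_intros self_adjoint_one sn)
    show "norm (of_real 1 - (1 - (1 / N) *\<^sub>R (n * n))) \<le> 1"
      using N by (simp add: norm_square_self_adjoint[OF sn]) (simp add: N_def)
  qed
  then obtain r where r: "self_adjoint r" "1 - e *\<^sub>R (n * n) = r * r"
      "\<And>x. x * (1 - e *\<^sub>R (n * n)) = (1 - e *\<^sub>R (n * n)) * x \<Longrightarrow> x * r = r * x"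
    using positive_root positive_self_adjoint unfolding e_def by metis
  have cn: "c * n = n * c"
    unfolding n_def using inv_elem_commute[OF minv cm] .
  have cr: "c * r = r * c"
    by (rule r(3)) (simp add: algebra_simps, metis cn mult.assoc)
  have mr: "m * r = r * m"
    by (rule r(3)) (simp add: algebra_simps, metis n mult.assoc)
  have "(m * r) * (m * r) = m * m * (r * r)" by (metis mr mult.assoc)
  also have "\<dots> = m * m - e *\<^sub>R (m * m * (n * n))" by (simp flip: r(2) add: algebra_simps)
  also have "m * m * (n * n) = 1" by (metis n mult.assoc mult_1_left)
  finally have mrmr: "c * c + (m * r) * (m * r) = of_real (1 - e)"
    by (simp flip: m(2) add: of_real_def scaleR_diff_left)
  have "(norm c)\<^sup>2 \<le> \<bar>1 - e\<bar>"
  proof (rule norm_sq_le_of_sum_squares[OF c(1) _ _ mrmr])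
    show "self_adjoint (m * r)"
      using positive_self_adjoint[OF m(1)] r(1) mr by (rule self_adjoint_mult)
    show "c * (m * r) = m * r * c" by (metis cm cr mult.assoc)
  qed
  also have "\<dots> < 1" using e by simp
  finally show ?thesis by (simp add: power_less_one_iff)
qed

text \<open>Let \<open>c = N - a\<close> and suppose that \<open>s = norm c\<close> exceeds
  \<open>N\<close>. For \<open>d = c / s\<close> of norm 1, \<open>1 - d\<close> is invertible by
  hypothesis at \<open>t = s - N\<close>, and \<open>1 + d\<close> because
  \<open>s + N > norm a\<close>. So \<open>1 - d * d\<close> is invertible and
  \<open>norm d < 1\<close>, a contradiction. Thus \<open>norm (N - a) \<le> N\<close>.\<close>

lemma positive_of_invertibles:
  fixes a :: "'a::cstar_algebra_1"
  assumes a: "self_adjoint a" and inv: "\<And>t. t > 0 \<Longrightarrow> a + of_real t \<in> invertibles"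
  shows "positive a"
proof -
  define N where "N = norm a + 1"
  have N: "N > 0" "norm a < N" by (simp_all add: N_def add_nonneg_pos)
  define c where "c = of_real N - a"
  have sc: "self_adjoint c" unfolding c_def by (intro self_adjoint_intros self_adjoint_of_real a)
  define s where "s = norm c"
  have "s \<le> N"
  proof (rule ccontr)
    assume "\<not> s \<le> N"
    then have s: "s > N" by simp
    let ?d = "(1 / s) *\<^sub>R c"
    have "a + of_real (s - N) \<in> invertibles" using s by (intro inv) simp
    also have "a + of_real (s - N) = s *\<^sub>R (1 - ?d)"
      using s N by (simp add: c_def of_real_def scaleR_diff_right scaleR_diff_left)
    finally have 1: "s *\<^sub>R (1 - ?d) \<in> invertibles" .
    have "(- 1) *\<^sub>R (a + of_real (- (s + N))) \<in> invertibles"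
      using s N by (intro invertibles_scaleR invertibles_of_real_plus) auto
    also have "(- 1) *\<^sub>R (a + of_real (- (s + N))) = s *\<^sub>R (1 + ?d)"
      using s N by (simp add: c_def of_real_def scaleR_diff_right scaleR_diff_left scaleR_add_right scaleR_add_left)
    finally have 2: "s *\<^sub>R (1 + ?d) \<in> invertibles" .
    have "(1 / (s * s)) *\<^sub>R (s *\<^sub>R (1 - ?d) * (s *\<^sub>R (1 + ?d))) \<in> invertibles"
      using s N by (intro invertibles_scaleR invertibles_mult 1 2) auto
    also have "(1 / (s * s)) *\<^sub>R (s *\<^sub>R (1 - ?d) * (s *\<^sub>R (1 + ?d))) = 1 - ?d * ?d"
      using s N by (simp add: algebra_simps)
    finally have "norm ?d < 1"
      using s N by (intro norm_less_one_of_invertible self_adjoint_intros sc) (auto simp: s_def)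
    then show False using s N by (auto simp: s_def split: if_splits)
  qed
  then show ?thesis
    using a by (intro positive_of_norm_le[of a N]) (simp_all add: s_def c_def)
qed

text \<open>If \<open>r\<close> inverts \<open>t + x y\<close>, then \<open>(1 - y r x) / t\<close>
  inverts \<open>t + y x\<close>: the two products have the same nonzero spectrum.\<close>

lemma invertibles_of_real_plus_swap:
  fixes x y :: "'a::cstar_algebra_1"
  assumes t: "t \<noteq> 0" and inv: "of_real t + x * y \<in> invertibles"
  shows "of_real t + y * x \<in> invertibles"
proof -
  obtain r where r: "(of_real t + x * y) * r = 1" "r * (of_real t + x * y) = 1"
    using inv by (rule invertiblesE)
  let ?s = "1 - y * r * x"
  have "(of_real t + y * x) * ?s = of_real t + y * x - y * ((of_real t + x * y) * r) * x"
    by (simp add: algebra_simps of_real_commute)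
  then have 1: "(of_real t + y * x) * ?s = of_real t" by (simp only: r) simp
  have "?s * (of_real t + y * x) = of_real t + y * x - y * (r * (of_real t + x * y)) * x"
    by (simp add: algebra_simps of_real_commute)
  then have 2: "?s * (of_real t + y * x) = of_real t" by (simp only: r) simp
  show ?thesis
    using t 1 2 by (intro invertiblesI[of _ "(1 / t) *\<^sub>R ?s"]) (simp_all, simp_all add: of_real_def)
qed

lemma positive_star_mult_swap:
  fixes z :: "'a::cstar_algebra_1"
  assumes "positive (z * star z)"
  shows "positive (star z * z)"
proof (rule positive_of_invertibles[OF self_adjoint_star_mult(1)])
  fix t :: real assume t: "t > 0"
  then have "of_real t + z * star z \<in> invertibles"
    using invertibles_positive_plus[OF assms t] by (simp add: add.commute)
  then show "star z * z + of_real t \<in> invertibles"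
    using invertibles_of_real_plus_swap[of t z "star z"] t by (simp add: add.commute)
qed

text \<open>The real and imaginary parts of \<open>z\<close> give \<open>z\<^sup>* z + z z\<^sup>* \<ge> 0\<close>, so \<open>z\<^sup>* z \<le> 0\<close> forces
  \<open>z z\<^sup>* \<ge> 0\<close> and hence \<open>z\<^sup>* z \<ge> 0\<close>.\<close>

lemma star_mult_zero_of_negative:
  fixes z :: "'a::cstar_algebra_1"
  assumes "positive (- (star z * z))"
  shows "star z * z = 0"
proof -
  define h where "h = z + star z"
  define g where "g = \<i> *\<^sub>C (z - star z)"
  have sa: "self_adjoint h" "self_adjoint g"
    by (simp_all add: h_def g_def self_adjoint_def star_add star_star star_diff star_scaleC
        scaleC_minus_left scaleC_diff_right)
  have hh: "h * h = z * z + star z * z + z * star z + star z * star z"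
    by (simp add: h_def algebra_simps)
  have gg: "g * g = - (z * z) + star z * z + z * star z - star z * star z"
    by (simp add: g_def scaleC_simps scaleC_diff_right scaleC_minus_left algebra_simps)
  have "h * h + g * g = 2 *\<^sub>R (star z * z + z * star z)"
    by (simp add: hh gg scaleR_2)
  then have "z * star z = (1/2) *\<^sub>R (h * h + g * g) + - (star z * z)"
    by simp
  also have "positive \<dots>"
    using sa assms by (intro positive_add positive_scaleR) (auto simp: positive_def)
  finally have "positive (star z * z)" by (rule positive_star_mult_swap)
  then show ?thesis using assms by (rule positive_antisym)
qed

text \<open>With \<open>a\<close> the absolute value of \<open>y = star x * x\<close>, the element
  \<open>b = (a - y) / 2\<close> is its negative part. From \<open>y b = - b^2\<close> one gets
  \<open>star (x b) * (x b) = - b^3\<close>, which is negative and therefore zero; so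
  \<open>b = 0\<close> and \<open>y = a\<close>.\<close>

lemma positive_star_mult [simp]: "positive (star x * (x::'a::cstar_algebra_1))"
proof -
  define y where "y = star x * x"
  have y: "self_adjoint y" unfolding y_def by (rule self_adjoint_star_mult)
  then have "positive (y * y)" by (auto simp: positive_def)
  then obtain a where a: "positive a" "y * y = a * a" "\<And>x. x * (y * y) = (y * y) * x \<Longrightarrow> x * a = a * x"
    using positive_root by blast
  have ya: "y * a = a * y" by (rule a(3)) (simp add: mult.assoc)
  define b where "b = (1/2) *\<^sub>R (a - y)"
  have sb: "self_adjoint b"
    unfolding b_def by (intro self_adjoint_intros positive_self_adjoint a(1) y)
  have yb: "y = a - 2 *\<^sub>R b" by (simp add: b_def)
  have ab: "a * b = b * a" by (simp add: b_def algebra_simps ya)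
  have "b * b = (1/4) *\<^sub>R (a * a - a * y - y * a + y * y)"
    by (simp add: b_def algebra_simps)
  also have "\<dots> = (1/4) *\<^sub>R (2 *\<^sub>R (a * a) - 2 *\<^sub>R (a * y))"
    by (simp add: a(2) ya scaleR_2)
  also have "\<dots> = a * b"
    by (simp add: b_def scaleR_diff_right right_diff_distrib)
  finally have bb: "b * b = a * b" .
  have "positive b"
  proof (rule positive_of_invertibles[OF sb])
    fix t :: real assume t: "t > 0"
    define r where "r = inv_elem (a + of_real t)"
    have inv: "a + of_real t \<in> invertibles" by (rule invertibles_positive_plus[OF a(1) t])
    have r: "(a + of_real t) * r = 1" unfolding r_def by (rule inv_elem(1)[OF inv])
    have br: "b * r = r * b"
      unfolding r_def by (rule inv_elem_commute[OF inv]) (simp add: algebra_simps ab of_real_commute)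
    \<comment> \<open>Because \<open>b * b = a * b\<close>, the inverse \<open>r\<close> of
      \<open>a + t\<close> also serves for \<open>b\<close>:
      \<open>(b + t) (1 - b r) = b + t - b (a + t) r = t\<close>.\<close>
    let ?s = "1 - b * r"
    have "(b + of_real t) * ?s = b + of_real t - (b * b * r + t *\<^sub>R (b * r))"
      by (simp add: algebra_simps of_real_def)
    also have "b * b * r + t *\<^sub>R (b * r) = b * ((a + of_real t) * r)"
      by (simp add: bb ab algebra_simps of_real_def)
    finally have 1: "(b + of_real t) * ?s = of_real t" by (simp add: r)
    have "?s * (b + of_real t) = (b + of_real t) * ?s"
      by (simp add: algebra_simps of_real_commute br) (metis br mult.assoc)
    with 1 have 2: "?s * (b + of_real t) = of_real t" by simp
    show "b + of_real t \<in> invertibles"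
      using t 1 2 by (intro invertiblesI[of _ "(1 / t) *\<^sub>R ?s"]) (simp_all, simp_all add: of_real_def)
  qed
  then have b3: "positive (b * b * b)"
    by (intro positive_mult) (auto simp: mult.assoc)
  have "star (x * b) * (x * b) = b * y * b"
    using sb by (simp add: star_mult self_adjoint_def y_def mult.assoc)
  also have "b * y = - (b * b)"
    using bb ab by (simp add: yb right_diff_distrib distrib_left scaleR_2)
  finally have z: "star (x * b) * (x * b) = - (b * b * b)" by simp
  then have "star (x * b) * (x * b) = 0"
    using b3 by (intro star_mult_zero_of_negative) simp
  then have "b * b * b = 0" using z by simp
  then have "(b * b) * (b * b) = 0" by (simp flip: mult.assoc)
  then have "(norm (b * b))\<^sup>2 = 0"
    using norm_square_self_adjoint[OF self_adjoint_intros(5)[OF sb]] by simp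
  then have "(norm b)\<^sup>2 = 0"
    using norm_square_self_adjoint[OF sb] by simp
  then have "b = 0" by simp
  then have "y = a" using yb by simp
  then show ?thesis using a(1) by (simp add: y_def)
qed

lemma positive_conjugate:
  fixes a z :: "'a::cstar_algebra_1"
  assumes "positive a"
  shows "positive (star z * a * z)"
proof -
  obtain k where k: "self_adjoint k" "a = k * k" using assms by (auto simp: positive_def)
  then have "star z * a * z = star (k * z) * (k * z)"
    by (simp add: star_mult self_adjoint_def mult.assoc)
  then show ?thesis by simp
qed

lemma positive_norm_square_minus:
  fixes x :: "'a::cstar_algebra_1"
  assumes "norm x \<le> r"
  shows "positive (of_real (r\<^sup>2) - star x * x)"
  using assms by (intro positive_of_norm_le[of _ "r\<^sup>2"] self_adjoint_intros self_adjoint_of_real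
      self_adjoint_star_mult) (auto simp: cstar_identity intro: power_mono self_adjoint_star_mult)

text \<open>Membership in the unit ball becomes positivity of \<open>1 - star x * x\<close>, an
  algebraic statement that homomorphisms preserve and that can be checked on both legs of a
  pullback.\<close>

lemma norm_le_one_iff:
  fixes x :: "'a::cstar_algebra_1"
  shows "norm x \<le> 1 \<longleftrightarrow> positive (1 - star x * x)"
proof
  assume "positive (1 - star x * x)"
  then have "norm (star x * x) \<le> 1" by (intro norm_le_of_positive) auto
  then show "norm x \<le> 1" by (simp add: cstar_identity power_le_one_iff)
qed (use positive_norm_square_minus[of x 1] in simp)

subsection \<open>Extreme points of the unit ball\<close>

lemma extreme_point_of_cball_iff:
  fixes v :: "'a::real_normed_vector"
  shows "v extreme_point_of cball 0 1 \<longleftrightarrow>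
    norm v \<le> 1 \<and> (\<forall>y. norm (v + y) \<le> 1 \<and> norm (v - y) \<le> 1 \<longrightarrow> y = 0)"
proof safe
  assume v: "v extreme_point_of cball 0 1"
  then show "norm v \<le> 1" by (simp add: extreme_point_of_def)
  fix y assume y: "norm (v + y) \<le> 1" "norm (v - y) \<le> 1"
  show "y = 0"
  proof (rule ccontr)
    assume "y \<noteq> 0"
    moreover have "v = midpoint (v + y) (v - y)"
      by (simp add: midpoint_def)
    moreover have "v + y \<noteq> v - y"
    proof
      assume "v + y = v - y"
      then have "2 *\<^sub>R y = 0" by (simp add: scaleR_2 eq_neg_iff_add_eq_0)
      then show False using \<open>y \<noteq> 0\<close> by simp
    qed
    ultimately have "v \<in> open_segment (v + y) (v - y)" by (metis midpoint_in_open_segment)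
    then show False using v y by (auto simp: extreme_point_of_def)
  qed
next
  assume n: "norm v \<le> 1" and *: "\<forall>y. norm (v + y) \<le> 1 \<and> norm (v - y) \<le> 1 \<longrightarrow> y = 0"
  show "v extreme_point_of cball 0 1"
    unfolding extreme_point_of_def
  proof (intro conjI ballI notI)
    show "v \<in> cball 0 1" using n by simp
    fix a b :: 'a assume ab: "a \<in> cball 0 1" "b \<in> cball 0 1" and seg: "v \<in> open_segment a b"
    then obtain u where u: "a \<noteq> b" "0 < u" "u < 1" "v = (1 - u) *\<^sub>R a + u *\<^sub>R b"
      by (auto simp: in_segment)
    \<comment> \<open>The factor \<open>min u (1 - u)\<close> is the largest for which both
      \<open>v + y\<close> and \<open>v - y\<close> stay on the segment from \<open>a\<close> to
      \<open>b\<close>.\<close>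
    define y where "y = min u (1 - u) *\<^sub>R (b - a)"
    have conv: "norm ((1 - s) *\<^sub>R a + s *\<^sub>R b) \<le> 1" if "0 \<le> s" "s \<le> 1" for s
      using convexD[OF convex_cball ab, of "1 - s" s] that by simp
    have "v + y = (1 - (u + min u (1 - u))) *\<^sub>R a + (u + min u (1 - u)) *\<^sub>R b"
      "v - y = (1 - (u - min u (1 - u))) *\<^sub>R a + (u - min u (1 - u)) *\<^sub>R b"
      by (simp_all add: u y_def algebra_simps)
    then have "norm (v + y) \<le> 1" "norm (v - y) \<le> 1"
      using u conv[of "u + min u (1 - u)"] conv[of "u - min u (1 - u)"] by auto
    then have "y = 0" using * by blast
    then show False using u by (auto simp: y_def min_def split: if_splits)
  qed
qed

lemma star_mult_eq_zero_iff [simp]: "star x * x = 0 \<longleftrightarrow> x = (0::'a::cstar_algebra)"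
  using cstar_identity[of x] by auto

lemma scaleR_3_4: "3 *\<^sub>R x = x + x + x" "4 *\<^sub>R x = x + x + x + (x::'a::real_vector)"
  using scaleR_left_distrib[of 2 1 x] scaleR_left_distrib[of 2 2 x] by (simp_all add: scaleR_2)

text \<open>\<open>c\<close> stands for the unit and small multiples are written as sums, so both
  identities are plain expansions without numerals. With \<open>h = star v * v\<close> they compute
  four times the defects \<open>1 - star u * u\<close> of the two perturbations of
  \<open>v\<close>.\<close>

lemma cubic_identities:
  fixes c h :: "'a::ring"
  assumes "c * c = c" "c * h = h" "h * c = h"
  shows "(c + c + c + c) - (c + c + c - h) * (h * (c + c + c - h)) =
      (c - h) * (c - h) * (c + c + c + c - h)"
    and "(c + c + c + c) - (c + h) * (h * (c + h)) = (c - h) * (c + c + c + c + (h + h + h) + h * h)"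
proof -
  have "c * (h * z) = h * z" for z using assms(2) by (simp flip: mult.assoc)
  then show "(c + c + c + c) - (c + c + c - h) * (h * (c + c + c - h)) =
      (c - h) * (c - h) * (c + c + c + c - h)"
    and "(c + c + c + c) - (c + h) * (h * (c + h)) = (c - h) * (c + c + c + c + (h + h + h) + h * h)"
    using assms by (simp_all add: algebra_simps)
qed

text \<open>With \<open>h = v\<^sup>* v\<close>, the element \<open>v\<close> is the midpoint of \<open>v (1 \<plusminus> (1 - h)/2)\<close>, both of norm at most
  \<open>1\<close> because \<open>1 - s (3 - s)\<^sup>2/4 = (1 - s)\<^sup>2 (4 - s)/4\<close> and
  \<open>1 - s (1 + s)\<^sup>2/4 = (1 - s) (4 + 3 s + s\<^sup>2)/4\<close>.\<close>

lemma extreme_imp_partial_isometry: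
  fixes v :: "'a::cstar_algebra_1"
  assumes v: "v \<in> extremes"
  shows "v * star v * v = v"
proof -
  have n: "norm v \<le> 1" and ex: "\<And>y. norm (v + y) \<le> 1 \<Longrightarrow> norm (v - y) \<le> 1 \<Longrightarrow> y = 0"
    using v by (auto simp: extremes_def extreme_point_of_cball_iff)
  define h where "h = star v * v"
  have h: "positive h" "positive (1 - h)" "star h = h"
    using n by (auto simp: h_def norm_le_one_iff star_mult star_star)
  define y where "y = (1/2) *\<^sub>R (v * (1 - h))"
  have c4: "positive (4 *\<^sub>R 1 - h)"
    using positive_add[OF h(2) positive_of_real[of 3]] by (simp only: of_real_def scaleR_3_4) (simp add: algebra_simps)
  have hv: "star v * (v * z) = h * z" for z by (simp add: h_def mult.assoc)
  have four: "1 - star u * u = (1/4) *\<^sub>R (4 *\<^sub>R 1 - star (2 *\<^sub>R u) * (2 *\<^sub>R u))" for u :: 'a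
    by (simp add: star_scaleR scaleR_diff_right)
  have "2 *\<^sub>R (v + y) = v * (3 *\<^sub>R 1 - h)"
    unfolding y_def scaleR_add_right by (simp add: right_diff_distrib scaleR_2) (simp add: scaleR_3_4)
  then have "star (2 *\<^sub>R (v + y)) * (2 *\<^sub>R (v + y)) = (3 *\<^sub>R 1 - h) * (h * (3 *\<^sub>R 1 - h))"
    by (simp add: star_mult star_diff star_scaleR h(3) mult.assoc hv)
  then have "1 - star (v + y) * (v + y) = (1/4) *\<^sub>R ((1 - h) * (1 - h) * (4 *\<^sub>R 1 - h))"
    unfolding four[of "v + y"] using cubic_identities(1)[of 1 h] by (simp only: scaleR_3_4) simp
  also have "positive \<dots>"
    using h c4 by (intro positive_scaleR positive_mult) (auto simp: algebra_simps)
  finally have 1: "norm (v + y) \<le> 1" by (simp only: norm_le_one_iff)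
  have "2 *\<^sub>R (v - y) = v * (1 + h)"
    unfolding y_def scaleR_diff_right by (simp add: right_diff_distrib scaleR_2 distrib_left)
  then have "star (2 *\<^sub>R (v - y)) * (2 *\<^sub>R (v - y)) = (1 + h) * (h * (1 + h))"
    by (simp add: star_mult star_add h(3) mult.assoc hv)
  then have "1 - star (v - y) * (v - y) = (1/4) *\<^sub>R ((1 - h) * (of_real 4 + 3 *\<^sub>R h + h * h))"
    unfolding four[of "v - y"] of_real_def
    using cubic_identities(2)[of 1 h] by (simp only: scaleR_3_4) simp
  also have "positive \<dots>"
    using h by (intro positive_scaleR positive_mult positive_add positive_of_real)
      (auto simp: algebra_simps of_real_def)
  finally have 2: "norm (v - y) \<le> 1" by (simp only: norm_le_one_iff)
  have "y = 0" using 1 2 by (rule ex)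
  then show ?thesis by (simp add: y_def h_def right_diff_distrib mult.assoc)
qed

text \<open>Source and range of \<open>y\<close> are orthogonal to those of \<open>v\<close>, so
  with \<open>p = 1 - star v * v\<close> the defect of \<open>v + y\<close> is the compression
  \<open>p (1 - star y * y) p\<close>.\<close>

lemma norm_add_le_one:
  fixes v y :: "'a::cstar_algebra_1"
  assumes v: "v * star v * v = v" and y: "norm y \<le> 1" "star v * y = 0" "y * star v = 0"
  shows "norm (v + y) \<le> 1"
proof -
  define p where "p = 1 - star v * v"
  have yv: "star y * v = 0" "v * star y = 0" using y(2,3)
    by (metis star_mult star_star star_zero)+
  have yp: "y * p = y" using y(3) by (simp add: p_def right_diff_distrib flip: mult.assoc)
  have p: "star p = p" "p * p = p"
    using v by (simp_all add: p_def star_diff star_mult star_star algebra_simps)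
  have "1 - star (v + y) * (v + y) = p - star y * y"
    by (simp add: star_add algebra_simps y yv p_def)
  also have "\<dots> = star p * (1 - star y * y) * p"
  proof -
    have "star p * (1 - star y * y) * p = star p * p - star (y * p) * (y * p)"
      by (simp add: star_mult algebra_simps)
    then show ?thesis by (simp only: yp p)
  qed
  also have "positive \<dots>"
    using y by (intro positive_conjugate) (simp flip: norm_le_one_iff)
  finally show ?thesis by (simp add: norm_le_one_iff)
qed

lemma partial_isometry_norm_le_one:
  fixes v :: "'a::cstar_algebra_1"
  assumes "v * star v * v = v"
  shows "norm v \<le> 1"
  using norm_add_le_one[OF assms, of 0] by simp

lemma partial_isometry_star:
  "v * star v * v = v \<Longrightarrow> star v * v * star v = star (v::'a::cstar_algebra)"
  by (drule arg_cong[of _ _ star]) (simp only: star_mult star_star mult.assoc)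

text \<open>By the parallelogram law the average of the two defects is
  \<open>1 - p - star y * y\<close>. Compressed by \<open>p\<close> it becomes
  \<open>- star (y p) * (y p)\<close>, which can be positive only if \<open>y p = 0\<close>.\<close>

lemma range_orthogonal:
  fixes v :: "'a::cstar_algebra_1"
  assumes v: "v * star v * v = v" and n: "norm (v + y) \<le> 1" "norm (v - y) \<le> 1"
  shows "y * (star v * v) = 0"
proof -
  define p where "p = star v * v"
  have p: "star p = p" "p * p = p"
    using partial_isometry_star[OF v] by (simp_all add: p_def star_mult star_star flip: mult.assoc)
  have "positive ((1/2) *\<^sub>R ((1 - star (v + y) * (v + y)) + (1 - star (v - y) * (v - y))))"
    using n by (intro positive_scaleR positive_add) (simp_all add: norm_le_one_iff)
  also have "(1 - star (v + y) * (v + y)) + (1 - star (v - y) * (v - y)) =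
      2 *\<^sub>R (1 - p - star y * y)"
    unfolding scaleR_2 by (simp add: p_def star_add star_diff algebra_simps)
  also have "(1/2) *\<^sub>R 2 *\<^sub>R (1 - p - star y * y) = 1 - p - star y * y"
    by simp
  finally have "positive (star p * (1 - p - star y * y) * p)"
    by (rule positive_conjugate)
  also have "star p * (1 - p - star y * y) * p = - (star (y * p) * (y * p))"
    using p by (simp add: algebra_simps star_mult)
  finally have "star (y * p) * (y * p) = 0"
    by (rule star_mult_zero_of_negative)
  then show ?thesis by (simp add: p_def)
qed

text \<open>Kadison's criterion. An element of the corner between the two defect projections, scaled
  into the ball, can be added to and subtracted from \<open>v\<close>; conversely
  \<open>range_orthogonal\<close> for \<open>v\<close> and for \<open>star v\<close> confines every
  admissible perturbation to that corner.\<close>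

lemma extremes_iff:
  fixes v :: "'a::cstar_algebra_1"
  shows "v \<in> extremes \<longleftrightarrow>
    v * star v * v = v \<and> (\<forall>x. (1 - v * star v) * x * (1 - star v * v) = 0)"
proof (intro iffI conjI allI)
  assume v: "v \<in> extremes"
  then show pi: "v * star v * v = v" by (rule extreme_imp_partial_isometry)
  note pi' = partial_isometry_star[OF pi]
  fix x
  define z where "z = (1 - v * star v) * x * (1 - star v * v)"
  define y where "y = (1 / (norm z + 1)) *\<^sub>R z"
  have ny: "norm y \<le> 1" by (simp add: y_def add_nonneg_pos divide_le_eq)
  have "star v * (1 - v * star v) = 0" "(1 - star v * v) * star v = 0"
    using pi' by (simp_all add: algebra_simps)
  then have "star v * z = 0" "z * star v = 0"
    unfolding z_def by (metis mult.assoc mult_zero_left mult_zero_right)+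
  then have vy: "star v * y = 0" "y * star v = 0" by (simp_all add: y_def)
  have "norm (v + y) \<le> 1" "norm (v + (- y)) \<le> 1"
    using ny vy by (intro norm_add_le_one[OF pi]; simp)+
  then have "y = 0" using v by (simp add: extremes_def extreme_point_of_cball_iff)
  moreover have "norm z + 1 \<noteq> 0" using norm_ge_zero[of z] by linarith
  ultimately show "z = 0" by (simp add: y_def)
next
  assume v: "v * star v * v = v \<and> (\<forall>x. (1 - v * star v) * x * (1 - star v * v) = 0)"
  have "y = 0" if n: "norm (v + y) \<le> 1" "norm (v - y) \<le> 1" for y
  proof -
    have 1: "y * (star v * v) = 0" using v n by (intro range_orthogonal) auto
    have "norm (star v + star y) \<le> 1" "norm (star v - star y) \<le> 1"
      using n by (metis norm_star star_add, metis norm_star star_diff)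
    moreover have "star v * star (star v) * star v = star v"
      using v by (metis partial_isometry_star star_star)
    ultimately have "star y * (star (star v) * star v) = 0"
      by (intro range_orthogonal)
    then have 2: "v * star v * y = 0"
      by (metis star_mult star_star star_zero)
    have "(1 - v * star v) * y * (1 - star v * v) = y"
      using 1 2 by (simp add: algebra_simps mult.assoc)
    then show ?thesis using v by metis
  qed
  then show "v \<in> extremes"
    using partial_isometry_norm_le_one v by (auto simp: extremes_def extreme_point_of_cball_iff)
qed

subsection \<open>Quasi-invertible elements\<close>

text \<open>Kadison's criterion with \<open>star v\<close> replaced by a generalized inverse.
  Without the involution the condition is stable under multiplication by invertible
  elements.\<close>

definition quasi_inverse :: "'a::cstar_algebra_1 \<Rightarrow> 'a \<Rightarrow> bool" where
  "quasi_inverse x w \<longleftrightarrow> x * w * x = x \<and> (\<forall>a. (1 - x * w) * a * (1 - w * x) = 0)"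

lemma quasi_inverse_of_extreme: "v \<in> extremes \<Longrightarrow> quasi_inverse v (star v)"
  by (simp add: quasi_inverse_def extremes_iff)

lemma extreme_of_quasi_inverse:
  fixes v :: "'a::cstar_algebra_1"
  assumes "v * star v * v = v" "quasi_inverse v w"
  shows "v \<in> extremes"
  unfolding extremes_iff
proof (intro conjI allI)
  fix a
  have "(1 - v * star v) * (1 - v * w) = 1 - v * star v"
    using assms(1) by (simp add: right_diff_distrib left_diff_distrib flip: mult.assoc)
  moreover have "(1 - w * v) * (1 - star v * v) = 1 - star v * v"
    using assms(1) by (simp add: right_diff_distrib left_diff_distrib mult.assoc)
  ultimately have "(1 - v * star v) * a * (1 - star v * v) =
      (1 - v * star v) * ((1 - v * w) * a * (1 - w * v)) * (1 - star v * v)"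
    by (metis mult.assoc)
  then show "(1 - v * star v) * a * (1 - star v * v) = 0"
    using assms(2) by (simp add: quasi_inverse_def)
qed (rule assms(1))

lemma quasi_inverse_mult:
  fixes g h :: "'a::cstar_algebra_1"
  assumes q: "quasi_inverse x w" and g: "g * g' = 1" "g' * g = 1" and h: "h * h' = 1" "h' * h = 1"
  shows "quasi_inverse (g * x * h) (h' * w * g')"
  unfolding quasi_inverse_def
proof (intro conjI allI)
  have "g * x * h * (h' * w * g') = g * (x * w) * g'" "h' * w * g' * (g * x * h) = h' * (w * x) * h"
    using g h by (metis mult.assoc mult_1_left)+
  then have e: "1 - g * x * h * (h' * w * g') = g * (1 - x * w) * g'"
    "1 - h' * w * g' * (g * x * h) = h' * (1 - w * x) * h"
    using g h by (simp_all add: algebra_simps)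
  have "g * x * h * (h' * w * g') * (g * x * h) = g * (x * w * x) * h"
    using g h by (metis mult.assoc mult_1_left)
  then show "g * x * h * (h' * w * g') * (g * x * h) = g * x * h"
    using q by (simp add: quasi_inverse_def)
  fix a
  have "g * (1 - x * w) * g' * a * (h' * (1 - w * x) * h) =
      g * ((1 - x * w) * (g' * a * h') * (1 - w * x)) * h"
    by (simp add: mult.assoc)
  then show "(1 - g * x * h * (h' * w * g')) * a * (1 - h' * w * g' * (g * x * h)) = 0"
    unfolding e using q by (simp add: quasi_inverse_def)
qed

lemma quasi_inverse_of_quasi_invertible:
  "x \<in> quasi_invertibles \<Longrightarrow> \<exists>w. quasi_inverse (x::'a::cstar_algebra_1) w"
proof -
  assume "x \<in> quasi_invertibles"
  then obtain g v h where "x = g * v * h" "g \<in> invertibles" "v \<in> extremes" "h \<in> invertibles"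
    by (auto simp: quasi_invertibles_def)
  then show ?thesis
    using quasi_inverse_mult[OF quasi_inverse_of_extreme, of v g _ h] by (metis inv_elem)
qed

lemma invertibles_star_mult_diff:
  fixes f :: "'a::cstar_algebra_1"
  shows "1 + star (f - star f) * (f - star f) \<in> invertibles"
proof -
  let ?k = "\<i> *\<^sub>C (f - star f)"
  have "star ?k = ?k"
    by (simp add: star_scaleC star_diff star_star scaleC_minus_left scaleC_diff_right)
  then have "?k * ?k + of_real 1 \<in> invertibles" by (rule invertibles_square_plus) simp
  also have "?k * ?k + of_real 1 = 1 + star (f - star f) * (f - star f)"
    by (simp add: scaleC_simps scaleC_diff_right star_diff star_star algebra_simps)
  finally show ?thesis .
qed

text \<open>Kaplansky's formula: \<open>z = 1 + star (f - star f) * (f - star f)\<close> is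
  invertible and commutes with \<open>f\<close> and \<open>star f\<close>, and
  \<open>f * z = f * star f * f\<close>. Hence \<open>q = f * star f * inv_elem z\<close> is a
  projection with the range of \<open>f\<close>.\<close>

lemma idempotent_range_projection:
  fixes f :: "'a::cstar_algebra_1"
  assumes f: "f * f = f"
  obtains q where "star q = q" "q * q = q" "q * f = f" "f * q = q"
proof -
  define z where "z = 1 + star (f - star f) * (f - star f)"
  have z: "z \<in> invertibles" unfolding z_def by (rule invertibles_star_mult_diff)
  have ff: "star f * star f = star f" using f by (metis star_mult)
  have zeq: "z = 1 + star f * f - star f - f + f * star f"
    by (simp add: z_def star_diff star_star algebra_simps f ff)
  have fz: "f * z = f * star f * f" "z * f = f * star f * f"
    by (simp_all add: zeq distrib_left distrib_right right_diff_distrib left_diff_distrib f mult.assoc)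
       (simp_all add: f flip: mult.assoc)
  have sz: "star z = z" by (simp add: z_def star_add star_mult star_star)
  have fz': "star f * z = z * star f"
    using fz by (metis star_mult sz)
  let ?r = "inv_elem z"
  have r: "z * ?r = 1" "?r * z = 1" "star ?r = ?r"
    using inv_elem[OF z] star_inv_elem[OF z] sz by auto
  have fr: "f * ?r = ?r * f" "star f * ?r = ?r * star f"
    using fz fz' by (auto intro!: inv_elem_commute z)
  define q where "q = f * star f * ?r"
  have 1: "star q = q" by (simp add: q_def star_mult star_star r(3)) (metis fr mult.assoc)
  have "q * f = f * star f * f * ?r" unfolding q_def by (metis fr mult.assoc)
  also have "\<dots> = f" by (metis fz(1) r(1) mult.assoc mult_1_right)
  finally have 2: "q * f = f" .
  have 3: "f * q = q" by (simp add: q_def f flip: mult.assoc)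
  have "q * q = (q * f) * (star f * ?r)" by (simp add: q_def mult.assoc)
  then have "q * q = q" by (simp only: 2) (simp add: q_def mult.assoc)
  then show ?thesis using 1 2 3 that by blast
qed

text \<open>The Moore-Penrose inverse. It is unique and defined by equations, so every homomorphism
  carries it to the Moore-Penrose inverse of the image.\<close>

definition MP_inverse :: "'a::cstar_algebra_1 \<Rightarrow> 'a \<Rightarrow> bool" where
  "MP_inverse x w \<longleftrightarrow> x * w * x = x \<and> w * x * w = w \<and> star (x * w) = x * w \<and> star (w * x) = w * x"

text \<open>Let \<open>q\<close> and \<open>p\<close> be the range projections of the idempotents
  \<open>x * w\<close> and \<open>star (w * x)\<close>. Then \<open>w' = p * w * q\<close> satisfies
  \<open>x * w' = q\<close> and \<open>w' * x = p\<close>.\<close>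

lemma MP_inverse_exists:
  fixes x :: "'a::cstar_algebra_1"
  assumes x: "x * w * x = x"
  obtains w' where "MP_inverse x w'"
proof -
  have "(x * w) * (x * w) = x * w" using x by (metis mult.assoc)
  then obtain q where q: "star q = q" "q * q = q" "q * (x * w) = x * w" "(x * w) * q = q"
    using idempotent_range_projection by metis
  have "star (w * x) * star (w * x) = star (w * x)" using x by (metis mult.assoc star_mult)
  then obtain p where p: "star p = p" "p * p = p" "p * star (w * x) = star (w * x)"
      "star (w * x) * p = p"
    using idempotent_range_projection by metis
  have p': "(w * x) * p = w * x" "p * (w * x) = p"
    using p by (metis star_mult star_star)+
  have xp: "x * p = x" using p'(1) x by (metis mult.assoc)
  have qx: "q * x = x" using q(3) x by (metis mult.assoc)
  let ?w = "p * w * q"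
  have xw: "x * ?w = q" using xp q(4) by (metis mult.assoc)
  have wx: "?w * x = p" using qx p'(2) by (metis mult.assoc)
  have "MP_inverse x ?w"
    unfolding MP_inverse_def mult.assoc[of ?w] xw wx
    using q p qx by (simp add: xw wx) (metis mult.assoc)
  then show ?thesis using that by blast
qed

lemma MP_inverse_unique:
  fixes x :: "'a::cstar_algebra_1"
  assumes "MP_inverse x w" "MP_inverse x w'"
  shows "w = w'"
proof -
  have "x * w = star (x * w' * (x * w))" using assms unfolding MP_inverse_def by (metis mult.assoc)
  also have "\<dots> = x * w'" using assms unfolding MP_inverse_def by (metis mult.assoc star_mult)
  finally have 1: "x * w = x * w'" .
  have "w * x = star (w * x * (w' * x))" using assms unfolding MP_inverse_def by (metis mult.assoc)
  also have "\<dots> = w' * x" using assms unfolding MP_inverse_def by (metis mult.assoc star_mult)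
  finally have 2: "w * x = w' * x" .
  show ?thesis using assms 1 2 unfolding MP_inverse_def by (metis mult.assoc)
qed

text \<open>From \<open>(1 - x u) (1 - x w) = 1 - x u\<close> and its mirror image, the defects for
  \<open>u\<close> factor through those for \<open>w\<close>. One may therefore switch to the
  Moore-Penrose inverse.\<close>

lemma quasi_inverse_change:
  fixes x :: "'a::cstar_algebra_1"
  assumes q: "quasi_inverse x w" and u: "x * u * x = x"
  shows "quasi_inverse x u"
  unfolding quasi_inverse_def
proof (intro conjI allI u)
  fix a
  have "(1 - x * u) * (1 - x * w) = 1 - x * u"
    using u by (simp add: right_diff_distrib left_diff_distrib flip: mult.assoc)
  moreover have "(1 - w * x) * (1 - u * x) = 1 - u * x"
    using u by (simp add: right_diff_distrib left_diff_distrib mult.assoc)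
  ultimately have "(1 - x * u) * a * (1 - u * x) =
      (1 - x * u) * ((1 - x * w) * a * (1 - w * x)) * (1 - u * x)"
    by (metis mult.assoc)
  then show "(1 - x * u) * a * (1 - u * x) = 0"
    using q by (simp add: quasi_inverse_def)
qed

text \<open>Polar decomposition \<open>x = v m\<close> with \<open>m\<^sup>2 = x\<^sup>* x + (1 - p)\<close>, where \<open>p\<close> is the support projection
  of \<open>x\<close>: the extra summand makes \<open>m\<close> invertible.\<close>

lemma quasi_invertibles_iff:
  fixes x :: "'a::cstar_algebra_1"
  shows "x \<in> quasi_invertibles \<longleftrightarrow> (\<exists>w. quasi_inverse x w)"
proof
  assume "\<exists>w. quasi_inverse x w"
  then obtain w0 where w0: "quasi_inverse x w0" by blast
  then obtain w where mp: "MP_inverse x w"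
    using MP_inverse_exists unfolding quasi_inverse_def by metis
  then have w: "x * w * x = x" "w * x * w = w" "star (x * w) = x * w" "star (w * x) = w * x"
    by (auto simp: MP_inverse_def)
  define p where "p = w * x"
  have p: "star p = p" "p * p = p" "x * p = x" "p * w = w"
    using w by (auto simp: p_def mult.assoc)
  have p': "star (1 - p) = 1 - p" "(1 - p) * (1 - p) = 1 - p" "x * (1 - p) = 0" "(1 - p) * w = 0"
    "(1 - p) * star x = 0"
    using p by (simp_all add: star_diff algebra_simps) (metis star_mult)
  have ws: "star w * (1 - p) = 0" using p'(1,4) by (metis star_mult star_zero)
  define s where "s = star x * x + (1 - p)"
  have "star x * x * (w * star w) = star x * star (x * w) * star w"
    using w by (simp add: mult.assoc)
  also have "\<dots> = star (w * x * w * x)" by (simp add: star_mult mult.assoc)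
  also have "\<dots> = p" using p by (simp add: w p_def)
  finally have a1: "star x * x * (w * star w) = p" .
  then have a2: "w * star w * (star x * x) = p"
    using p(1) by (metis star_mult star_star)
  have b: "star x * x * (1 - p) = 0" "(1 - p) * (w * star w) = 0" "w * star w * (1 - p) = 0"
    "(1 - p) * (star x * x) = 0"
    using p' ws by (metis mult.assoc mult_zero_left mult_zero_right)+
  \<comment> \<open>\<open>w * star w\<close> inverts \<open>star x * x\<close> in the corner of
    \<open>p\<close>, and \<open>1 - p\<close> is its own inverse in the complementary
    corner.\<close>
  have "s * (w * star w + (1 - p)) = 1" "(w * star w + (1 - p)) * s = 1"
    unfolding s_def distrib_left distrib_right a1 a2 b p' by simp_all
  then have sinv: "s \<in> invertibles" by (rule invertiblesI)
  have "positive (1 - p)" using p'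
    by (auto simp: positive_def self_adjoint_def intro!: exI[of _ "1 - p"])
  then have "positive s" unfolding s_def by (intro positive_add) auto
  then obtain m where m: "positive m" "s = m * m" "\<And>x. x * s = s * x \<Longrightarrow> x * m = m * x"
    using positive_root by blast
  have sm: "star m = m" using m(1) positive_self_adjoint self_adjointD by blast
  have minv: "m \<in> invertibles" using sinv m(2) by (metis invertibles_of_mult)
  let ?r = "inv_elem m"
  have r: "m * ?r = 1" "?r * m = 1" "star ?r = ?r"
    using inv_elem[OF minv] star_inv_elem[OF minv] sm by auto
  have ps: "p * s = star x * x" "s * p = star x * x"
    using p b(4) b(1) by (simp_all add: s_def algebra_simps)
  then have "p * m = m * p" by (intro m(3)) simp
  then have pr: "p * ?r = ?r * p" by (rule inv_elem_commute[OF minv])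
  define v where "v = x * ?r"
  have "star v * v = ?r * (star x * x) * ?r" by (simp add: v_def star_mult r mult.assoc)
  also have "\<dots> = ?r * (m * m * p) * ?r" by (simp add: ps(2)[symmetric] m(2))
  also have "\<dots> = p" using r pr by (metis mult.assoc mult_1_left mult_1_right)
  finally have vv: "star v * v = p" .
  have "v * p = v" unfolding v_def by (metis pr p(3) mult.assoc)
  then have vpi: "v * star v * v = v" by (simp add: mult.assoc vv)
  have "quasi_inverse (1 * x * ?r) (m * w0 * 1)"
    using w0 r by (intro quasi_inverse_mult) auto
  then have "v \<in> extremes"
    using vpi by (intro extreme_of_quasi_inverse) (auto simp: v_def)
  moreover have "x = 1 * v * m" using r by (simp add: v_def mult.assoc)
  ultimately show "x \<in> quasi_invertibles"
    using minv unfolding quasi_invertibles_def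
    by (intro CollectI exI[of _ 1] exI[of _ v] exI[of _ m]) simp
qed (rule quasi_inverse_of_quasi_invertible)

lemma quasi_invertibles_mult:
  fixes x :: "'a::cstar_algebra_1"
  assumes "x \<in> quasi_invertibles" "g \<in> invertibles" "h \<in> invertibles"
  shows "g * x * h \<in> quasi_invertibles"
proof -
  obtain a v b where "x = a * v * b" "a \<in> invertibles" "v \<in> extremes" "b \<in> invertibles"
    using assms(1) by (auto simp: quasi_invertibles_def)
  then have "g * x * h = (g * a) * v * (b * h)" "g * a \<in> invertibles" "b * h \<in> invertibles"
    using assms by (auto simp: mult.assoc intro: invertibles_mult)
  then show ?thesis using \<open>v \<in> extremes\<close> unfolding quasi_invertibles_def by blast
qed

text \<open>Homomorphisms preserve partial isometries, so for the image of an extreme point only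
  quasi-invertibility remains to be shown.\<close>

lemma extreme_of_quasi_invertible:
  "v * star v * v = v \<Longrightarrow> v \<in> quasi_invertibles \<Longrightarrow> (v::'a::cstar_algebra_1) \<in> extremes"
  using extreme_of_quasi_inverse quasi_invertibles_iff by blast

lemma extremes_subset_quasi_invertibles: "extremes \<subseteq> (quasi_invertibles :: 'a::cstar_algebra_1 set)"
  using quasi_inverse_of_extreme quasi_invertibles_iff by blast

text \<open>Writing \<open>e\<close> for the perturbation, \<open>x + e = (1 + e w) x + e (1 - w x)\<close>, and the second summand is
  absorbed since \<open>(1 - x w) a (1 - w x) = 0\<close>.\<close>

lemma quasi_inverse_factorization:
  fixes x :: "'a::cstar_algebra_1"
  assumes q: "quasi_inverse x w" and g: "(1 + e * w) * g' = 1" "g' * (1 + e * w) = 1"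
  shows "x + e = (1 + e * w) * x * (1 + w * g' * e * (1 - w * x))"
proof -
  have "(1 - x * w) * (g' * e) * (1 - w * x) = 0" using q by (simp add: quasi_inverse_def)
  then have "x * w * (g' * e) * (1 - w * x) = g' * e * (1 - w * x)"
    by (simp add: left_diff_distrib)
  then have "x * (w * g' * e * (1 - w * x)) = g' * e * (1 - w * x)"
    by (simp only: mult.assoc)
  then have "(1 + e * w) * x * (1 + w * g' * e * (1 - w * x)) =
      (1 + e * w) * x + (1 + e * w) * (g' * e * (1 - w * x))"
    by (simp add: distrib_left mult.assoc)
  also have "(1 + e * w) * (g' * e * (1 - w * x)) = e * (1 - w * x)"
    using g(1) by (metis mult.assoc mult_1_left)
  finally show ?thesis by (simp add: algebra_simps)
qed

subsection \<open>Unital homomorphisms\<close>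

locale unital_star_hom =
  fixes \<phi> :: "'a::cstar_algebra_1 \<Rightarrow> 'b::cstar_algebra_1"
  assumes hom: "star_hom \<phi>" and map_one [simp]: "\<phi> 1 = 1"
begin

lemma map_simps [simp]:
  "\<phi> (x + y) = \<phi> x + \<phi> y" "\<phi> (x * y) = \<phi> x * \<phi> y" "\<phi> (c *\<^sub>C x) = c *\<^sub>C \<phi> x" "\<phi> (star x) = star (\<phi> x)"
  using hom by (auto simp: star_hom_def)

lemma map_scaleR [simp]: "\<phi> (r *\<^sub>R x) = r *\<^sub>R \<phi> x"
  by (simp add: scaleR_as_scaleC)

lemma map_zero [simp]: "\<phi> 0 = 0"
  using map_simps(1)[of 0 0] by simp

lemma map_uminus [simp]: "\<phi> (- x) = - \<phi> x"
  using map_simps(1)[of x "- x"] by (simp add: eq_neg_iff_add_eq_0 add.commute)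

lemma map_diff [simp]: "\<phi> (x - y) = \<phi> x - \<phi> y"
  using map_simps(1)[of x "- y"] by simp

lemma map_of_real [simp]: "\<phi> (of_real r) = of_real r"
  by (simp add: of_real_def)

lemma map_sum [simp]: "\<phi> (sum f I) = (\<Sum>i\<in>I. \<phi> (f i))"
  by (induction I rule: infinite_finite_induct) simp_all

lemma map_self_adjoint: "self_adjoint x \<Longrightarrow> self_adjoint (\<phi> x)"
  unfolding self_adjoint_def by (metis map_simps(4))

lemma map_positive: "positive a \<Longrightarrow> positive (\<phi> a)"
  unfolding positive_def using map_self_adjoint by force

lemma norm_map_le: "norm (\<phi> x) \<le> norm x"
proof (cases "x = 0")
  case False
  let ?y = "(1 / norm x) *\<^sub>R x"
  have "norm ?y \<le> 1" using False by simp
  then have "positive (\<phi> (1 - star ?y * ?y))" by (intro map_positive) (simp only: norm_le_one_iff)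
  then have "norm (\<phi> ?y) \<le> 1" by (simp only: norm_le_one_iff) (simp add: star_scaleR)
  then show ?thesis using False by (simp add: divide_le_eq)
qed simp

lemma tendsto_map: "(X \<longlongrightarrow> x) F \<Longrightarrow> ((\<lambda>i. \<phi> (X i)) \<longlongrightarrow> \<phi> x) F"
  by (rule bounded_linear.tendsto, rule bounded_linear_intro[where K = 1]) (auto simp: norm_map_le)

lemma map_inv_elem:
  assumes "x \<in> invertibles"
  shows "\<phi> (inv_elem x) = inv_elem (\<phi> x)"
proof -
  have "\<phi> x * \<phi> (inv_elem x) = 1" "\<phi> (inv_elem x) * \<phi> x = 1"
    using inv_elem[OF assms] by (metis map_simps(2) map_one)+
  then show ?thesis by (metis inv_elem_unique)
qed

lemma map_invertibles: "x \<in> invertibles \<Longrightarrow> \<phi> x \<in> invertibles"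
  by (erule invertiblesE) (metis invertiblesI map_simps(2) map_one)

lemma map_MP_inverse: "MP_inverse x w \<Longrightarrow> MP_inverse (\<phi> x) (\<phi> w)"
  unfolding MP_inverse_def by (metis map_simps(2,4))

lemma map_quasi_invertibles_of_extremes:
  assumes "\<phi> ` extremes \<subseteq> extremes" "x \<in> quasi_invertibles"
  shows "\<phi> x \<in> quasi_invertibles"
proof -
  obtain a v b where "x = a * v * b" "a \<in> invertibles" "v \<in> extremes" "b \<in> invertibles"
    using assms(2) by (auto simp: quasi_invertibles_def)
  then show ?thesis using assms(1) extremes_subset_quasi_invertibles
    by (auto intro!: quasi_invertibles_mult map_invertibles)
qed

end

locale surjective_star_hom = unital_star_hom +
  assumes surj: "surj \<phi>"
begin

text \<open>The defect condition in the target quantifies over all its elements; surjectivity writes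
  each of them as an image.\<close>

lemma map_quasi_invertibles:
  assumes "x \<in> quasi_invertibles"
  shows "\<phi> x \<in> quasi_invertibles"
proof -
  obtain w where w: "quasi_inverse x w" using assms quasi_invertibles_iff by blast
  have "quasi_inverse (\<phi> x) (\<phi> w)"
    unfolding quasi_inverse_def
  proof (intro conjI allI)
    show "\<phi> x * \<phi> w * \<phi> x = \<phi> x" using w unfolding quasi_inverse_def by (metis map_simps(2))
    fix d
    obtain a where "d = \<phi> a" using surj by (metis surjD)
    then have "(1 - \<phi> x * \<phi> w) * d * (1 - \<phi> w * \<phi> x) = \<phi> ((1 - x * w) * a * (1 - w * x))" by simp
    then show "(1 - \<phi> x * \<phi> w) * d * (1 - \<phi> w * \<phi> x) = 0"
      using w by (simp only: quasi_inverse_def map_zero)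
  qed
  then show ?thesis using quasi_invertibles_iff by blast
qed

text \<open>The function \<open>t \<mapsto> 2 t / (1 + t\<^sup>2)\<close> maps the line onto \<open>[-1, 1]\<close>, and \<open>s / (1 + sqrt (1 - s\<^sup>2))\<close> is a
  right inverse. Thus an arbitrary lift of \<open>d / (1 + sqrt (1 - d\<^sup>2))\<close> yields a lift of \<open>d\<close> of norm at
  most \<open>1\<close>.\<close>

lemma lift_self_adjoint_contraction:
  assumes d: "self_adjoint d" "norm d \<le> 1"
  obtains c where "self_adjoint c" "\<phi> c = d" "norm c \<le> 1"
proof -
  have dd: "norm (d * d) \<le> 1" using d by (simp add: norm_square_self_adjoint power_le_one)
  define m where "m = sqrt_one_minus (d * d)"
  have m: "m * m = 1 - d * d" "d * m = m * d" "self_adjoint m" "norm (1 - m) \<le> 1"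
    unfolding m_def using dd norm_one_diff_sqrt_one_minus_le[OF dd] d
    by (auto intro!: sqrt_one_minus_square sqrt_one_minus_commute self_adjoint_sqrt_one_minus
        self_adjoint_intros simp: mult.assoc)
  \<comment> \<open>\<open>norm (1 - m) \<le> 1\<close> puts \<open>(1 + m) / 2\<close> within 1/2
    of 1, which makes \<open>1 + m\<close> invertible.\<close>
  have "1 - (1/2) *\<^sub>R (1 + m) = (1/2) *\<^sub>R (2 *\<^sub>R 1 - (1 + m))"
    by (simp only: scaleR_diff_right scaleR_scaleR) simp
  also have "2 *\<^sub>R 1 - (1 + m) = 1 - m" by (simp only: scaleR_2) (simp add: algebra_simps)
  finally have "norm (1 - (1/2) *\<^sub>R (1 + m)) < 1" using m(4) by simp
  then have "2 *\<^sub>R (1/2) *\<^sub>R (1 + m) \<in> invertibles"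
    by (intro invertibles_scaleR invertibles_near_one) auto
  then have inv: "1 + m \<in> invertibles" by simp
  define r where "r = inv_elem (1 + m)"
  have r: "(1 + m) * r = 1" "r * (1 + m) = 1" using inv_elem[OF inv] by (auto simp: r_def)
  have sr: "star r = r"
    using star_inv_elem[OF inv] m(3) by (simp add: r_def self_adjoint_def star_add)
  have dr: "d * r = r * d"
    unfolding r_def by (rule inv_elem_commute[OF inv]) (simp add: algebra_simps m(2))
  define e where "e = d * r"
  have se: "star e = e" using d(1) sr dr by (simp add: e_def star_mult self_adjoint_def)
  have em: "e * (1 + m) = d" using r by (simp add: e_def mult.assoc)
  have "e * e * (1 + m) = d * r * d" using em by (simp add: mult.assoc) (simp add: e_def mult.assoc)
  also have "\<dots> = r * (d * d)" using dr by (simp add: mult.assoc)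
  also have "d * d = (1 + m) * (1 - m)" by (simp add: m(1) algebra_simps)
  also have "r * \<dots> = 1 - m" using r by (metis mult.assoc mult_1_left)
  finally have eem: "(e * e + 1) * (1 + m) = 2 *\<^sub>R 1"
    by (simp only: distrib_right) (simp only: scaleR_2, simp)
  have "e * ((e * e + 1) * (1 + m)) = (e * e + 1) * (e * (1 + m))"
    by (simp add: algebra_simps)
  then have "(e * e + 1) * d = e * ((e * e + 1) * (1 + m))"
    by (simp only: em)
  then have ed: "(e * e + 1) * d = 2 *\<^sub>R e" by (simp only: eem) simp
  obtain c0 where c0: "\<phi> c0 = e" using surj by (metis surjD)
  define c1 where "c1 = (1/2) *\<^sub>R (c0 + star c0)"
  have c1: "self_adjoint c1" "\<phi> c1 = e"
    by (simp_all add: c1_def self_adjoint_def star_scaleR star_add star_star add.commute c0 se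
        flip: scaleR_2)
  define z where "z = c1 * c1 + 1"
  have z: "z \<in> invertibles"
    using invertibles_square_plus[of c1 1] c1(1) by (simp add: z_def self_adjoint_def)
  define s where "s = inv_elem z"
  have s: "z * s = 1" "s * z = 1" using inv_elem[OF z] by (auto simp: s_def)
  have sz: "star z = z" using c1 by (simp add: z_def self_adjoint_def star_add star_mult)
  have ss: "star s = s" using star_inv_elem[OF z] sz by (simp add: s_def)
  have cs: "c1 * s = s * c1"
    unfolding s_def by (rule inv_elem_commute[OF z]) (simp add: z_def algebra_simps)
  \<comment> \<open>\<open>2 t / (1 + t^2)\<close> and \<open>(1 - t^2) / (1 + t^2)\<close>
    parametrize the unit circle: \<open>c\<close> and \<open>k\<close> are commuting and
    self-adjoint with squares summing to 1, which bounds \<open>norm c\<close> by 1.\<close>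
  define c where "c = 2 *\<^sub>R (c1 * s)"
  define k where "k = (1 - c1 * c1) * s"
  have ks: "(1 - c1 * c1) * s = s * (1 - c1 * c1)"
    using cs by (simp add: algebra_simps) (metis mult.assoc)
  have sc: "self_adjoint c" "self_adjoint k"
    using c1(1) ss cs ks by (simp_all add: c_def k_def self_adjoint_def star_scaleR star_mult star_diff)
  have "c1 * s * (c1 * s) = c1 * c1 * (s * s)" using cs by (metis mult.assoc)
  moreover have "k * k = (1 - c1 * c1) * (1 - c1 * c1) * (s * s)"
    unfolding k_def using ks by (metis mult.assoc)
  ultimately have "c * c + k * k = (4 *\<^sub>R (c1 * c1) + (1 - c1 * c1) * (1 - c1 * c1)) * (s * s)"
    by (simp add: c_def distrib_right)
  also have "4 *\<^sub>R (c1 * c1) + (1 - c1 * c1) * (1 - c1 * c1) = z * z"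
    by (simp only: scaleR_3_4 z_def) (simp add: algebra_simps)
  also have "z * z * (s * s) = 1" using s by (metis mult.assoc mult_1_left)
  finally have sq: "c * c + k * k = of_real 1" by simp
  have ck: "c * k = k * c"
  proof -
    have "c1 * (1 - c1 * c1) = (1 - c1 * c1) * c1" by (simp add: algebra_simps)
    then have "c1 * s * ((1 - c1 * c1) * s) = (1 - c1 * c1) * s * (c1 * s)"
      using cs ks by (metis mult.assoc)
    then show ?thesis by (simp add: c_def k_def)
  qed
  have "norm c \<le> 1"
    using norm_sq_le_of_sum_squares[OF sc ck sq] by (simp add: power_le_one_iff)
  moreover have "\<phi> c = d"
  proof -
    have "\<phi> s * (e * e + 1) = 1"
      using s(2) c1(2) by (metis map_simps(1,2) map_one z_def)
    then have "d = \<phi> s * ((e * e + 1) * d)" by (metis mult.assoc mult_1_left)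
    then have "d = 2 *\<^sub>R (\<phi> s * e)" using ed by simp
    moreover have "\<phi> s * e = e * \<phi> s" using cs c1(2) by (metis map_simps(2))
    ultimately show ?thesis by (simp add: c_def c1(2))
  qed
  ultimately show ?thesis using sc(1) that by blast
qed

lemma lift_self_adjoint:
  assumes d: "self_adjoint d"
  obtains c where "self_adjoint c" "\<phi> c = d" "norm c \<le> norm d"
proof (cases "d = 0")
  case True
  then show ?thesis using that[of 0] by (simp add: self_adjoint_def)
next
  case False
  have "self_adjoint ((1 / norm d) *\<^sub>R d)" "norm ((1 / norm d) *\<^sub>R d) \<le> 1"
    using False d by (auto intro: self_adjoint_intros)
  then obtain c where c: "self_adjoint c" "\<phi> c = (1 / norm d) *\<^sub>R d" "norm c \<le> 1"
    using lift_self_adjoint_contraction by blast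
  then show ?thesis
    using False by (intro that[of "norm d *\<^sub>R c"]) (auto intro: self_adjoint_intros mult_left_le)
qed

text \<open>The constant 2 is the price of lifting real and imaginary parts separately.
  \<open>L\<close> is a pointwise choice, and the estimate serves as its continuity at 0.\<close>

lemma bounded_lift:
  obtains L where "\<And>d. \<phi> (L d) = d" "\<And>d. norm (L d) \<le> 2 * norm d"
    "\<And>d. self_adjoint d \<Longrightarrow> self_adjoint (L d)"
proof -
  have "\<exists>c. \<phi> c = d \<and> norm c \<le> 2 * norm d \<and> (self_adjoint d \<longrightarrow> self_adjoint c)" for d
  proof (cases "self_adjoint d")
    case True
    then obtain c where "self_adjoint c" "\<phi> c = d" "norm c \<le> norm d" by (rule lift_self_adjoint)
    then show ?thesis by (intro exI[of _ c]) (use norm_ge_zero[of d] in linarith)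
  next
    case False
    define a where "a = (1/2) *\<^sub>R (d + star d)"
    define b where "b = (1/2) *\<^sub>R (\<i> *\<^sub>C (star d - d))"
    have "self_adjoint a" "self_adjoint b"
      by (simp_all add: a_def b_def self_adjoint_def star_scaleR star_add star_diff star_scaleC
          star_star scaleC_minus_left scaleC_diff_right add.commute)
    then obtain c c' where c: "\<phi> c = a" "norm c \<le> norm a" "\<phi> c' = b" "norm c' \<le> norm b"
      using lift_self_adjoint by metis
    have ab: "d = a + \<i> *\<^sub>C b"
    proof -
      have "\<i> *\<^sub>C b = (1/2) *\<^sub>R (d - star d)"
        by (simp add: b_def scaleR_as_scaleC scaleC_simps scaleC_diff_right scaleC_minus_left)
      then show ?thesis by (simp add: a_def scaleR_add_right scaleR_diff_right flip: scaleR_left_distrib)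
    qed
    have "norm a \<le> norm d" "norm b \<le> norm d"
      using norm_triangle_ineq[of d "star d"] norm_triangle_ineq4[of "star d" d]
      by (auto simp: a_def b_def norm_scaleC)
    then have "norm (c + \<i> *\<^sub>C c') \<le> 2 * norm d"
      using norm_triangle_ineq[of c "\<i> *\<^sub>C c'"] c by (simp add: norm_scaleC)
    then show ?thesis using False c ab by (intro exI[of _ "c + \<i> *\<^sub>C c'"]) simp
  qed
  then show ?thesis using that by metis
qed

lemma tendsto_bounded_lift:
  assumes "\<And>d. norm (L d) \<le> 2 * norm d" and "(X \<longlongrightarrow> 0) F"
  shows "((\<lambda>i. L (X i)) \<longlongrightarrow> 0) F"
proof (rule Lim_null_comparison)
  show "\<forall>\<^sub>F i in F. norm (L (X i)) \<le> 2 * norm (X i)" by (simp add: assms(1))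
  show "((\<lambda>i. 2 * norm (X i)) \<longlongrightarrow> 0) F"
    using tendsto_mult_left[OF tendsto_norm_zero[OF assms(2)], of 2] by simp
qed

lemma lift_tendsto_one:
  assumes "(G \<longlongrightarrow> 1) F"
  obtains G' where "(G' \<longlongrightarrow> 1) F" "\<And>i. \<phi> (G' i) = G i"
proof -
  obtain L where L: "\<And>d. \<phi> (L d) = d" "\<And>d. norm (L d) \<le> 2 * norm d" using bounded_lift by metis
  have "((\<lambda>i. 1 + L (G i - 1)) \<longlongrightarrow> 1 + 0) F"
    using assms by (intro tendsto_add tendsto_const tendsto_bounded_lift[OF L(2)]) (simp add: LIM_zero_iff)
  then show ?thesis using L(1) by (intro that[of "\<lambda>i. 1 + L (G i - 1)"]) auto
qed

end

subsection \<open>Unimodular tuples\<close>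

text \<open>A Cauchy-Schwarz inequality with the crude constant \<open>2 ^ n\<close>: each induction
  step doubles it, the slack being \<open>star (s - z) * (s - z)\<close> for the partial sum
  \<open>s\<close> and the new term \<open>z\<close>.\<close>

lemma positive_sum_square_bound:
  fixes z :: "nat \<Rightarrow> 'a::cstar_algebra_1"
  shows "positive (2 ^ n *\<^sub>R (\<Sum>k<n. star (z k) * z k) - star (\<Sum>k<n. z k) * (\<Sum>k<n. z k))"
proof (induction n)
  case (Suc n)
  let ?s = "\<Sum>k<n. z k" and ?g = "\<Sum>k<n. star (z k) * z k"
  have "2 ^ Suc n *\<^sub>R (\<Sum>k<Suc n. star (z k) * z k) - star (\<Sum>k<Suc n. z k) * (\<Sum>k<Suc n. z k) =
    2 *\<^sub>R (2 ^ n *\<^sub>R ?g - star ?s * ?s) + (2 * (2 ^ n - 1)) *\<^sub>R (star (z n) * z n) +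
      star (?s - z n) * (?s - z n)"
    by (simp add: scaleR_add_right scaleR_diff_right scaleR_diff_left star_add star_diff)
      (simp add: algebra_simps scaleR_2)
  also have "positive \<dots>"
    by (intro positive_add positive_scaleR Suc.IH positive_star_mult) simp_all
  finally show ?case .
qed simp

text \<open>If \<open>l\<close> is a left inverse of the column, then
  \<open>1 \<le> 2^n M^2 g\<close> for the Gram element \<open>g\<close>, by the preceding
  inequality and \<open>norm (l k) \<le> M\<close>. The right-hand condition is free of the
  involution, so it can be followed through a factorization of the column.\<close>

lemma gram_invertible_iff:
  fixes y :: "nat \<Rightarrow> 'a::cstar_algebra_1"
  shows "(\<Sum>k<n. star (y k) * y k) \<in> invertibles \<longleftrightarrow> (\<exists>l. (\<Sum>k<n. l k * y k) = 1)"
proof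
  assume "(\<Sum>k<n. star (y k) * y k) \<in> invertibles"
  then obtain r where "r * (\<Sum>k<n. star (y k) * y k) = 1" by (rule invertiblesE)
  then show "\<exists>l. (\<Sum>k<n. l k * y k) = 1"
    by (intro exI[of _ "\<lambda>k. r * star (y k)"]) (simp add: sum_distrib_left mult.assoc)
next
  assume "\<exists>l. (\<Sum>k<n. l k * y k) = 1"
  then obtain l where l: "(\<Sum>k<n. l k * y k) = 1" by blast
  let ?g = "\<Sum>k<n. star (y k) * y k"
  define M where "M = (\<Sum>k<n. norm (l k))"
  have lM: "norm (l k) \<le> M" if "k < n" for k
    unfolding M_def using that by (intro member_le_sum) auto
  have "positive (2 ^ n *\<^sub>R (\<Sum>k<n. star (l k * y k) * (l k * y k)) - 1)"
    using positive_sum_square_bound[of n "\<lambda>k. l k * y k"] by (simp add: l)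
  moreover have "positive (\<Sum>k<n. star (y k) * (of_real (M\<^sup>2) - star (l k) * l k) * y k)"
    using lM by (intro positive_sum positive_conjugate positive_norm_square_minus) auto
  moreover have "positive ?g" by (intro positive_sum) simp
  \<comment> \<open>The extra \<open>?g\<close> makes its final coefficient
    \<open>2 ^ n * M^2 + 1\<close>, visibly positive, so that one can divide by it.\<close>
  ultimately have "positive (2 ^ n *\<^sub>R (\<Sum>k<n. star (l k * y k) * (l k * y k)) - 1 +
      2 ^ n *\<^sub>R (\<Sum>k<n. star (y k) * (of_real (M\<^sup>2) - star (l k) * l k) * y k) + ?g)"
    by (intro positive_add positive_scaleR; (assumption | simp))
  also have "(\<Sum>k<n. star (y k) * (of_real (M\<^sup>2) - star (l k) * l k) * y k) =
      M\<^sup>2 *\<^sub>R ?g - (\<Sum>k<n. star (l k * y k) * (l k * y k))"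
    by (simp add: of_real_def star_mult right_diff_distrib left_diff_distrib mult.assoc
        sum_subtractf scaleR_right.sum del: of_real_power)
  also have "2 ^ n *\<^sub>R (\<Sum>k<n. star (l k * y k) * (l k * y k)) - 1 +
      2 ^ n *\<^sub>R (M\<^sup>2 *\<^sub>R ?g - (\<Sum>k<n. star (l k * y k) * (l k * y k))) + ?g =
      (2 ^ n * M\<^sup>2 + 1) *\<^sub>R ?g - 1"
    by (simp add: scaleR_diff_right scaleR_add_left)
  finally have "(2 ^ n * M\<^sup>2 + 1) *\<^sub>R ?g - 1 + of_real 1 \<in> invertibles"
    by (rule invertibles_positive_plus) simp
  moreover have r: "2 ^ n * M\<^sup>2 + 1 > 0" by (simp add: add_nonneg_pos)
  ultimately have "(1 / (2 ^ n * M\<^sup>2 + 1)) *\<^sub>R (2 ^ n * M\<^sup>2 + 1) *\<^sub>R ?g \<in> invertibles"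
    by (intro invertibles_scaleR[of "_ *\<^sub>R ?g"]) simp_all
  then show "?g \<in> invertibles" using r by simp
qed

definition unimodular_dense :: "nat \<Rightarrow> 'a::cstar_algebra itself \<Rightarrow> bool" where
  "unimodular_dense d (_ :: 'a itself) \<longleftrightarrow> (\<forall>(x :: nat \<Rightarrow> 'a) \<epsilon>. \<epsilon> > 0 \<longrightarrow>
     (\<exists>y. (\<forall>k<d. norm (x k - y k) < \<epsilon>) \<and> (\<Sum>k<d. star (y k) * y k) \<in> invertibles))"

lemma unimodular_dense_Suc:
  assumes "unimodular_dense d TYPE('a::cstar_algebra_1)"
  shows "unimodular_dense (Suc d) TYPE('a)"
  unfolding unimodular_dense_def
proof (intro allI impI)
  fix x :: "nat \<Rightarrow> 'a" and \<epsilon> :: real assume "\<epsilon> > 0"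
  then obtain y where y: "\<forall>k<d. norm (x k - y k) < \<epsilon>" "(\<Sum>k<d. star (y k) * y k) \<in> invertibles"
    using assms unfolding unimodular_dense_def by blast
  from y(2) obtain l where l: "(\<Sum>k<d. l k * y k) = 1" unfolding gram_invertible_iff by blast
  have "(\<Sum>k<Suc d. (l(d := 0)) k * (y(d := x d)) k) = 1"
    using l by simp
  then have "(\<Sum>k<Suc d. star ((y(d := x d)) k) * (y(d := x d)) k) \<in> invertibles"
    using gram_invertible_iff by blast
  moreover have "\<forall>k<Suc d. norm (x k - (y(d := x d)) k) < \<epsilon>"
    using y(1) \<open>\<epsilon> > 0\<close> by (auto simp: less_Suc_eq)
  ultimately show "\<exists>y. (\<forall>k<Suc d. norm (x k - y k) < \<epsilon>) \<and>
      (\<Sum>k<Suc d. star (y k) * y k) \<in> invertibles"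
    by blast
qed

lemma unimodular_dense_mono:
  "unimodular_dense d TYPE('a::cstar_algebra_1) \<Longrightarrow> d \<le> e \<Longrightarrow> unimodular_dense e TYPE('a)"
  by (induction e) (auto simp: le_Suc_eq intro: unimodular_dense_Suc)

text \<open>The infimum is attained when finite, and density is monotone in the length of the tuple,
  so the bound is a condition on \<open>n\<close> itself.\<close>

lemma tsr_unital_le_iff:
  "tsr_unital TYPE('a::cstar_algebra_1) \<le> enat n \<longleftrightarrow> n \<ge> 1 \<and> unimodular_dense n TYPE('a)"
proof -
  let ?S = "{enat d | d. d \<ge> 1 \<and> unimodular_dense d TYPE('a)}"
  have eq: "tsr_unital TYPE('a) = Inf ?S"
    by (simp add: tsr_unital_def unimodular_dense_def)
  show ?thesis
  proof
    assume *: "tsr_unital TYPE('a) \<le> enat n"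
    have "?S \<noteq> {}"
    proof
      assume "?S = {}"
      then have "tsr_unital TYPE('a) = \<infinity>" unfolding eq by (simp add: Inf_enat_def)
      then show False using * by simp
    qed
    then have "Inf ?S \<in> ?S" unfolding Inf_enat_def by (auto intro: LeastI)
    then obtain d where "tsr_unital TYPE('a) = enat d" "d \<ge> 1" "unimodular_dense d TYPE('a)"
      unfolding eq by blast
    then show "n \<ge> 1 \<and> unimodular_dense n TYPE('a)"
      using * by (auto intro: unimodular_dense_mono)
  next
    assume "n \<ge> 1 \<and> unimodular_dense n TYPE('a)"
    then show "tsr_unital TYPE('a) \<le> enat n" unfolding eq by (intro Inf_lower) blast
  qed
qed

subsection \<open>Approximation within a fibre\<close>

lemma quasi_invertible_perturbation:
  fixes x :: "'a::cstar_algebra_1"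
  assumes x: "x \<in> quasi_invertibles" and X: "(X \<longlongrightarrow> x) F"
  obtains G H where "(G \<longlongrightarrow> 1) F" "(H \<longlongrightarrow> 1) F" "eventually (\<lambda>i. X i = G i * x * H i) F"
proof -
  obtain w where w: "quasi_inverse x w" using x quasi_invertibles_iff by blast
  define e where "e i = X i - x" for i
  have e: "(e \<longlongrightarrow> 0) F" using X by (simp add: e_def[abs_def] LIM_zero_iff)
  define G where "G i = 1 + e i * w" for i
  have "((\<lambda>i. 1 + e i * w) \<longlongrightarrow> 1 + 0 * w) F" by (intro tendsto_intros e)
  then have G: "(G \<longlongrightarrow> 1) F" by (simp add: G_def[abs_def])
  define H where "H i = 1 + w * inv_elem (G i) * e i * (1 - w * x)" for i
  have "((\<lambda>i. 1 + w * inv_elem (G i) * e i * (1 - w * x)) \<longlongrightarrow> 1 + w * 1 * 0 * (1 - w * x)) F"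
    by (intro tendsto_intros e tendsto_inv_elem G)
  then have H: "(H \<longlongrightarrow> 1) F" by (simp add: H_def[abs_def])
  have "eventually (\<lambda>i. X i = G i * x * H i) F"
    using eventually_invertibles[OF G]
  proof eventually_elim
    case (elim i)
    from quasi_inverse_factorization[OF w inv_elem[OF elim, unfolded G_def]]
    show ?case by (simp add: e_def H_def G_def)
  qed
  with G H show ?thesis by (rule that)
qed

lemma sequence_of_closure_UNIV:
  fixes x :: "'a::real_normed_vector"
  assumes "closure S = UNIV"
  obtains X where "\<And>n. X n \<in> S" "X \<longlonglongrightarrow> x"
  using assms closure_sequential[of x S] by auto

context surjective_star_hom
begin

text \<open>Approximants \<open>X n\<close> of \<open>c\<close> leave the fibre, but
  \<open>\<phi> (X n) = G n * \<phi> c * H n\<close> with factors tending to 1. Dividing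
  \<open>X n\<close> by lifts of these factors returns it to the fibre and disturbs it
  little.\<close>

lemma fibre_approximation_quasi_invertible:
  assumes dense: "closure quasi_invertibles = (UNIV :: 'a set)"
    and c: "\<phi> c \<in> quasi_invertibles" and \<epsilon>: "\<epsilon> > 0"
  obtains c' where "c' \<in> quasi_invertibles" "\<phi> c' = \<phi> c" "norm (c' - c) < \<epsilon>"
proof -
  obtain X where X: "\<And>n. X n \<in> quasi_invertibles" "X \<longlonglongrightarrow> c"
    using sequence_of_closure_UNIV[OF dense] by blast
  obtain G H where GH: "G \<longlonglongrightarrow> 1" "H \<longlonglongrightarrow> 1" "\<forall>\<^sub>F n in sequentially. \<phi> (X n) = G n * \<phi> c * H n"
    using quasi_invertible_perturbation[OF c tendsto_map[OF X(2)]] by blast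
  obtain G' where G': "G' \<longlonglongrightarrow> 1" "\<And>i. \<phi> (G' i) = G i" using lift_tendsto_one[OF GH(1)] by blast
  obtain H' where H': "H' \<longlonglongrightarrow> 1" "\<And>i. \<phi> (H' i) = H i" using lift_tendsto_one[OF GH(2)] by blast
  define Y where "Y n = inv_elem (G' n) * X n * inv_elem (H' n)" for n
  have "(\<lambda>n. inv_elem (G' n) * X n * inv_elem (H' n)) \<longlonglongrightarrow> 1 * c * 1"
    by (intro tendsto_intros tendsto_inv_elem G' H' X)
  then have "Y \<longlonglongrightarrow> c" by (simp add: Y_def[abs_def])
  from tendstoD[OF this \<epsilon>] have "\<forall>\<^sub>F n in sequentially. norm (Y n - c) < \<epsilon> \<and>
      Y n \<in> quasi_invertibles \<and> \<phi> (Y n) = \<phi> c"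
    using GH(3) eventually_invertibles[OF G'(1)] eventually_invertibles[OF H'(1)]
  proof eventually_elim
    case (elim n)
    note inv = inv_elem[OF map_invertibles[OF elim(3)]] inv_elem[OF map_invertibles[OF elim(4)]]
    have "\<phi> (Y n) = inv_elem (G n) * (G n * \<phi> c * H n) * inv_elem (H n)"
      using elim by (simp add: Y_def map_inv_elem G'(2) H'(2))
    also have "\<dots> = (inv_elem (G n) * G n) * \<phi> c * (H n * inv_elem (H n))"
      by (simp only: mult.assoc)
    also have "\<dots> = \<phi> c" using inv by (simp add: G' H')
    finally show ?case
      using elim X(1) by (auto simp: Y_def dist_norm intro!: quasi_invertibles_mult inv_elem_invertibles)
  qed
  from eventually_happens'[OF sequentially_bot this] show ?thesis using that by blast
qed

text \<open>If \<open>l d = 1\<close> for a row \<open>l\<close> and a column \<open>d\<close>, then \<open>d + e = (1 + e l) d\<close>; lifting \<open>e\<close> and \<open>l\<close> to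
  \<open>E\<close> and \<open>L\<close>, the matrix \<open>1 + E L\<close> has inverse \<open>1 - E (1 + L E)\<^sup>-\<^sup>1 L\<close>.\<close>

lemma fibre_approximation_unimodular:
  assumes dense: "unimodular_dense n TYPE('a)"
    and c: "(\<Sum>k<n. star (\<phi> (c k)) * \<phi> (c k)) \<in> invertibles" and \<epsilon>: "\<epsilon> > 0"
  obtains c' where "(\<Sum>k<n. star (c' k) * c' k) \<in> invertibles" "\<And>k. k < n \<Longrightarrow> \<phi> (c' k) = \<phi> (c k)"
    "\<And>k. k < n \<Longrightarrow> norm (c' k - c k) < \<epsilon>"
proof -
  have "\<exists>y. \<forall>m. (\<forall>k<n. norm (c k - y m k) < 1 / Suc m) \<and> (\<Sum>k<n. star (y m k) * y m k) \<in> invertibles"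
    using dense unfolding unimodular_dense_def by (intro choice allI) simp
  then obtain y where y: "\<And>m k. k < n \<Longrightarrow> norm (c k - y m k) < 1 / Suc m"
    "\<And>m. (\<Sum>k<n. star (y m k) * y m k) \<in> invertibles" by blast
  have ylim: "(\<lambda>m. y m k) \<longlonglongrightarrow> c k" if "k < n" for k
  proof -
    have "(\<lambda>m. y m k - c k) \<longlonglongrightarrow> 0"
      by (rule Lim_null_comparison[OF _ LIMSEQ_inverse_real_of_nat])
        (use y(1)[OF that] in \<open>auto intro!: always_eventually less_imp_le simp: norm_minus_commute inverse_eq_divide\<close>)
    then show ?thesis by (simp add: LIM_zero_iff)
  qed
  obtain T where T: "\<And>d. \<phi> (T d) = d" "\<And>d. norm (T d) \<le> 2 * norm d"
    using bounded_lift by metis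
  obtain l where l: "(\<Sum>k<n. l k * \<phi> (c k)) = 1" using iffD1[OF gram_invertible_iff c] by blast
  define E where "E m k = T (\<phi> (y m k) - \<phi> (c k))" for m k
  have E: "(\<lambda>m. E m k) \<longlonglongrightarrow> 0" if "k < n" for k
    unfolding E_def using tendsto_map[OF ylim[OF that]]
    by (intro tendsto_bounded_lift[of T, OF T(2)]) (simp add: LIM_zero_iff)
  define R where "R m = 1 + (\<Sum>k<n. T (l k) * E m k)" for m
  have "(\<lambda>m. T (l k) * E m k) \<longlonglongrightarrow> T (l k) * 0" if "k < n" for k
    by (rule tendsto_mult_left[OF E[OF that]])
  then have "(\<lambda>m. 1 + (\<Sum>k<n. T (l k) * E m k)) \<longlonglongrightarrow> 1 + (\<Sum>k<n. T (l k) * 0)"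
    by (intro tendsto_add tendsto_const tendsto_sum) simp
  then have R: "R \<longlonglongrightarrow> 1" by (simp add: R_def[abs_def])
  define s where "s m = (\<Sum>k<n. T (l k) * y m k)" for m
  have s: "s \<longlonglongrightarrow> (\<Sum>k<n. T (l k) * c k)"
    unfolding s_def[abs_def] by (intro tendsto_sum tendsto_mult_left ylim) auto
  \<comment> \<open>This is \<open>(1 + E L)^-1 y\<close> in coordinates, by the formula for the
    inverse; \<open>R m\<close> is \<open>1 + L E\<close> and \<open>s m\<close> is
    \<open>L y\<close>.\<close>
  define z where "z m k = y m k - E m k * inv_elem (R m) * s m" for m k
  have z: "(\<lambda>m. z m k) \<longlonglongrightarrow> c k" if "k < n" for k
  proof -
    have "(\<lambda>m. z m k) \<longlonglongrightarrow> c k - 0 * 1 * (\<Sum>k<n. T (l k) * c k)"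
      unfolding z_def
      by (intro tendsto_diff tendsto_mult E[OF that] ylim[OF that] s tendsto_inv_elem[OF R])
    then show ?thesis by simp
  qed
  have "\<forall>\<^sub>F m in sequentially. \<forall>k\<in>{..<n}. norm (z m k - c k) < \<epsilon>"
    using tendstoD[OF z \<epsilon>] by (intro eventually_ball_finite) (auto simp: dist_norm)
  moreover have "\<forall>\<^sub>F m in sequentially. R m \<in> invertibles" by (rule eventually_invertibles[OF R])
  ultimately have "\<forall>\<^sub>F m in sequentially. (\<forall>k\<in>{..<n}. norm (z m k - c k) < \<epsilon>) \<and> R m \<in> invertibles"
    by (rule eventually_conj)
  then obtain m where m: "\<And>k. k < n \<Longrightarrow> norm (z m k - c k) < \<epsilon>" "R m \<in> invertibles"
    using eventually_happens'[OF sequentially_bot] by (metis (no_types, lifting) lessThan_iff)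
  let ?r = "inv_elem (R m)"
  note r = inv_elem[OF m(2)]
  have "(\<Sum>k<n. T (l k) * z m k) = s m - (\<Sum>k<n. T (l k) * E m k) * ?r * s m"
    by (simp add: z_def right_diff_distrib sum_subtractf sum_distrib_right s_def[of m, symmetric]
        mult.assoc)
  also have "(\<Sum>k<n. T (l k) * E m k) = R m - 1" by (simp add: R_def)
  also have "s m - (R m - 1) * ?r * s m = ?r * s m"
    using r by (simp add: left_diff_distrib)
  finally have Lz: "(\<Sum>k<n. T (l k) * z m k) = ?r * s m" .
  have yz: "y m k = z m k + E m k * (\<Sum>j<n. T (l j) * z m j)" for k
    unfolding Lz by (simp add: z_def mult.assoc)
  obtain M where M: "(\<Sum>k<n. M k * y m k) = 1" using y(2) gram_invertible_iff by blast
  \<comment> \<open>Since \<open>y = (1 + E L) z\<close>, a left inverse \<open>M\<close> of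
    \<open>y\<close> gives the left inverse \<open>M (1 + E L)\<close> of \<open>z\<close>.\<close>
  define M' where "M' k = M k + (\<Sum>j<n. M j * E m j) * T (l k)" for k
  have "(\<Sum>k<n. M' k * z m k) =
      (\<Sum>k<n. M k * z m k) + (\<Sum>j<n. M j * E m j) * (\<Sum>k<n. T (l k) * z m k)"
    by (simp add: M'_def distrib_right sum.distrib sum_distrib_left mult.assoc)
  also have "\<dots> = (\<Sum>k<n. M k * (z m k + E m k * (\<Sum>j<n. T (l j) * z m j)))"
    by (simp add: distrib_left sum.distrib sum_distrib_right mult.assoc)
  also have "\<dots> = 1" by (simp only: yz[symmetric] M)
  finally have 1: "(\<Sum>k<n. star (z m k) * z m k) \<in> invertibles" using gram_invertible_iff by blast
  have \<phi>E: "\<phi> (E m k) = \<phi> (y m k) - \<phi> (c k)" for k by (simp add: E_def T)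
  have \<phi>r: "\<phi> (R m) * \<phi> ?r = 1" "\<phi> ?r * \<phi> (R m) = 1" using r by (metis map_simps(2) map_one)+
  \<comment> \<open>Both are \<open>l\<close> applied to the image of \<open>y\<close>, since
    \<open>l\<close> applied to the image of \<open>c\<close> is 1. Hence the correction in
    \<open>z\<close> maps to the image of \<open>E\<close>, the whole error in D.\<close>
  have "\<phi> (s m) = \<phi> (R m)"
    using l by (simp add: s_def R_def T \<phi>E right_diff_distrib sum_subtractf)
  then have "\<phi> (z m k) = \<phi> (c k)" for k
    by (simp add: z_def \<phi>E mult.assoc \<phi>r)
  then show ?thesis using that[of "z m"] 1 m(1) by blast
qed

text \<open>If \<open>d\<close> is self-adjoint and invertible, then \<open>h = sqrt (1 + d\<^sup>-\<^sup>1 e)\<close> satisfies \<open>h\<^sup>* d = d h\<close> for self-adjoint \<open>e\<close>,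
  hence \<open>d + e = h\<^sup>* d h\<close>.\<close>

lemma fibre_approximation_self_adjoint:
  assumes dense: "real_rank_zero_unital TYPE('a)"
    and c: "self_adjoint c" "\<phi> c \<in> invertibles" and \<epsilon>: "\<epsilon> > 0"
  obtains c' where "c' \<in> invertibles" "self_adjoint c'" "\<phi> c' = \<phi> c" "norm (c' - c) < \<epsilon>"
proof -
  have "c \<in> closure (invertibles \<inter> self_adjoints)"
    using dense c by (auto simp: real_rank_zero_unital_def self_adjoints_def self_adjoint_def)
  then obtain X where X: "\<And>n. X n \<in> invertibles" "\<And>n. star (X n) = X n" "X \<longlonglongrightarrow> c"
    unfolding closure_sequential self_adjoints_def by auto
  define d where "d = \<phi> c"
  have sd: "star d = d" using c(1) map_self_adjoint by (simp add: d_def self_adjoint_def)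
  define r where "r = inv_elem d"
  have r: "d * r = 1" "r * d = 1" "star r = r"
    using inv_elem[OF c(2)] star_inv_elem[OF c(2)] sd by (auto simp: r_def d_def)
  \<comment> \<open>The sign is chosen so that \<open>\<phi> (X n) = d (1 - r e)\<close>, matching
    \<open>sqrt_one_minus\<close>.\<close>
  define e where "e n = d - \<phi> (X n)" for n
  have se: "star (e n) = e n" for n
    using X(2)[of n] map_simps(4)[of "X n"] by (simp add: e_def star_diff sd)
  have "(\<lambda>n. \<phi> (X n)) \<longlonglongrightarrow> d" unfolding d_def by (rule tendsto_map[OF X(3)])
  from tendsto_diff[OF tendsto_const[of d] this] have e: "e \<longlonglongrightarrow> 0"
    by (simp add: e_def[abs_def])
  have "(\<lambda>n. r * e n) \<longlonglongrightarrow> r * 0" by (intro tendsto_intros e)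
  then have re: "(\<lambda>n. r * e n) \<longlonglongrightarrow> 0" by simp
  define h where "h n = sqrt_one_minus (r * e n)" for n
  have h: "h \<longlonglongrightarrow> 1" unfolding h_def by (rule tendsto_sqrt_one_minus[OF re])
  obtain G where G: "G \<longlonglongrightarrow> 1" "\<And>n. \<phi> (G n) = inv_elem (h n)"
    using lift_tendsto_one[OF tendsto_inv_elem[OF h]] by blast
  define Y where "Y n = star (G n) * X n * G n" for n
  have sG: "(\<lambda>n. star (G n)) \<longlonglongrightarrow> star 1"
    by (rule bounded_linear.tendsto[OF bounded_linear_star G(1)])
  have "(\<lambda>n. star (G n) * X n * G n) \<longlonglongrightarrow> star 1 * c * 1"
    by (intro tendsto_intros sG G X)
  then have "Y \<longlonglongrightarrow> c" by (simp add: Y_def[abs_def])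
  from tendstoD[OF this \<epsilon>] have "\<forall>\<^sub>F n in sequentially. norm (Y n - c) < \<epsilon> \<and>
      Y n \<in> invertibles \<and> self_adjoint (Y n) \<and> \<phi> (Y n) = \<phi> c"
    using eventually_invertibles[OF G(1)] eventually_invertibles[OF h] tendstoD[OF re zero_less_one]
  proof eventually_elim
    case (elim n)
    have n1: "norm (r * e n) \<le> 1" "norm (e n * r) \<le> 1"
      using elim(4) norm_star[of "r * e n"] by (simp_all add: star_mult r se)
    have sh: "star (h n) = sqrt_one_minus (e n * r)"
      by (simp add: h_def star_sqrt_one_minus[OF n1(1)] star_mult r se)
    \<comment> \<open>Both sides equal \<open>e n\<close>; this is the relation that the square root
      inherits as \<open>d * h n = star (h n) * d\<close>.\<close>
    have "d * (r * e n) = e n * r * d" using r by (simp add: mult.assoc) (simp flip: mult.assoc add: r)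
    then have dh: "d * h n = star (h n) * d"
      unfolding sh unfolding h_def by (rule sqrt_one_minus_intertwine[OF n1])
    have "star (h n) * d * h n = d * (h n * h n)" by (simp add: dh[symmetric] mult.assoc)
    also have "\<dots> = d * (1 - r * e n)" by (simp add: h_def sqrt_one_minus_square[OF n1(1)])
    also have "\<dots> = \<phi> (X n)" using r by (simp add: right_diff_distrib e_def flip: mult.assoc)
    finally have hX: "\<phi> (X n) = star (h n) * d * h n" by simp
    note hi = inv_elem[OF elim(3)]
    have "star (inv_elem (h n)) * star (h n) = 1" using hi by (metis star_mult star_one)
    then have "\<phi> (Y n) = d"
      using hi by (simp add: Y_def G(2) hX) (metis mult.assoc mult_1_left mult_1_right)
    moreover have "Y n \<in> invertibles"
      unfolding Y_def by (intro invertibles_mult invertibles_star elim X)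
    moreover have "self_adjoint (Y n)"
      by (simp add: Y_def self_adjoint_def star_mult star_star X(2) mult.assoc)
    ultimately show ?case using elim(1) by (simp add: dist_norm d_def)
  qed
  from eventually_happens'[OF sequentially_bot this] show ?thesis using that by blast
qed

end

subsection \<open>Pullbacks of unital algebras\<close>

locale unital_pullback =
  T: unital_star_hom \<tau> + P: surjective_star_hom \<pi> + E: unital_star_hom \<eta> + R: unital_star_hom \<rho>
  for \<tau> :: "'b::cstar_algebra_1 \<Rightarrow> 'd::cstar_algebra_1"
    and \<pi> :: "'c::cstar_algebra_1 \<Rightarrow> 'd"
    and \<eta> :: "'a::cstar_algebra_1 \<Rightarrow> 'b"
    and \<rho> :: "'a \<Rightarrow> 'c" +
  assumes commutes: "\<tau> (\<eta> a) = \<pi> (\<rho> a)"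
    and glue: "\<tau> b = \<pi> c \<Longrightarrow> \<exists>a. \<eta> a = b \<and> \<rho> a = c"
    and joint_inj: "\<eta> a = \<eta> a' \<Longrightarrow> \<rho> a = \<rho> a' \<Longrightarrow> a = a'"
begin

sublocale E: surjective_star_hom \<eta>
proof
  show "surj \<eta>" using glue P.surj by (metis surj_def)
qed

text \<open>The inverses of the two coordinates have the same image in D, by uniqueness of inverses,
  and therefore glue.\<close>

lemma invertibles_iff: "a \<in> invertibles \<longleftrightarrow> \<eta> a \<in> invertibles \<and> \<rho> a \<in> invertibles"
proof
  assume *: "\<eta> a \<in> invertibles \<and> \<rho> a \<in> invertibles"
  then have "\<tau> (inv_elem (\<eta> a)) = \<pi> (inv_elem (\<rho> a))"
    by (simp add: T.map_inv_elem P.map_inv_elem commutes)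
  then obtain b where b: "\<eta> b = inv_elem (\<eta> a)" "\<rho> b = inv_elem (\<rho> a)" using glue by blast
  show "a \<in> invertibles"
    by (rule invertiblesI[of _ b]; rule joint_inj) (use * in \<open>simp_all add: b inv_elem\<close>)
qed (auto intro: E.map_invertibles R.map_invertibles)

text \<open>Positivity is tested by invertibility of the translates \<open>a + t\<close>, which is
  already known to be coordinatewise.\<close>

lemma positive_iff: "positive a \<longleftrightarrow> positive (\<eta> a) \<and> positive (\<rho> a)"
proof
  assume *: "positive (\<eta> a) \<and> positive (\<rho> a)"
  show "positive a"
  proof (rule positive_of_invertibles)
    show "self_adjoint a"
      unfolding self_adjoint_def
      by (rule joint_inj) (use * in \<open>auto dest!: positive_self_adjoint simp: self_adjoint_def\<close>)
    show "a + of_real t \<in> invertibles" if "t > 0" for t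
      using * that by (simp add: invertibles_iff invertibles_positive_plus)
  qed
qed (auto intro: E.map_positive R.map_positive)

text \<open>The norm of A is not given as a maximum; it is bounded by the two coordinate norms
  because membership in the unit ball is a positivity statement.\<close>

lemma norm_less:
  assumes "norm (\<eta> a) < r" "norm (\<rho> a) < r"
  shows "norm a < r"
proof -
  define s where "s = max (norm (\<eta> a)) (norm (\<rho> a))"
  show ?thesis
  proof (cases "s = 0")
    case True
    then have "norm (\<eta> a) = 0" "norm (\<rho> a) = 0"
      using norm_ge_zero[of "\<eta> a"] norm_ge_zero[of "\<rho> a"] unfolding s_def by linarith+
    then have "a = 0" by (intro joint_inj) simp_all
    then show ?thesis using assms by simp
  next
    case False
    then have s: "s > 0" using norm_ge_zero[of "\<eta> a"] unfolding s_def by linarith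
    have "norm (\<eta> ((1 / s) *\<^sub>R a)) \<le> 1" "norm (\<rho> ((1 / s) *\<^sub>R a)) \<le> 1"
      using s by (simp_all add: divide_le_eq s_def)
    then have "norm ((1 / s) *\<^sub>R a) \<le> 1"
      unfolding norm_le_one_iff positive_iff by simp
    then have "norm a \<le> s" using s by simp
    then show ?thesis using assms by (simp add: s_def)
  qed
qed

text \<open>Arbitrary generalized inverses of the coordinates may differ in D. The Moore-Penrose
  inverses both map to that of the common image, so they glue.\<close>

lemma quasi_invertiblesI:
  assumes "\<eta> a \<in> quasi_invertibles" "\<rho> a \<in> quasi_invertibles"
  shows "a \<in> quasi_invertibles"
proof -
  obtain u v where uv: "quasi_inverse (\<eta> a) u" "quasi_inverse (\<rho> a) v"
    using assms unfolding quasi_invertibles_iff by blast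
  then obtain u' v' where mp: "MP_inverse (\<eta> a) u'" "MP_inverse (\<rho> a) v'"
    unfolding quasi_inverse_def using MP_inverse_exists by metis
  have "\<tau> u' = \<pi> v'"
    using T.map_MP_inverse[OF mp(1)] P.map_MP_inverse[OF mp(2)] unfolding commutes
    by (rule MP_inverse_unique)
  then obtain w where w: "\<eta> w = u'" "\<rho> w = v'" using glue by blast
  have "quasi_inverse (\<eta> a) u'" "quasi_inverse (\<rho> a) v'"
    using quasi_inverse_change uv mp unfolding MP_inverse_def by blast+
  then have "quasi_inverse a w"
    unfolding quasi_inverse_def by (intro conjI allI; intro joint_inj) (simp_all add: w)
  then show ?thesis using quasi_invertibles_iff by blast
qed

lemma unimodular_dense_pullback:
  assumes B: "unimodular_dense n TYPE('b)" and C: "unimodular_dense n TYPE('c)"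
  shows "unimodular_dense n TYPE('a)"
  unfolding unimodular_dense_def
proof (intro allI impI)
  fix x :: "nat \<Rightarrow> 'a" and \<epsilon> :: real assume \<epsilon>: "\<epsilon> > 0"
  obtain L where L: "\<And>d. \<pi> (L d) = d" "\<And>d. norm (L d) \<le> 2 * norm d" using P.bounded_lift by metis
  \<comment> \<open>Lifting may double a norm: an error below \<open>\<epsilon> / 4\<close> in B
    moves the element of C by less than \<open>\<epsilon> / 2\<close>, and the correction within the
    fibre takes the other half.\<close>
  have "\<epsilon> / 4 > 0" using \<epsilon> by simp
  then obtain b where b: "\<And>k. k < n \<Longrightarrow> norm (\<eta> (x k) - b k) < \<epsilon> / 4"
      "(\<Sum>k<n. star (b k) * b k) \<in> invertibles"
    using B[unfolded unimodular_dense_def, rule_format, of "\<epsilon> / 4" "\<lambda>k. \<eta> (x k)"] by blast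
  define c where "c k = \<rho> (x k) + L (\<tau> (b k) - \<tau> (\<eta> (x k)))" for k
  have pc: "\<pi> (c k) = \<tau> (b k)" for k by (simp add: c_def L commutes)
  have cn: "norm (c k - \<rho> (x k)) < \<epsilon> / 2" if "k < n" for k
  proof -
    have "norm (c k - \<rho> (x k)) \<le> 2 * norm (\<tau> (b k - \<eta> (x k)))" using L(2) by (simp add: c_def)
    also have "\<dots> \<le> 2 * norm (\<eta> (x k) - b k)"
      using T.norm_map_le[of "b k - \<eta> (x k)"] by (simp add: norm_minus_commute)
    finally show ?thesis using b(1)[OF that] by simp
  qed
  have "(\<Sum>k<n. star (\<pi> (c k)) * \<pi> (c k)) \<in> invertibles"
    using T.map_invertibles[OF b(2)] by (simp add: pc)
  moreover have "\<epsilon> / 2 > 0" using \<epsilon> by simp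
  ultimately obtain c' where c': "(\<Sum>k<n. star (c' k) * c' k) \<in> invertibles"
      "\<And>k. k < n \<Longrightarrow> \<pi> (c' k) = \<pi> (c k)" "\<And>k. k < n \<Longrightarrow> norm (c' k - c k) < \<epsilon> / 2"
    using P.fibre_approximation_unimodular[OF C] by blast
  have "\<exists>a. k < n \<longrightarrow> \<eta> a = b k \<and> \<rho> a = c' k" for k
    using glue[of "b k" "c' k"] c'(2)[of k] pc by auto
  then obtain y where y: "\<And>k. k < n \<Longrightarrow> \<eta> (y k) = b k" "\<And>k. k < n \<Longrightarrow> \<rho> (y k) = c' k" by metis
  have "norm (x k - y k) < \<epsilon>" if k: "k < n" for k
  proof (rule norm_less)
    show "norm (\<eta> (x k - y k)) < \<epsilon>" using b(1)[OF k] \<epsilon> y k by simp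
    have "norm ((\<rho> (x k) - c k) + (c k - c' k)) < \<epsilon> / 2 + \<epsilon> / 2"
      using cn[OF k] c'(3)[OF k] by (intro norm_add_less) (simp_all add: norm_minus_commute)
    then show "norm (\<rho> (x k - y k)) < \<epsilon>" by (simp add: y k)
  qed
  moreover have "(\<Sum>k<n. star (y k) * y k) \<in> invertibles"
    unfolding invertibles_iff using b(2) c'(1) y by simp
  ultimately show "\<exists>y. (\<forall>k<n. norm (x k - y k) < \<epsilon>) \<and> (\<Sum>k<n. star (y k) * y k) \<in> invertibles"
    by blast
qed

lemma tsr_unital_pullback:
  "tsr_unital TYPE('a) \<le> max (tsr_unital TYPE('b)) (tsr_unital TYPE('c))"
proof (cases "max (tsr_unital TYPE('b)) (tsr_unital TYPE('c))")
  case (enat n)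
  then have "tsr_unital TYPE('b) \<le> enat n" "tsr_unital TYPE('c) \<le> enat n"
    by (metis max.cobounded1 max.cobounded2)+
  then have "tsr_unital TYPE('a) \<le> enat n"
    unfolding tsr_unital_le_iff by (auto intro: unimodular_dense_pullback)
  then show ?thesis using enat by simp
qed simp

lemma real_rank_zero_unital_pullback:
  assumes B: "real_rank_zero_unital TYPE('b)" and C: "real_rank_zero_unital TYPE('c)"
  shows "real_rank_zero_unital TYPE('a)"
  unfolding real_rank_zero_unital_def
proof
  fix x :: 'a assume "x \<in> self_adjoints"
  then have x: "star x = x" by (simp add: self_adjoints_def)
  obtain L where L: "\<And>d. \<pi> (L d) = d" "\<And>d. norm (L d) \<le> 2 * norm d"
      "\<And>d. self_adjoint d \<Longrightarrow> self_adjoint (L d)"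
    using P.bounded_lift by metis
  show "x \<in> closure (invertibles \<inter> self_adjoints)"
    unfolding closure_approachable
  proof (intro allI impI)
    fix \<epsilon> :: real assume \<epsilon>: "\<epsilon> > 0"
    have sx: "star (\<eta> x) = \<eta> x" "star (\<rho> x) = \<rho> x" using x by (metis E.map_simps(4), metis R.map_simps(4))
    then have "\<eta> x \<in> closure (invertibles \<inter> self_adjoints)"
      using B by (auto simp: real_rank_zero_unital_def self_adjoints_def)
    moreover have "\<epsilon> / 4 > 0" using \<epsilon> by simp
    ultimately obtain b where b: "b \<in> invertibles" "star b = b" "norm (b - \<eta> x) < \<epsilon> / 4"
      unfolding closure_approachable dist_norm self_adjoints_def by blast
    define c where "c = \<rho> x + L (\<tau> (b - \<eta> x))"
    have pc: "\<pi> c = \<tau> b" by (simp add: c_def L(1) commutes)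
    have "self_adjoint (\<tau> (b - \<eta> x))"
      by (intro T.map_self_adjoint) (simp add: self_adjoint_def star_diff b sx)
    then have sc: "self_adjoint c" unfolding c_def
      by (intro self_adjoint_intros L) (simp_all add: self_adjoint_def sx)
    have cn: "norm (c - \<rho> x) < \<epsilon> / 2"
      using L(2)[of "\<tau> (b - \<eta> x)"] T.norm_map_le[of "b - \<eta> x"] b(3) by (simp add: c_def)
    have "\<pi> c \<in> invertibles" unfolding pc by (rule T.map_invertibles[OF b(1)])
    moreover have "\<epsilon> / 2 > 0" using \<epsilon> by simp
    ultimately obtain c' where c': "c' \<in> invertibles" "self_adjoint c'" "\<pi> c' = \<pi> c" "norm (c' - c) < \<epsilon> / 2"
      using P.fibre_approximation_self_adjoint[OF C sc] by blast
    obtain a where a: "\<eta> a = b" "\<rho> a = c'" using glue c'(3) pc by metis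
    have "norm (a - x) < \<epsilon>"
    proof (rule norm_less)
      show "norm (\<eta> (a - x)) < \<epsilon>" using b(3) \<epsilon> a by simp
      have "norm ((c' - c) + (c - \<rho> x)) < \<epsilon> / 2 + \<epsilon> / 2"
        using cn c'(4) by (intro norm_add_less)
      then show "norm (\<rho> (a - x)) < \<epsilon>" by (simp add: a)
    qed
    moreover have "a \<in> invertibles" unfolding invertibles_iff using b c' a by simp
    moreover have "star a = a"
      by (rule joint_inj) (use b c' a in \<open>simp_all add: self_adjoint_def\<close>)
    ultimately show "\<exists>y\<in>invertibles \<inter> self_adjoints. dist y x < \<epsilon>"
      unfolding self_adjoints_def dist_norm by blast
  qed
qed

lemma extremally_rich_unital_quotient:
  assumes "extremally_rich_unital TYPE('c)"
  shows "extremally_rich_unital TYPE('d)"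
proof -
  have "y \<in> closure quasi_invertibles" for y :: 'd
  proof -
    obtain x where x: "\<pi> x = y" using P.surj by (metis surjD)
    obtain X where X: "\<And>n. X n \<in> quasi_invertibles" "X \<longlonglongrightarrow> x"
      using sequence_of_closure_UNIV assms[unfolded extremally_rich_unital_def] by blast
    then show ?thesis
      unfolding closure_sequential
      using P.map_quasi_invertibles[OF X(1)] P.tendsto_map[OF X(2)] x
      by (intro exI[of _ "\<lambda>n. \<pi> (X n)"]) simp
  qed
  then show ?thesis by (auto simp: extremally_rich_unital_def)
qed

text \<open>Approximation within the fibre of \<eta> lifts the extreme point \<open>v\<close>
  exactly to a quasi-invertible \<open>a'\<close> of A. Then
  \<open>\<tau> v = \<pi> (\<rho> a')\<close> is a quasi-invertible partial isometry.\<close>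

lemma extremes_preserved_if:
  assumes A: "extremally_rich_unital TYPE('a)" and \<rho>: "\<rho> ` extremes \<subseteq> extremes"
  shows "\<tau> ` extremes \<subseteq> extremes"
proof safe
  fix v :: 'b assume v: "v \<in> extremes"
  obtain a where a: "\<eta> a = v" using E.surj by (metis surjD)
  have "\<eta> a \<in> quasi_invertibles" using v a extremes_subset_quasi_invertibles by blast
  \<comment> \<open>The tolerance 1 is arbitrary: what counts is
    \<open>\<eta> a' = v\<close>.\<close>
  then obtain a' where a': "a' \<in> quasi_invertibles" "\<eta> a' = v"
    using E.fibre_approximation_quasi_invertible[of a 1] A a
    by (auto simp: extremally_rich_unital_def)
  have "\<tau> v = \<pi> (\<rho> a')" using a' commutes by metis
  then have "\<tau> v \<in> quasi_invertibles"
    using P.map_quasi_invertibles R.map_quasi_invertibles_of_extremes[OF \<rho> a'(1)] by simp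
  moreover have "\<tau> v * star (\<tau> v) * \<tau> v = \<tau> v"
    using extreme_imp_partial_isometry[OF v] by (metis T.map_simps(2,4))
  ultimately show "\<tau> v \<in> extremes" by (intro extreme_of_quasi_invertible)
qed

context
  assumes C: "extremally_rich_unital TYPE('c)" and \<tau>: "\<tau> ` extremes \<subseteq> extremes"
begin

text \<open>\<open>b\<close> is prescribed and met exactly. Density in A uses a quasi-invertible
  \<open>b\<close> near \<open>\<eta> x\<close>; preservation of extreme points by \<rho> uses
  \<open>b = \<eta> x\<close> itself.\<close>

lemma quasi_invertible_approximation:
  assumes b: "b \<in> quasi_invertibles" "norm (b - \<eta> x) < \<epsilon> / 4"
  obtains a where "\<eta> a = b" "\<rho> a \<in> quasi_invertibles" "norm (a - x) < \<epsilon>"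
proof -
  have \<epsilon>: "\<epsilon> > 0" using b(2) norm_ge_zero[of "b - \<eta> x"] by linarith
  obtain L where L: "\<And>d. \<pi> (L d) = d" "\<And>d. norm (L d) \<le> 2 * norm d" using P.bounded_lift by metis
  define c where "c = \<rho> x + L (\<tau> (b - \<eta> x))"
  have pc: "\<pi> c = \<tau> b" by (simp add: c_def L(1) commutes)
  have cn: "norm (c - \<rho> x) < \<epsilon> / 2"
    using L(2)[of "\<tau> (b - \<eta> x)"] T.norm_map_le[of "b - \<eta> x"] b(2) by (simp add: c_def)
  have "\<pi> c \<in> quasi_invertibles"
    unfolding pc using \<tau> b(1) by (rule T.map_quasi_invertibles_of_extremes)
  moreover have "\<epsilon> / 2 > 0" using \<epsilon> by simp
  ultimately obtain c' where c': "c' \<in> quasi_invertibles" "\<pi> c' = \<pi> c" "norm (c' - c) < \<epsilon> / 2"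
    using P.fibre_approximation_quasi_invertible[of c "\<epsilon> / 2"] C
    by (auto simp: extremally_rich_unital_def)
  obtain a where a: "\<eta> a = b" "\<rho> a = c'" using glue c'(2) pc by metis
  have "norm (a - x) < \<epsilon>"
  proof (rule norm_less)
    show "norm (\<eta> (a - x)) < \<epsilon>" using b(2) \<epsilon> a by simp
    have "norm ((c' - c) + (c - \<rho> x)) < \<epsilon> / 2 + \<epsilon> / 2"
      using cn c'(3) by (intro norm_add_less)
    then show "norm (\<rho> (a - x)) < \<epsilon>" by (simp add: a)
  qed
  then show ?thesis using a c'(1) that by blast
qed

lemma extremally_rich_unital_pullback:
  assumes B: "extremally_rich_unital TYPE('b)"
  shows "extremally_rich_unital TYPE('a)"
proof -
  have "x \<in> closure quasi_invertibles" for x :: 'a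
    unfolding closure_approachable
  proof (intro allI impI)
    fix \<epsilon> :: real assume "\<epsilon> > 0"
    moreover have "\<eta> x \<in> closure quasi_invertibles" using B by (simp add: extremally_rich_unital_def)
    ultimately obtain b where b: "b \<in> quasi_invertibles" "norm (b - \<eta> x) < \<epsilon> / 4"
      unfolding closure_approachable dist_norm by (metis zero_less_divide_iff zero_less_numeral)
    from quasi_invertible_approximation[OF this] obtain a
      where "\<eta> a = b" "\<rho> a \<in> quasi_invertibles" "norm (a - x) < \<epsilon>" .
    then show "\<exists>y\<in>quasi_invertibles. dist y x < \<epsilon>"
      unfolding dist_norm using quasi_invertiblesI b(1) by blast
  qed
  then show ?thesis by (auto simp: extremally_rich_unital_def)
qed

text \<open>Inside the fibre of \<open>\<eta>\<close> over \<open>\<eta> v\<close> we find \<open>a\<close> close to \<open>v\<close> with \<open>\<rho> a\<close> quasi-invertible, and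
  \<open>a = g v h\<close> with \<open>g\<close>, \<open>h\<close> invertible because \<open>v\<close> is quasi-invertible.\<close>

lemma extremes_preserved_pullback: "\<rho> ` extremes \<subseteq> extremes"
proof safe
  fix v :: 'a assume v: "v \<in> extremes"
  have vq: "v \<in> quasi_invertibles" using v extremes_subset_quasi_invertibles by blast
  have "\<exists>a. \<rho> a \<in> quasi_invertibles \<and> norm (a - v) < 1 / Suc n" for n
    using quasi_invertible_approximation[OF E.map_quasi_invertibles[OF vq], of v "1 / Suc n"]
    by (metis diff_self norm_zero of_nat_0_less_iff zero_less_Suc zero_less_divide_1_iff
        zero_less_divide_iff zero_less_numeral)
  then obtain X where X: "\<And>n. \<rho> (X n) \<in> quasi_invertibles" "\<And>n. norm (X n - v) < 1 / Suc n"
    by metis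
  have "(\<lambda>n. X n - v) \<longlonglongrightarrow> 0"
    by (rule Lim_null_comparison[OF _ LIMSEQ_inverse_real_of_nat])
      (use X(2) in \<open>auto intro!: always_eventually less_imp_le simp: inverse_eq_divide\<close>)
  then have "X \<longlonglongrightarrow> v" by (simp add: LIM_zero_iff)
  from quasi_invertible_perturbation[OF vq this] obtain G H
    where GH: "G \<longlonglongrightarrow> 1" "H \<longlonglongrightarrow> 1" "\<forall>\<^sub>F n in sequentially. X n = G n * v * H n" .
  \<comment> \<open>The conclusion does not depend on \<open>n\<close>: one index at which the
    factorization holds and both factors are invertible suffices.\<close>
  have "\<forall>\<^sub>F n in sequentially. \<rho> v \<in> quasi_invertibles"
    using GH(3) eventually_invertibles[OF GH(1)] eventually_invertibles[OF GH(2)]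
  proof eventually_elim
    case (elim n)
    have "v = (inv_elem (G n) * G n) * v * (H n * inv_elem (H n))"
      using elim by (simp add: inv_elem)
    also have "\<dots> = inv_elem (G n) * X n * inv_elem (H n)" using elim by (simp only: mult.assoc)
    finally have "\<rho> v = \<rho> (inv_elem (G n)) * \<rho> (X n) * \<rho> (inv_elem (H n))" by (metis R.map_simps(2))
    then show ?case
      using X(1)[of n] elim(2,3)
      by (metis quasi_invertibles_mult R.map_invertibles inv_elem_invertibles)
  qed
  then have "\<rho> v \<in> quasi_invertibles" by simp
  moreover have "\<rho> v * star (\<rho> v) * \<rho> v = \<rho> v"
    using extreme_imp_partial_isometry[OF v] by (metis R.map_simps(2,4))
  ultimately show "\<rho> v \<in> extremes" by (intro extreme_of_quasi_invertible)
qed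

end

lemma extremally_rich_unital_pullback_iff:
  assumes "extremally_rich_unital TYPE('b)" "extremally_rich_unital TYPE('c)"
  shows "extremally_rich_unital TYPE('a) \<and> \<rho> ` extremes \<subseteq> extremes \<longleftrightarrow> \<tau> ` extremes \<subseteq> extremes"
  using assms extremes_preserved_if extremally_rich_unital_pullback extremes_preserved_pullback
  by blast

end

subsection \<open>The forced unitization of a unital algebra\<close>

lemma scaleC_diff_left: "(c - d) *\<^sub>C x = c *\<^sub>C x - d *\<^sub>C (x::'a::cstar_algebra)"
  using scaleC_add_left[of c "- d" x] by (simp add: scaleC_minus_left)

text \<open>If \<open>B\<close> is unital, then \<open>u \<mapsto> (to_base u, scalar u)\<close> is an isomorphism of \<open>B\<^sup>+\<close> onto the direct sum of \<open>B\<close> and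
  the scalars.\<close>

definition to_base :: "'a::cstar_algebra unitization \<Rightarrow> 'a" where
  "to_base u = base u + scalar u *\<^sub>C the_unit"

definition of_pair :: "'a::cstar_algebra \<Rightarrow> complex \<Rightarrow> 'a unitization" where
  "of_pair x c = Unitization (x - c *\<^sub>C the_unit) c"

lemma to_base_of_pair [simp]: "to_base (of_pair x c) = x" "scalar (of_pair x c) = c"
  by (simp_all add: to_base_def of_pair_def)

lemma pair_eqI: "to_base u = to_base v \<Longrightarrow> scalar u = scalar v \<Longrightarrow> u = v"
  by (simp add: unitization_eq_iff to_base_def)

lemma scalar_simps [simp]:
  fixes u v :: "'a::cstar_algebra unitization"
  shows "scalar (u + v) = scalar u + scalar v" "scalar (u - v) = scalar u - scalar v"
    "scalar (u * v) = scalar u * scalar v" "scalar (star u) = cnj (scalar u)"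
    "scalar (0 :: 'a unitization) = 0" "scalar (1 :: 'a unitization) = 1"
  by (simp_all add: unitization_defs one_unitization_def)

lemma scalar_sum [simp]:
  "scalar (sum f I) = (\<Sum>i\<in>I. scalar (f i :: 'a::cstar_algebra unitization))"
  by (induction I rule: infinite_finite_induct) simp_all

lemma nonzero_complex_approximation:
  assumes "\<epsilon> > 0"
  obtains \<mu> where "\<mu> \<noteq> 0" "cmod (c - \<mu>) < \<epsilon>" "cnj c = c \<Longrightarrow> cnj \<mu> = \<mu>"
proof (cases "c = 0")
  case True
  then show ?thesis using assms by (intro that[of "of_real (\<epsilon> / 2)"]) auto
qed (use assms that[of c] in auto)

text \<open>Inside the disc, \<open>1 - cmod c\<close> is an admissible perturbation; on the circle
  the parallelogram law excludes every nonzero one.\<close>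

lemma complex_extreme_iff:
  "cmod c \<le> 1 \<and> (\<forall>z. cmod (c + z) \<le> 1 \<and> cmod (c - z) \<le> 1 \<longrightarrow> z = 0) \<longleftrightarrow> cmod c = 1"
proof safe
  assume c: "cmod c \<le> 1" and *: "\<forall>z. cmod (c + z) \<le> 1 \<and> cmod (c - z) \<le> 1 \<longrightarrow> z = 0"
  have "cmod (c + of_real (1 - cmod c)) \<le> 1" "cmod (c - of_real (1 - cmod c)) \<le> 1"
    using norm_triangle_ineq[of c "of_real (1 - cmod c)"] norm_triangle_ineq4[of c "of_real (1 - cmod c)"] c
    by (simp_all only: norm_of_real)
  then show "cmod c = 1" using * by (metis of_real_eq_0_iff right_minus_eq)
next
  fix z assume c: "cmod c = 1" and z: "cmod (c + z) \<le> 1" "cmod (c - z) \<le> 1"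
  have "(cmod (c + z))\<^sup>2 + (cmod (c - z))\<^sup>2 = 2 * (cmod c)\<^sup>2 + 2 * (cmod z)\<^sup>2"
    by (simp add: cmod_power2) (simp add: power2_eq_square algebra_simps)
  moreover have "(cmod (c + z))\<^sup>2 \<le> 1" "(cmod (c - z))\<^sup>2 \<le> 1" using z by (simp_all add: power_le_one)
  ultimately have "(cmod z)\<^sup>2 \<le> 0" unfolding c power_one by linarith
  then show "z = 0" by simp
qed simp

locale unital_algebra =
  fixes type :: "'a::cstar_algebra itself"
  assumes unital: "unital TYPE('a)"
begin

lemma unit [simp]: "the_unit * x = x" "x * the_unit = (x::'a)"
proof -
  obtain e :: 'a where "is_unit_elem e" using unital by (auto simp: unital_def)
  then have "is_unit_elem (the_unit :: 'a)" using the_unit_eqI by metis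
  then show "the_unit * x = x" "x * the_unit = x" by (auto simp: is_unit_elem_def)
qed

lemma star_unit [simp]: "star (the_unit :: 'a) = the_unit"
  by (metis star_mult star_star unit(1) unit(2))

lemma to_base_simps [simp]:
  fixes u v :: "'a unitization"
  shows "to_base (u + v) = to_base u + to_base v" "to_base (u - v) = to_base u - to_base v"
    "to_base (u * v) = to_base u * to_base v" "to_base (star u) = star (to_base u)"
    "to_base (0 :: 'a unitization) = 0" "to_base (1 :: 'a unitization) = the_unit"
  by (simp_all add: to_base_def unitization_defs one_unitization_def scaleC_add_left star_add
      scaleC_diff_left scaleC_simps algebra_simps)

lemma to_base_sum [simp]: "to_base (sum f I) = (\<Sum>i\<in>I. to_base (f i :: 'a unitization))"
  by (induction I rule: infinite_finite_induct) simp_all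

text \<open>On B, left multiplication by \<open>u\<close> is left multiplication by
  \<open>to_base u\<close>, whose operator norm is its norm by the C*-identity.\<close>

lemma norm_pair: "norm u = max (norm (to_base u :: 'a)) (cmod (scalar u))"
proof -
  have l: "lmult u = (\<lambda>x. to_base u * x)"
    by (auto simp: lmult_def to_base_def distrib_right mult_scaleC_left)
  moreover have "lmult (Unitization (to_base u) 0) = (\<lambda>x. to_base u * x)"
    by (auto simp: lmult_def)
  ultimately have "norm (to_base u) \<le> onorm (lmult u)"
    using norm_base_le[of "Unitization (to_base u) 0"] by simp
  moreover have "onorm (lmult u) \<le> norm (to_base u)"
    unfolding l by (rule onorm_bound) (simp_all add: norm_mult_ineq)
  ultimately show ?thesis by (simp add: norm_unitization_def)
qed

lemma invertibles_pair: "u \<in> invertibles \<longleftrightarrow> (to_base u :: 'a) \<in> invertibles \<and> scalar u \<noteq> 0"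
proof
  assume "u \<in> invertibles"
  then obtain v where "u * v = 1" "v * u = 1" by (rule invertiblesE)
  then have "to_base (u * v) = the_unit" "to_base (v * u) = the_unit" "scalar (u * v) = 1" by simp_all
  then show "to_base u \<in> invertibles \<and> scalar u \<noteq> 0"
    unfolding invertibles_def by auto
next
  assume u: "to_base u \<in> invertibles \<and> scalar u \<noteq> 0"
  then obtain y where y: "to_base u * y = the_unit" "y * to_base u = the_unit"
    by (auto simp: invertibles_def)
  show "u \<in> invertibles"
    by (rule invertiblesI[of _ "of_pair y (inverse (scalar u))"]; rule pair_eqI) (use u y in simp_all)
qed

text \<open>In a maximum norm a perturbation is admissible exactly when both coordinates are, so
  perturbing one coordinate at a time decides extremality.\<close>

lemma extremes_pair: "v \<in> extremes \<longleftrightarrow> (to_base v :: 'a) \<in> extremes \<and> cmod (scalar v) = 1"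
proof
  assume v: "v \<in> extremes"
  then have n: "norm v \<le> 1" and ex: "\<And>y. norm (v + y) \<le> 1 \<Longrightarrow> norm (v - y) \<le> 1 \<Longrightarrow> y = 0"
    by (auto simp: extremes_def extreme_point_of_cball_iff)
  have "x = 0" if "norm (to_base v + x) \<le> 1" "norm (to_base v - x) \<le> 1" for x
    using ex[of "of_pair x 0"] that n unfolding norm_pair by (simp, metis to_base_of_pair(1) to_base_simps(5))
  moreover have "c = 0" if "cmod (scalar v + c) \<le> 1" "cmod (scalar v - c) \<le> 1" for c
    using ex[of "of_pair 0 c"] that n unfolding norm_pair by (simp, metis to_base_of_pair(2) scalar_simps(5))
  ultimately show "to_base v \<in> extremes \<and> cmod (scalar v) = 1"
    using n unfolding complex_extreme_iff[symmetric] norm_pair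
    by (auto simp: extremes_def extreme_point_of_cball_iff)
next
  assume "to_base v \<in> extremes \<and> cmod (scalar v) = 1"
  then show "v \<in> extremes"
    unfolding complex_extreme_iff[symmetric]
    by (auto simp: extremes_def extreme_point_of_cball_iff norm_pair intro!: pair_eqI)
qed

lemma quasi_invertibles_pair:
  "u \<in> quasi_invertibles \<longleftrightarrow> (to_base u :: 'a) \<in> quasi_invertibles \<and> scalar u \<noteq> 0"
proof
  assume "u \<in> quasi_invertibles"
  then obtain g v h where u: "u = g * v * h" "g \<in> invertibles" "v \<in> extremes" "h \<in> invertibles"
    by (auto simp: quasi_invertibles_def)
  have "to_base u = to_base g * to_base v * to_base h" by (simp add: u)
  moreover have "to_base g \<in> invertibles" "to_base v \<in> extremes" "to_base h \<in> invertibles" "scalar u \<noteq> 0"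
    using u by (auto simp: invertibles_pair extremes_pair)
  ultimately show "to_base u \<in> quasi_invertibles \<and> scalar u \<noteq> 0"
    unfolding quasi_invertibles_def by blast
next
  assume u: "to_base u \<in> quasi_invertibles \<and> scalar u \<noteq> 0"
  then obtain g v h where "to_base u = g * v * h" "g \<in> invertibles" "v \<in> extremes" "h \<in> invertibles"
    by (auto simp: quasi_invertibles_def)
  then have "u = of_pair g (scalar u) * of_pair v 1 * of_pair h 1"
    "of_pair g (scalar u) \<in> invertibles" "of_pair v 1 \<in> extremes" "of_pair h 1 \<in> invertibles"
    using u by (auto simp: invertibles_pair extremes_pair intro: pair_eqI)
  then show "u \<in> quasi_invertibles" unfolding quasi_invertibles_def by blast
qed

lemma unimodular_dense_pair:
  assumes n: "n \<ge> 1"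
  shows "unimodular_dense n TYPE('a) \<longleftrightarrow> unimodular_dense n TYPE('a unitization)"
proof
  assume a: "unimodular_dense n TYPE('a)"
  show "unimodular_dense n TYPE('a unitization)"
    unfolding unimodular_dense_def
  proof (intro allI impI)
    fix x :: "nat \<Rightarrow> 'a unitization" and \<epsilon> :: real assume \<epsilon>: "\<epsilon> > 0"
    then obtain y where y: "\<forall>k<n. norm (to_base (x k) - y k) < \<epsilon>" "(\<Sum>k<n. star (y k) * y k) \<in> invertibles"
      using a[unfolded unimodular_dense_def, rule_format, of \<epsilon> "\<lambda>k. to_base (x k)"] by blast
    obtain \<mu> where \<mu>: "\<mu> \<noteq> 0" "cmod (scalar (x 0) - \<mu>) < \<epsilon>"
      using nonzero_complex_approximation[OF \<epsilon>] by metis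
    \<comment> \<open>Only entry 0, present because \<open>n \<ge> 1\<close>, is changed; its
      nonzero value makes the scalar part of the Gram element nonzero.\<close>
    define m where "m = (\<lambda>k. scalar (x k))(0 := \<mu>)"
    have "(\<Sum>k<n. (cmod (m k))\<^sup>2) > 0"
      using n \<mu> by (intro sum_pos2[of _ 0]) (auto simp: m_def)
    then have "(\<Sum>k<n. cnj (m k) * m k) \<noteq> 0"
      by (simp add: complex_norm_square[symmetric] mult.commute[of "cnj _"] del: of_real_power
          flip: of_real_sum)
    then have "(\<Sum>k<n. star (of_pair (y k) (m k)) * of_pair (y k) (m k)) \<in> invertibles"
      using y(2) by (simp add: invertibles_pair)
    moreover have "\<forall>k<n. norm (x k - of_pair (y k) (m k)) < \<epsilon>"
      using y(1) \<mu> \<epsilon> by (auto simp: norm_pair m_def)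
    ultimately show "\<exists>y. (\<forall>k<n. norm (x k - y k) < \<epsilon>) \<and> (\<Sum>k<n. star (y k) * y k) \<in> invertibles"
      by (intro exI[of _ "\<lambda>k. of_pair (y k) (m k)"]) simp
  qed
next
  assume u: "unimodular_dense n TYPE('a unitization)"
  show "unimodular_dense n TYPE('a)"
    unfolding unimodular_dense_def
  proof (intro allI impI)
    fix x :: "nat \<Rightarrow> 'a" and \<epsilon> :: real assume "\<epsilon> > 0"
    then obtain z where z: "\<forall>k<n. norm (of_pair (x k) 0 - z k) < \<epsilon>" "(\<Sum>k<n. star (z k) * z k) \<in> invertibles"
      using u[unfolded unimodular_dense_def, rule_format, of \<epsilon> "\<lambda>k. of_pair (x k) 0"] by blast
    then show "\<exists>y. (\<forall>k<n. norm (x k - y k) < \<epsilon>) \<and> (\<Sum>k<n. star (y k) * y k) \<in> invertibles"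
      by (intro exI[of _ "\<lambda>k. to_base (z k)"]) (simp add: norm_pair invertibles_pair)
  qed
qed

lemma tsr_unital_pair: "tsr_unital TYPE('a) = tsr_unital TYPE('a unitization)"
proof -
  have "{enat d | d. d \<ge> 1 \<and> unimodular_dense d TYPE('a)} =
      {enat d | d. d \<ge> 1 \<and> unimodular_dense d TYPE('a unitization)}"
    using unimodular_dense_pair by blast
  then show ?thesis unfolding tsr_unital_def unimodular_dense_def by simp
qed

text \<open>Density for product sets, shared by real rank zero and extremal richness.
  \<open>P 0\<close> lets \<open>x\<close> enter the direct sum as the pair with scalar 0, and the
  last hypothesis is density in the scalar coordinate.\<close>

lemma dense_pair:
  fixes S T :: "'a set" and S' T' :: "'a unitization set"
  assumes T: "\<And>u. u \<in> T' \<longleftrightarrow> to_base u \<in> T \<and> P (scalar u)"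
    and S: "\<And>u. u \<in> S' \<longleftrightarrow> to_base u \<in> S \<and> Q (scalar u)"
    and P0: "P 0"
    and PQ: "\<And>c \<epsilon>. P c \<Longrightarrow> \<epsilon> > 0 \<Longrightarrow> \<exists>\<mu>. Q \<mu> \<and> cmod (c - \<mu>) < \<epsilon>"
  shows "T \<subseteq> closure S \<longleftrightarrow> T' \<subseteq> closure S'"
proof
  assume *: "T \<subseteq> closure S"
  show "T' \<subseteq> closure S'"
  proof (rule subsetI, unfold closure_approachable, intro allI impI)
    fix u and \<epsilon> :: real assume u: "u \<in> T'" and \<epsilon>: "\<epsilon> > 0"
    then have "to_base u \<in> closure S" using * T by blast
    then obtain y where y: "y \<in> S" "norm (y - to_base u) < \<epsilon>"
      using \<epsilon> unfolding closure_approachable dist_norm by blast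
    obtain \<mu> where \<mu>: "Q \<mu>" "cmod (scalar u - \<mu>) < \<epsilon>" using PQ[OF _ \<epsilon>] u T by blast
    show "\<exists>y\<in>S'. dist y u < \<epsilon>"
      using y \<mu> by (intro bexI[of _ "of_pair y \<mu>"]) (simp_all add: S dist_norm norm_pair norm_minus_commute)
  qed
next
  assume *: "T' \<subseteq> closure S'"
  show "T \<subseteq> closure S"
  proof (rule subsetI, unfold closure_approachable, intro allI impI)
    fix x and \<epsilon> :: real assume x: "x \<in> T" and \<epsilon>: "\<epsilon> > 0"
    then have "of_pair x 0 \<in> closure S'" using * T P0 by (metis subsetD to_base_of_pair)
    then obtain u where "u \<in> S'" "norm (u - of_pair x 0) < \<epsilon>"
      using \<epsilon> unfolding closure_approachable dist_norm by blast
    then show "\<exists>y\<in>S. dist y x < \<epsilon>"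
      by (intro bexI[of _ "to_base u"]) (simp_all add: S dist_norm norm_pair)
  qed
qed

lemma real_rank_zero_unital_pair:
  "real_rank_zero_unital TYPE('a) \<longleftrightarrow> real_rank_zero_unital TYPE('a unitization)"
  unfolding real_rank_zero_unital_def
proof (rule dense_pair)
  show "u \<in> self_adjoints \<longleftrightarrow> to_base u \<in> self_adjoints \<and> cnj (scalar u) = scalar u" for u :: "'a unitization"
    unfolding self_adjoints_def mem_Collect_eq
    by (metis pair_eqI scalar_simps(4) to_base_simps(4))
  then show "u \<in> invertibles \<inter> self_adjoints \<longleftrightarrow>
      to_base u \<in> invertibles \<inter> self_adjoints \<and> (scalar u \<noteq> 0 \<and> cnj (scalar u) = scalar u)"
    for u :: "'a unitization"
    by (auto simp: invertibles_pair)
  show "\<exists>\<mu>. (\<mu> \<noteq> 0 \<and> cnj \<mu> = \<mu>) \<and> cmod (c - \<mu>) < \<epsilon>" if "cnj c = c" "\<epsilon> > 0" for c \<epsilon>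
    using nonzero_complex_approximation[OF that(2), of c] that(1) by metis
qed simp

lemma extremally_rich_unital_pair:
  "extremally_rich_unital TYPE('a) \<longleftrightarrow> extremally_rich_unital TYPE('a unitization)"
proof -
  have "UNIV \<subseteq> closure (quasi_invertibles :: 'a set) \<longleftrightarrow>
      UNIV \<subseteq> closure (quasi_invertibles :: 'a unitization set)"
  proof (rule dense_pair)
    show "\<exists>\<mu>. \<mu> \<noteq> 0 \<and> cmod (c - \<mu>) < \<epsilon>" if "True" "\<epsilon> > 0" for c \<epsilon>
      using nonzero_complex_approximation[OF that(2), of c] by metis
  qed (simp_all add: quasi_invertibles_pair)
  then show ?thesis by (simp add: extremally_rich_unital_def top.extremum_unique)
qed

end

section \<open>Reduction of all notions to forced unitizations\<close>

lemma tsr_eq: "tsr TYPE('a::cstar_algebra) = tsr_unital TYPE('a unitization)"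
  by (simp add: tsr_def unital_algebra.tsr_unital_pair unital_algebra_def)

lemma real_rank_zero_iff:
  "real_rank_zero TYPE('a::cstar_algebra) \<longleftrightarrow> real_rank_zero_unital TYPE('a unitization)"
  by (simp add: real_rank_zero_def unital_algebra.real_rank_zero_unital_pair unital_algebra_def)

lemma extremally_rich_iff:
  "extremally_rich TYPE('a::cstar_algebra) \<longleftrightarrow> extremally_rich_unital TYPE('a unitization)"
  by (simp add: extremally_rich_def unital_algebra.extremally_rich_unital_pair unital_algebra_def)

lemma scalar_map_unitization [simp]: "scalar (map_unitization \<phi> u) = scalar u"
  and base_map_unitization [simp]: "base (map_unitization \<phi> u) = \<phi> (base u)"
  by (cases u; simp)+

text \<open>When \<phi> preserves units, its extension acts on pairs as \<phi> together with the
  identity on scalars, and an extreme point \<open>v\<close> is tested through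
  \<open>of_pair v 1\<close>. Otherwise the definition already uses the extension.\<close>

lemma extreme_point_preserving_iff:
  fixes \<phi> :: "'a::cstar_algebra \<Rightarrow> 'b::cstar_algebra"
  assumes \<phi>: "star_hom \<phi>"
  shows "extreme_point_preserving \<phi> \<longleftrightarrow> map_unitization \<phi> ` extremes \<subseteq> extremes"
proof (cases "unital TYPE('a) \<and> unital TYPE('b) \<and> \<phi> the_unit = the_unit")
  case True
  interpret A: unital_algebra "TYPE('a)" by standard (use True in blast)
  interpret B: unital_algebra "TYPE('b)" by standard (use True in blast)
  have m: "to_base (map_unitization \<phi> u) = \<phi> (to_base u)" for u
    using \<phi> True by (simp add: to_base_def star_hom_def)
  have "\<phi> ` extremes \<subseteq> extremes \<longleftrightarrow> map_unitization \<phi> ` extremes \<subseteq> extremes"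
  proof safe
    fix u :: "'a unitization" assume "\<phi> ` extremes \<subseteq> extremes" "u \<in> extremes"
    then show "map_unitization \<phi> u \<in> extremes"
      by (auto simp: A.extremes_pair B.extremes_pair m)
  next
    fix v :: 'a assume *: "map_unitization \<phi> ` extremes \<subseteq> extremes" "v \<in> extremes"
    then have "of_pair v 1 \<in> extremes" by (simp add: A.extremes_pair)
    then have "map_unitization \<phi> (of_pair v 1) \<in> extremes" using * by blast
    then show "\<phi> v \<in> extremes" by (simp add: B.extremes_pair m)
  qed
  then show ?thesis using True by (simp add: extreme_point_preserving_def)
qed (auto simp: extreme_point_preserving_def)

lemma unital_star_hom_map_unitization:
  assumes "star_hom \<phi>"
  shows "unital_star_hom (map_unitization \<phi>)"
proof
  have add: "\<phi> (x + y) = \<phi> x + \<phi> y" for x y using assms by (simp add: star_hom_def)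
  have "\<phi> 0 = 0" using add[of 0 0] by simp
  then show "map_unitization \<phi> 1 = 1" by (simp add: one_unitization_def)
  show "star_hom (map_unitization \<phi>)"
    using assms by (simp add: star_hom_def unitization_defs)
qed

theorem theorem4p1:
  fixes \<tau> :: "'b::cstar_algebra \<Rightarrow> 'd::cstar_algebra"
    and \<pi> :: "'c::cstar_algebra \<Rightarrow> 'd"
    and \<eta> :: "'a::cstar_algebra \<Rightarrow> 'b"
    and \<rho> :: "'a \<Rightarrow> 'c"
  assumes "star_hom \<tau>" and "star_hom \<pi>" and "surj \<pi>"
    and "star_hom \<eta>" and "star_hom \<rho>" and "\<tau> \<circ> \<eta> = \<pi> \<circ> \<rho>"
    and pullback: "bij_betw (\<lambda>a. (\<eta> a, \<rho> a)) UNIV {(b, c). \<tau> b = \<pi> c}"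
  shows "surj \<eta> \<and>
    tsr TYPE('a) \<le> max (tsr TYPE('b)) (tsr TYPE('c)) \<and>
    (real_rank_zero TYPE('b) \<and> real_rank_zero TYPE('c) \<longrightarrow> real_rank_zero TYPE('a)) \<and>
    (extremally_rich TYPE('b) \<and> extremally_rich TYPE('c) \<longrightarrow>
       extremally_rich TYPE('d) \<and>
       ((extremally_rich TYPE('a) \<and> extreme_point_preserving \<rho>) \<longleftrightarrow>
          extreme_point_preserving \<tau>))"
proof -
  have inj: "a = a'" if "\<eta> a = \<eta> a'" "\<rho> a = \<rho> a'" for a a'
    using pullback that by (auto simp: bij_betw_def inj_on_def)
  have glue: "\<exists>a. \<eta> a = b \<and> \<rho> a = c" if "\<tau> b = \<pi> c" for b c
  proof -
    have "(b, c) \<in> range (\<lambda>a. (\<eta> a, \<rho> a))"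
      unfolding bij_betw_imp_surj_on[OF pullback] using that by simp
    then show ?thesis by auto
  qed
  have comm: "\<tau> (\<eta> a) = \<pi> (\<rho> a)" for a using assms(6) by (metis comp_apply)
  have surj: "surj \<eta>" using glue \<open>surj \<pi>\<close> by (metis surj_def)
  \<comment> \<open>Unital extensions keep the scalar, so elements with equal image in the
    unitization of D have equal scalars and bases that agree in D: unitization turns the pullback
    into a pullback.\<close>
  interpret unital_pullback "map_unitization \<tau>" "map_unitization \<pi>" "map_unitization \<eta>" "map_unitization \<rho>"
  proof (intro unital_pullback.intro surjective_star_hom.intro unital_star_hom_map_unitization assms
      surjective_star_hom_axioms.intro unital_pullback_axioms.intro)
    show "surj (map_unitization \<pi>)"
    proof (rule surjI)
      show "map_unitization \<pi> (Unitization (inv \<pi> (base u)) (scalar u)) = u" for u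
        by (simp add: unitization_eq_iff surj_f_inv_f[OF \<open>surj \<pi>\<close>])
    qed
    show "map_unitization \<tau> (map_unitization \<eta> u) = map_unitization \<pi> (map_unitization \<rho> u)" for u
      by (simp add: unitization_eq_iff comm)
    show "\<exists>u. map_unitization \<eta> u = v \<and> map_unitization \<rho> u = w"
      if "map_unitization \<tau> v = map_unitization \<pi> w" for v w
    proof -
      have "\<tau> (base v) = \<pi> (base w)" using arg_cong[OF that, of base] by simp
      then obtain a where "\<eta> a = base v" "\<rho> a = base w" using glue by blast
      moreover have "scalar v = scalar w" using arg_cong[OF that, of scalar] by simp
      ultimately show ?thesis
        by (intro exI[of _ "Unitization a (scalar v)"]) (simp add: unitization_eq_iff)
    qed
    show "u = v" if "map_unitization \<eta> u = map_unitization \<eta> v" "map_unitization \<rho> u = map_unitization \<rho> v" for u v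
      using that inj by (simp add: unitization_eq_iff)
  qed
  show ?thesis
    unfolding tsr_eq real_rank_zero_iff extremally_rich_iff
      extreme_point_preserving_iff[OF \<open>star_hom \<tau>\<close>] extreme_point_preserving_iff[OF \<open>star_hom \<rho>\<close>]
    using surj tsr_unital_pullback real_rank_zero_unital_pullback extremally_rich_unital_quotient
      extremally_rich_unital_pullback_iff
    by blast
qed

end
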